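(* Let $\{\mathbf{U}_i\}_{i\ge1}$ be an infinite deterministic sequence in $[0,1]^d$ such that $\mathbb{P}_{m+n}=(m+n)^{-1}\sum_{i=1}^{m+n}\delta_{\mathbf{U}_i}\overset{w}{\to}\mathcal{U}^d$ as $\min(m,n)\to\infty$. Put $N=m+n$ and let $\pi_N$ be drawn uniformly at random from the set $S_N$ of all permutations of $\{1,\ldots,N\}$. For $\mathbf{a}\in\mathcal{S}^{d-1}=\{\mathbf{x}\in\mathbb{R}^d:\|\mathbf{x}\|=1\}$ and $r\in\mathbb{R}$ define $$\Theta_{m,n}(\mathbf{a},r)=\sqrt{\frac{mn}{m+n}}\Big(\frac1m\sum_{i=1}^m\mathbf{1}(\mathbf{a}^\top\mathbf{U}_{\pi_N(i)}\le r)-\frac1n\sum_{j=m+1}^{m+n}\mathbf{1}(\mathbf{a}^\top\mathbf{U}_{\pi_N(j)}\le r)\Big).$$ Then, as $\min(m,n)\to\infty$, $$E_{m,n}:=\int_{\mathcal{S}^{d-1}}\int_{\mathbb{R}}\Theta_{m,n}^2(\mathbf{a},r)\,dr\,d\kappa(\mathbf{a})\ \overset{w}{\longrightarrow}\ E:=\int_{\mathcal{S}^{d-1}}\int_{\mathbb{R}}\Theta^2(\mathbf{a},r)\,dr\,d\kappa(\mathbf{a}),$$ where $\kappa$ is the uniform measure on $\mathcal{S}^{d-1}$ and $\Theta(\cdot,\cdot)$ is a mean $0$ Gaussian process on $\mathcal{S}^{d-1}\times\mathbb{R}$ with covariance kernel $$C\big((\mathbf{a}_1,r_1),(\mathbf{a}_2,r_2)\big)=\mathbb{P}(\mathbf{a}_1^\top\tilde{\mathbf{U}}\le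 r_1,\ \mathbf{a}_2^\top\tilde{\mathbf{U}}\le r_2)-\mathbb{P}(\mathbf{a}_1^\top\tilde{\mathbf{U}}\le r_1)\,\mathbb{P}(\mathbf{a}_2^\top\tilde{\mathbf{U}}\le r_2),$$ with $\tilde{\mathbf{U}}\sim\mathcal{U}^d$.
   Context: $\mathcal{U}^d$ is the uniform distribution on $[0,1]^d$; $\overset{w}{\to}$ denotes weak convergence; $\mathbf{1}(\cdot)$ is the indicator function. *)

theory Defs
  imports "HOL-Probability.Probability" "HOL-Combinatorics.Permutations"
begin

text \<open>The library's \<^const>\<open>weak_conv_m\<close> only covers sequences of measures on the reals.\<close>

definition weak_conv_filter ::
    "('i \<Rightarrow> 'a::topological_space measure) \<Rightarrow> 'a measure \<Rightarrow> 'i filter \<Rightarrow> bool" where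
  "weak_conv_filter \<mu> \<nu> F \<longleftrightarrow>
     (\<forall>f :: 'a \<Rightarrow> real. continuous_on UNIV f \<and> bounded (range f) \<longrightarrow>
        ((\<lambda>i. \<integral>x. f x \<partial>\<mu> i) \<longlongrightarrow> (\<integral>x. f x \<partial>\<nu>)) F)"

lemma weak_conv_filter_sequentially_iff:
  assumes "\<And>k. real_distribution (\<mu> k)" "real_distribution \<nu>"
  shows "weak_conv_filter \<mu> \<nu> sequentially \<longleftrightarrow> weak_conv_m \<mu> \<nu>"
proof
  assume *: "weak_conv_filter \<mu> \<nu> sequentially"
  show "weak_conv_m \<mu> \<nu>"
  proof (rule integral_bdd_continuous_conv_imp_weak_conv[of \<mu> \<nu>, OF assms])
    fix f :: "real \<Rightarrow> real"
    assume f: "\<And>x. isCont f x" "\<And>x. \<bar>f x\<bar> \<le> 1"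
    have "continuous_on UNIV f"
      using f(1) by (simp add: continuous_at_imp_continuous_on)
    moreover have "bounded (range f)"
      using f(2) by (auto intro!: boundedI[of _ 1])
    ultimately show "(\<lambda>n. \<integral>x. f x \<partial>\<mu> n) \<longlonglongrightarrow> (\<integral>x. f x \<partial>\<nu>)"
      using * unfolding weak_conv_filter_def by simp
  qed
next
  assume *: "weak_conv_m \<mu> \<nu>"
  show "weak_conv_filter \<mu> \<nu> sequentially"
    unfolding weak_conv_filter_def
  proof (intro allI impI, elim conjE)
    fix f :: "real \<Rightarrow> real"
    assume f: "continuous_on UNIV f" "bounded (range f)"
    then obtain B where "\<And>x. norm (f x) \<le> B"
      by (auto simp: bounded_iff)
    with f show "(\<lambda>n. \<integral>x. f x \<partial>\<mu> n) \<longlonglongrightarrow> (\<integral>x. f x \<partial>\<nu>)"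
      by (intro weak_conv_imp_integral_bdd_continuous_conv[OF assms *])
        (auto simp: continuous_on_eq_continuous_at)
  qed
qed

definition min_at_top :: "(nat \<times> nat) filter" where
  "min_at_top = filtercomap (\<lambda>(m, n). min m n) at_top"

definition empirical_measure :: "(nat \<Rightarrow> 'a::topological_space) \<Rightarrow> nat \<Rightarrow> 'a measure" where
  "empirical_measure U N =
     measure_of UNIV (sets borel)
       (\<lambda>A. ennreal (1 / real N) * (\<Sum>i=1..N. emeasure (return borel (U i)) A))"

lemma
  shows space_empirical_measure [simp]: "space (empirical_measure U N) = UNIV"
    and sets_empirical_measure [simp, measurable_cong]: "sets (empirical_measure U N) = sets borel"
proof -
  have "sets borel \<subseteq> Pow UNIV"
    by simp
  then show "space (empirical_measure U N) = UNIV" "sets (empirical_measure U N) = sets borel"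
    unfolding empirical_measure_def
    using sets.sigma_sets_eq[of borel] by (simp_all add: space_measure_of sets_measure_of)
qed

lemma emeasure_empirical_measure:
  assumes "A \<in> sets borel"
  shows "emeasure (empirical_measure U N) A =
    ennreal (1 / real N) * (\<Sum>i=1..N. indicator A (U i))"
proof -
  let ?\<mu> = "\<lambda>A. ennreal (1 / real N) * (\<Sum>i=1..N. emeasure (return borel (U i)) A)"
  have "emeasure (empirical_measure U N) A = ?\<mu> A"
  proof (rule emeasure_measure_of)
    show "empirical_measure U N = measure_of UNIV (sets borel) ?\<mu>"
      by (fact empirical_measure_def)
    show "positive (sets (empirical_measure U N)) ?\<mu>"
      by (simp add: positive_def)
    show "countably_additive (sets (empirical_measure U N)) ?\<mu>"
      unfolding countably_additive_def
    proof (intro allI impI)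
      fix B :: "nat \<Rightarrow> 'a set"
      assume "range B \<subseteq> sets (empirical_measure U N)" "disjoint_family B"
      then have "(\<Sum>k. emeasure (return borel (U i)) (B k)) =
          emeasure (return borel (U i)) (\<Union> (range B))" for i
        by (intro suminf_emeasure) auto
      then show "(\<Sum>k. ?\<mu> (B k)) = ?\<mu> (\<Union> (range B))"
        by (simp add: suminf_sum)
    qed
  qed (use assms in auto)
  with assms show ?thesis
    by simp
qed

definition uniform_cube :: "(real ^ 'd) measure" where
  "uniform_cube = uniform_measure lborel (cbox 0 1)"

text \<open>
  The uniform distribution on the unit sphere as normalised cone measure: a Borel set \<open>A\<close> of
  directions receives the share of the volume of the unit ball that lies on the rays through \<open>A\<close>.
\<close>

definition sphere_uniform :: "(real ^ 'd) measure" where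
  "sphere_uniform =
     restrict_space (distr (uniform_measure lborel (ball 0 1)) borel (\<lambda>x. x /\<^sub>R norm x)) (sphere 0 1)"

lemma space_sphere_uniform [simp]: "space sphere_uniform = sphere 0 1"
  by (simp add: sphere_uniform_def space_restrict_space)

lemma sets_sphere_uniform [measurable_cong]:
  "sets sphere_uniform = sets (restrict_space borel (sphere 0 1))"
  by (simp add: sphere_uniform_def sets_restrict_space)

lemma emeasure_sphere_uniform:
  fixes A :: "(real ^ 'd) set"
  assumes "A \<in> sets borel" "A \<subseteq> sphere 0 1"
  shows "emeasure sphere_uniform A =
    emeasure lborel {x \<in> ball 0 1. x /\<^sub>R norm x \<in> A} / emeasure lborel (ball 0 1 :: (real ^ 'd) set)"
proof -
  have "{x \<in> ball 0 1. x /\<^sub>R norm x \<in> A} = ball 0 1 \<inter> (\<lambda>x. x /\<^sub>R norm x) -` A"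
    by auto
  then show ?thesis
    using assms measurable_sets[of "\<lambda>x::real^'d. x /\<^sub>R norm x" borel borel A]
    by (simp add: sphere_uniform_def emeasure_restrict_space emeasure_distr)
qed

lemma prob_space_sphere_uniform: "prob_space (sphere_uniform :: (real ^ 'd) measure)"
proof
  have "{x \<in> ball 0 1. x /\<^sub>R norm x \<in> sphere 0 (1::real)} = ball 0 1 - {0 :: real ^ 'd}"
    by auto
  moreover have "emeasure lborel (ball 0 1 - {0 :: real ^ 'd}) = emeasure lborel (ball 0 1 :: (real^'d) set)"
    by (rule emeasure_Diff_null_set) auto
  moreover have "emeasure lborel (ball 0 1 :: (real^'d) set) \<noteq> 0"
    using content_ball_pos[of 1 "0 :: real ^ 'd"] by (auto simp: measure_def)
  moreover have "emeasure lborel (ball 0 1 :: (real^'d) set) \<noteq> \<infinity>"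
    using emeasure_lborel_ball_finite[of "0::real^'d" 1] by auto
  ultimately show "emeasure sphere_uniform (space (sphere_uniform :: (real ^ 'd) measure)) = 1"
    by (simp add: emeasure_sphere_uniform ennreal_divide_self less_top zero_less_iff_neq_zero)
qed

text \<open>The sort constraint is inherited from \<open>measure_orthogonal_image\<close>.\<close>

lemma sphere_uniform_orthogonal_invariant:
  fixes f :: "real ^ 'd::{finite,wellorder} \<Rightarrow> real ^ 'd::_"
  assumes "orthogonal_transformation f" "A \<in> sets sphere_uniform"
  shows "emeasure sphere_uniform (f ` A) = emeasure sphere_uniform A"
proof -
  let ?S = "\<lambda>A. {x \<in> ball 0 1. x /\<^sub>R norm x \<in> A} :: (real ^ 'd::_) set"
  have A: "A \<in> sets borel" "A \<subseteq> sphere 0 1"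
    using assms(2) by (auto simp: sets_sphere_uniform sets_restrict_space)
  have norm_f: "norm (f x) = norm x" for x
    using assms(1) by (rule orthogonal_transformation_norm)
  have bij: "bij f" and inv_f: "orthogonal_transformation (inv f)" and lin: "linear f"
    using assms(1)
    by (auto simp: orthogonal_transformation_bij orthogonal_transformation_inv
        orthogonal_transformation_linear)
  have "inv f \<in> borel_measurable borel"
    using inv_f by (intro borel_measurable_continuous_onI linear_continuous_on)
      (simp add: orthogonal_transformation_linear linear_conv_bounded_linear[symmetric])
  moreover have "f ` A = inv f -` A"
    using bij bij_vimage_eq_inv_image[OF bij_imp_bij_inv[OF bij], of A] by (simp add: inv_inv_eq)
  ultimately have fA: "f ` A \<in> sets borel"
    using measurable_sets[of "inv f" borel borel A] A(1) by simp
  have fA': "f ` A \<subseteq> sphere 0 1"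
    using A(2) by (auto simp: norm_f)
  have borel: "?S B \<in> sets borel" if "B \<in> sets borel" for B
    using that by measurable
  have eq: "emeasure lborel (?S B) = ennreal (measure lebesgue (?S B))"
    and lm: "?S B \<in> lmeasurable" if "B \<in> sets borel" for B
  proof -
    have "bounded (?S B)"
      by (rule bounded_subset[of "ball 0 1"]) auto
    then show "?S B \<in> lmeasurable"
      using borel[OF that] by (intro bounded_set_imp_lmeasurable) auto
    then show "emeasure lborel (?S B) = ennreal (measure lebesgue (?S B))"
      using borel[OF that] emeasure_eq_measure2[of "?S B" lebesgue] by simp
  qed
  have "?S (f ` A) = f ` ?S A"
  proof (intro subset_antisym subsetI)
    fix y assume y: "y \<in> ?S (f ` A)"
    obtain x where x: "y = f x"
      using bij by (metis bij_pointE)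
    have "f (x /\<^sub>R norm x) \<in> f ` A"
      using y lin by (simp add: x norm_f linear_scale)
    then have "x /\<^sub>R norm x \<in> A"
      using bij by (simp add: bij_is_inj inj_image_mem_iff)
    then show "y \<in> f ` ?S A"
      using y by (auto simp: x norm_f)
  qed (use lin in \<open>auto simp: norm_f linear_scale[symmetric]\<close>)
  then have "measure lebesgue (?S (f ` A)) = measure lebesgue (?S A)"
    using measure_orthogonal_image[OF assms(1) lm[OF A(1)]] by simp
  then show ?thesis
    unfolding emeasure_sphere_uniform[OF A] emeasure_sphere_uniform[OF fA fA'] eq[OF A(1)] eq[OF fA]
    by (rule arg_cong)
qed

definition normal_law :: "real measure \<Rightarrow> bool" where
  "normal_law \<nu> \<longleftrightarrow>
     (\<exists>\<mu>. \<nu> = return borel \<mu> \<or> (\<exists>\<sigma>>0. \<nu> = density lborel (\<lambda>x. ennreal (normal_density \<mu> \<sigma> x))))"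

text \<open>
  Joint normality of the finite-dimensional marginals, possibly degenerate, is normality of all
  linear combinations of the coordinates.
\<close>

definition gaussian_process :: "'w measure \<Rightarrow> 't set \<Rightarrow> ('t \<Rightarrow> 'w \<Rightarrow> real) \<Rightarrow> bool" where
  "gaussian_process M T X \<longleftrightarrow>
     prob_space M \<and> (\<forall>t\<in>T. X t \<in> borel_measurable M) \<and>
     (\<forall>I c. finite I \<and> I \<subseteq> T \<longrightarrow> normal_law (distr M borel (\<lambda>\<omega>. \<Sum>t\<in>I. c t * X t \<omega>)))"

definition mean_fun :: "'w measure \<Rightarrow> ('t \<Rightarrow> 'w \<Rightarrow> real) \<Rightarrow> 't \<Rightarrow> real" where
  "mean_fun M X t = (\<integral>\<omega>. X t \<omega> \<partial>M)"

definition cov_kernel :: "'w measure \<Rightarrow> ('t \<Rightarrow> 'w \<Rightarrow> real) \<Rightarrow> 't \<Rightarrow> 't \<Rightarrow> real" where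
  "cov_kernel M X s t = (\<integral>\<omega>. (X s \<omega> - mean_fun M X s) * (X t \<omega> - mean_fun M X t) \<partial>M)"

definition halfspace_kernel :: "(real ^ 'd) \<times> real \<Rightarrow> (real ^ 'd) \<times> real \<Rightarrow> real" where
  "halfspace_kernel = (\<lambda>(a1, r1) (a2, r2).
     measure uniform_cube {u. a1 \<bullet> u \<le> r1 \<and> a2 \<bullet> u \<le> r2} -
     measure uniform_cube {u. a1 \<bullet> u \<le> r1} * measure uniform_cube {u. a2 \<bullet> u \<le> r2})"

definition Theta_perm ::
    "(nat \<Rightarrow> real ^ 'd) \<Rightarrow> nat \<Rightarrow> nat \<Rightarrow> (nat \<Rightarrow> nat) \<Rightarrow> (real ^ 'd) \<times> real \<Rightarrow> real" where
  "Theta_perm U m n p = (\<lambda>(a, r).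
     sqrt (real m * real n / real (m + n)) *
       (1 / real m * (\<Sum>i=1..m. indicator {u. a \<bullet> u \<le> r} (U (p i))) -
        1 / real n * (\<Sum>j=m+1..m+n. indicator {u. a \<bullet> u \<le> r} (U (p j)))))"

definition sphere_energy :: "((real ^ 'd) \<times> real \<Rightarrow> real) \<Rightarrow> real" where
  "sphere_energy h = (\<integral>a. (\<integral>r. (h (a, r))\<^sup>2 \<partial>lborel) \<partial>sphere_uniform)"

definition random_permutation :: "nat \<Rightarrow> (nat \<Rightarrow> nat) measure" where
  "random_permutation N = measure_pmf (pmf_of_set {p. p permutes {1..N}})"

end

theory Submission
  imports Defs
begin

text \<open>
  Weak convergence of the nonnegative energies follows from convergence of their Laplace transforms,
  since the substitution \<open>y = exp (- x)\<close> turns these into moments on the unit interval. To compute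
  the Laplace transform, the integral of the squared field over directions and levels is replaced by
  an average over \<open>K\<close> random points \<open>t\<^sub>1, \<dots>, t\<^sub>K\<close>, and \<open>exp (- s x\<^sup>2)\<close> is the characteristic
  function of a Gaussian \<open>z\<close>. This reduces everything, up to an error of order \<open>1 / K\<close> controlled by
  fourth moments, to the characteristic functions of the linear combinations of the field at the
  points \<open>t\<^sub>1, \<dots>, t\<^sub>K\<close>. No tightness in a function space is needed.

  Such a linear combination of the permutation field is a two-sample statistic \<open>W\<close> of a finite
  population. Swapping an element of the first sample with one of the second gives an exchangeable
  pair with exact linear regression, from which the fourth moment bound follows, and the
  characteristic function \<open>\<phi>\<close> of \<open>W\<close> satisfies \<open>\<phi>' t = - v t \<phi> t\<close> up to an error of order
  \<open>(1 / m + 1 / n)\<^bsup>1/2\<^esup>\<close>, where \<open>v\<close> is the population variance. Hyperplanes being Lebesgue null, the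
  weak convergence of the points makes \<open>v\<close> converge to the variance given by the halfspace kernel.
\<close>

section \<open>Laplace transforms and weak convergence\<close>

text \<open>The averaging step rests on \<open>exp (- E y)\<close> being within
  \<open>E y^2 / K\<close> of \<open>(E exp (- y / K)) ^ K\<close>, a power that is an expectation
  over \<open>K\<close> independent points. The order of limits matters: the sample sizes grow with
  \<open>K\<close> fixed, and \<open>K\<close> grows afterwards. This is legitimate because one
  constant bounds the fourth moments of all the permutation fields and of the limit. An obstacle is
  that levels range over the whole line, which carries no uniform probability. Projections of the
  unit cube onto unit directions are bounded by the dimension, so both fields vanish at larger
  levels (the limit field almost surely), and levels can be drawn from a bounded interval. The paths
  of the limit field have no regularity beyond joint measurability, so statements about almost every
  path come from Fubini arguments. Escape of energy to infinity is excluded by the Laplace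
  transforms at small arguments.\<close>

lemma Laplace_conv_imp_exp_weighted_conv:
  fixes M :: "nat \<Rightarrow> 'a measure" and Y :: "nat \<Rightarrow> 'a \<Rightarrow> real" and N :: "'b measure" and Z :: "'b \<Rightarrow> real"
    and f :: "real \<Rightarrow> real"
  assumes M: "\<And>k. prob_space (M k)" and N: "prob_space N"
    and Y: "\<And>k. Y k \<in> borel_measurable (M k)" "\<And>k \<omega>. Y k \<omega> \<ge> 0"
    and Z: "Z \<in> borel_measurable N" "\<And>\<omega>. Z \<omega> \<ge> 0"
    and L: "\<And>s. s \<ge> 0 \<Longrightarrow> (\<lambda>k. \<integral>\<omega>. exp (- s * Y k \<omega>) \<partial>M k) \<longlonglongrightarrow> (\<integral>\<omega>. exp (- s * Z \<omega>) \<partial>N)"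
    and f: "continuous_on UNIV f" "\<And>x. \<bar>f x\<bar> \<le> B" and d: "d > 0"
  shows "(\<lambda>k. \<integral>\<omega>. exp (- d * Y k \<omega>) * f (Y k \<omega>) \<partial>M k) \<longlonglongrightarrow> (\<integral>\<omega>. exp (- d * Z \<omega>) * f (Z \<omega>) \<partial>N)"
proof -
  \<comment> \<open>The substitution is \<open>y = exp (- d * x)\<close>. The weight becomes the
    factor \<open>y\<close>, which forces \<open>g\<close> to 0 at \<open>y = 0\<close>, the image
    of x = infinity; so \<open>g\<close> is continuous on the closed interval although
    \<open>f\<close> may have no limit at infinity.\<close>
  define g where "g y = (if y = 0 then 0 else y * f (- ln y / d))" for y :: real
  have g_exp: "exp (- d * x) * f x = g (exp (- d * x))" for x
    using d by (simp add: g_def)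
  have cont: "continuous_on {0..1} g"
  proof (rule continuous_on_eq_continuous_within[THEN iffD2], rule ballI)
    fix y :: real assume "y \<in> {0..1}"
    show "continuous (at y within {0..1}) g"
    proof (cases "y = 0")
      case True
      have "(g \<longlongrightarrow> 0) (at 0 within {0..1})"
      proof (rule Lim_null_comparison)
        show "\<forall>\<^sub>F y in at 0 within {0..1}. norm (g y) \<le> B * \<bar>y\<bar>"
          using f(2) by (intro always_eventually) (auto simp: g_def abs_mult mult.commute[of B] intro!: mult_left_mono)
        show "((\<lambda>y. B * \<bar>y\<bar>) \<longlongrightarrow> 0) (at 0 within {0..1})"
          by (intro tendsto_mult_right_zero tendsto_rabs_zero tendsto_ident_at)
      qed
      then show ?thesis
        unfolding True continuous_within by (simp add: g_def)
    next
      case False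
      then have y: "y > 0"
        using \<open>y \<in> {0..1}\<close> by simp
      have "continuous_on {0<..} (\<lambda>y. y * f (- ln y / d))"
        by (intro continuous_intros continuous_on_compose2[OF f(1)]) (use d in auto)
      then have "continuous_on {0<..} g"
        by (rule continuous_on_cong[THEN iffD1, rotated 2]) (auto simp: g_def)
      then have "continuous (at y) g"
        using y by (simp add: continuous_on_eq_continuous_at)
      then show ?thesis
        by (rule continuous_at_imp_continuous_within)
    qed
  qed
  have f_meas [measurable]: "f \<in> borel_measurable borel"
    using f(1) by (rule borel_measurable_continuous_onI)
  \<comment> \<open>A monomial in \<open>exp (- d * x)\<close> is
    \<open>exp (- (i * d) * x)\<close>, so polynomials are covered by the hypothesis
    \<open>L\<close> at multiples of \<open>d\<close>; Weierstrass approximation then reaches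
    \<open>g\<close>.\<close>
  have poly: "(\<lambda>k. \<integral>\<omega>. p (exp (- d * Y k \<omega>)) \<partial>M k) \<longlonglongrightarrow> (\<integral>\<omega>. p (exp (- d * Z \<omega>)) \<partial>N)"
    and int_poly: "\<And>k. integrable (M k) (\<lambda>\<omega>. p (exp (- d * Y k \<omega>)))" "integrable N (\<lambda>\<omega>. p (exp (- d * Z \<omega>)))"
    if p_poly: "real_polynomial_function p" for p
  proof -
    obtain a n where p: "p = (\<lambda>x. \<Sum>i\<le>n. a i * x ^ i)"
      using p_poly by (auto simp: real_polynomial_function_iff_sum)
    have eq: "exp (- d * x) ^ i = exp (- (real i * d) * x)" for x i
      by (simp flip: exp_of_nat_mult add: mult.assoc)
    have exp_int: "integrable Q (\<lambda>\<omega>. exp (- (real i * d) * X \<omega>))"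
      if "prob_space Q" "X \<in> borel_measurable Q" "\<And>\<omega>. X \<omega> \<ge> 0" for Q i and X :: "'z \<Rightarrow> real"
    proof -
      interpret prob_space Q by fact
      have [measurable]: "X \<in> borel_measurable Q" by fact
      show ?thesis
        using that d by (intro integrable_const_bound[where B = 1]) auto
    qed
    have integral_sum_exp: "(\<integral>\<omega>. (\<Sum>i\<le>n. a i * exp (- (real i * d) * X \<omega>)) \<partial>Q) =
        (\<Sum>i\<le>n. a i * (\<integral>\<omega>. exp (- (real i * d) * X \<omega>) \<partial>Q))"
      if "prob_space Q" "X \<in> borel_measurable Q" "\<And>\<omega>. X \<omega> \<ge> 0" for Q and X :: "'z \<Rightarrow> real"
      by (subst Bochner_Integration.integral_sum) (intro integrable_mult_right exp_int that, simp)
    show "integrable (M k) (\<lambda>\<omega>. p (exp (- d * Y k \<omega>)))" for k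
      unfolding p eq by (intro Bochner_Integration.integrable_sum integrable_mult_right exp_int M Y)
    show "integrable N (\<lambda>\<omega>. p (exp (- d * Z \<omega>)))"
      unfolding p eq by (intro Bochner_Integration.integrable_sum integrable_mult_right exp_int N Z)
    have "(\<lambda>k. \<Sum>i\<le>n. a i * (\<integral>\<omega>. exp (- (real i * d) * Y k \<omega>) \<partial>M k)) \<longlonglongrightarrow>
        (\<Sum>i\<le>n. a i * (\<integral>\<omega>. exp (- (real i * d) * Z \<omega>) \<partial>N))"
      using d by (intro tendsto_sum tendsto_mult_left L) simp
    then show "(\<lambda>k. \<integral>\<omega>. p (exp (- d * Y k \<omega>)) \<partial>M k) \<longlonglongrightarrow> (\<integral>\<omega>. p (exp (- d * Z \<omega>)) \<partial>N)"
      unfolding p eq integral_sum_exp[OF M Y] integral_sum_exp[OF N Z] .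
  qed
  have close: "\<bar>(\<integral>\<omega>. exp (- d * X \<omega>) * f (X \<omega>) \<partial>Q) - (\<integral>\<omega>. p (exp (- d * X \<omega>)) \<partial>Q)\<bar> \<le> e"
    if Q: "prob_space Q" and X: "X \<in> borel_measurable Q" "\<And>\<omega>. X \<omega> \<ge> 0"
      and int: "integrable Q (\<lambda>\<omega>. p (exp (- d * X \<omega>)))"
      and p: "\<And>y. y \<in> {0..1} \<Longrightarrow> \<bar>g y - p y\<bar> < e"
    for Q e and X :: "'z \<Rightarrow> real" and p :: "real \<Rightarrow> real"
  proof -
    interpret prob_space Q by fact
    have [measurable]: "X \<in> borel_measurable Q" by fact
    have "exp (- d * x) * \<bar>f x\<bar> \<le> 1 * B" if "x \<ge> 0" for x
      using that d f(2) by (intro mult_mono) auto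
    then have [simp]: "integrable Q (\<lambda>\<omega>. exp (- (d * X \<omega>)) * f (X \<omega>))"
      using X by (intro integrable_const_bound[where B = B]) (auto simp: abs_mult)
    have "\<bar>(\<integral>\<omega>. exp (- d * X \<omega>) * f (X \<omega>) \<partial>Q) - (\<integral>\<omega>. p (exp (- d * X \<omega>)) \<partial>Q)\<bar> =
        \<bar>\<integral>\<omega>. exp (- d * X \<omega>) * f (X \<omega>) - p (exp (- d * X \<omega>)) \<partial>Q\<bar>"
      using int by simp
    also have "\<dots> \<le> (\<integral>\<omega>. \<bar>exp (- d * X \<omega>) * f (X \<omega>) - p (exp (- d * X \<omega>))\<bar> \<partial>Q)"
      by (rule integral_abs_bound)
    also have "\<dots> \<le> (\<integral>\<omega>. e \<partial>Q)"
    proof (rule integral_mono)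
      show "\<bar>exp (- d * X \<omega>) * f (X \<omega>) - p (exp (- d * X \<omega>))\<bar> \<le> e" for \<omega>
        unfolding g_exp using p[of "exp (- d * X \<omega>)"] X(2)[of \<omega>] d by simp
    qed (use int in auto)
    finally show ?thesis
      by (simp add: prob_space)
  qed
  show ?thesis
  proof (rule LIMSEQ_I)
    fix r :: real assume "r > 0"
    then obtain p where p: "real_polynomial_function p" "\<And>y. y \<in> {0..1} \<Longrightarrow> \<bar>g y - p y\<bar> < r / 4"
      using Stone_Weierstrass_real_polynomial_function[OF compact_Icc cont, of "r / 4"] by auto
    obtain k0 where k0: "\<And>k. k \<ge> k0 \<Longrightarrow>
        norm ((\<integral>\<omega>. p (exp (- d * Y k \<omega>)) \<partial>M k) - (\<integral>\<omega>. p (exp (- d * Z \<omega>)) \<partial>N)) < r / 4"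
      using LIMSEQ_D[OF poly[OF p(1)], of "r / 4"] \<open>r > 0\<close> by auto
    have "norm ((\<integral>\<omega>. exp (- d * Y k \<omega>) * f (Y k \<omega>) \<partial>M k) - (\<integral>\<omega>. exp (- d * Z \<omega>) * f (Z \<omega>) \<partial>N)) < r"
      if "k \<ge> k0" for k
      using k0[OF that] close[OF M Y int_poly(1)[OF p(1)] p(2), of k] close[OF N Z int_poly(2)[OF p(1)] p(2)] \<open>r > 0\<close>
      unfolding real_norm_def by linarith
    then show "\<exists>no. \<forall>k\<ge>no. norm ((\<integral>\<omega>. exp (- d * Y k \<omega>) * f (Y k \<omega>) \<partial>M k) -
        (\<integral>\<omega>. exp (- d * Z \<omega>) * f (Z \<omega>) \<partial>N)) < r"
      by blast
  qed
qed

text \<open>The weight \<open>exp (- d * x)\<close> of the previous lemma is removed by taking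
  \<open>d\<close> small. This costs at most \<open>B * (1 - E exp (- d * X))\<close>, which is
  small for \<open>Z\<close> by dominated convergence, hence also for \<open>Y k\<close> with large
  \<open>k\<close> by convergence of the Laplace transforms. That transfer does the work of
  tightness.\<close>

lemma Laplace_conv_imp_bounded_continuous_conv:
  fixes M :: "nat \<Rightarrow> 'a measure" and Y :: "nat \<Rightarrow> 'a \<Rightarrow> real" and N :: "'b measure" and Z :: "'b \<Rightarrow> real"
    and f :: "real \<Rightarrow> real"
  assumes M: "\<And>k. prob_space (M k)" and N: "prob_space N"
    and Y: "\<And>k. Y k \<in> borel_measurable (M k)" "\<And>k \<omega>. Y k \<omega> \<ge> 0"
    and Z: "Z \<in> borel_measurable N" "\<And>\<omega>. Z \<omega> \<ge> 0"
    and L: "\<And>s. s \<ge> 0 \<Longrightarrow> (\<lambda>k. \<integral>\<omega>. exp (- s * Y k \<omega>) \<partial>M k) \<longlonglongrightarrow> (\<integral>\<omega>. exp (- s * Z \<omega>) \<partial>N)"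
    and f: "continuous_on UNIV f" "\<And>x. \<bar>f x\<bar> \<le> B"
  shows "(\<lambda>k. \<integral>\<omega>. f (Y k \<omega>) \<partial>M k) \<longlonglongrightarrow> (\<integral>\<omega>. f (Z \<omega>) \<partial>N)"
proof -
  have f_meas [measurable]: "f \<in> borel_measurable borel"
    using f(1) by (rule borel_measurable_continuous_onI)
  have B: "B \<ge> 0"
    using f(2)[of 0] by linarith
  have "(\<lambda>j. \<integral>\<omega>. exp (- (1 / real (Suc j)) * Z \<omega>) \<partial>N) \<longlonglongrightarrow> (\<integral>\<omega>. 1 \<partial>N)"
  proof (rule integral_dominated_convergence[where w = "\<lambda>_. 1"])
    interpret prob_space N by (rule N)
    show "integrable N (\<lambda>_. 1 :: real)" by simp
    have "(\<lambda>j. exp (- (1 / real (Suc j)) * Z \<omega>)) \<longlonglongrightarrow> exp (- 0 * Z \<omega>)" for \<omega>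
      by (intro tendsto_intros LIMSEQ_Suc[OF lim_1_over_n])
    then show "AE \<omega> in N. (\<lambda>j. exp (- (1 / real (Suc j)) * Z \<omega>)) \<longlonglongrightarrow> 1"
      by simp
  qed (use Z in auto)
  then have lim1: "(\<lambda>j. \<integral>\<omega>. exp (- (1 / real (Suc j)) * Z \<omega>) \<partial>N) \<longlonglongrightarrow> 1"
    by (simp add: prob_space.prob_space N)
  have close: "\<bar>(\<integral>\<omega>. f (X \<omega>) \<partial>Q) - (\<integral>\<omega>. exp (- d * X \<omega>) * f (X \<omega>) \<partial>Q)\<bar> \<le> B * (1 - (\<integral>\<omega>. exp (- d * X \<omega>) \<partial>Q))"
    if Q: "prob_space Q" and X: "X \<in> borel_measurable Q" "\<And>\<omega>. X \<omega> \<ge> 0" and d: "d > 0"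
    for Q d and X :: "'z \<Rightarrow> real"
  proof -
    interpret prob_space Q by fact
    have [measurable]: "X \<in> borel_measurable Q" by fact
    have *: "exp (- d * x) \<le> 1" if "x \<ge> 0" for x
      using that d by simp
    have "exp (- d * x) * \<bar>f x\<bar> \<le> 1 * B" if "x \<ge> 0" for x
      using that d f(2) by (intro mult_mono) auto
    then have [simp]: "integrable Q (\<lambda>\<omega>. exp (- (d * X \<omega>)) * f (X \<omega>))"
      using X by (intro integrable_const_bound[where B = B]) (auto simp: abs_mult)
    have [simp]: "integrable Q (\<lambda>\<omega>. f (X \<omega>))"
      using f(2) by (intro integrable_const_bound[where B = B]) auto
    have [simp]: "integrable Q (\<lambda>\<omega>. exp (- (d * X \<omega>)))"
      using *[OF X(2)] by (intro integrable_const_bound[where B = 1]) auto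
    have "\<bar>(\<integral>\<omega>. f (X \<omega>) \<partial>Q) - (\<integral>\<omega>. exp (- d * X \<omega>) * f (X \<omega>) \<partial>Q)\<bar> =
        \<bar>\<integral>\<omega>. f (X \<omega>) - exp (- d * X \<omega>) * f (X \<omega>) \<partial>Q\<bar>"
      by (subst Bochner_Integration.integral_diff) simp_all
    also have "\<dots> \<le> (\<integral>\<omega>. \<bar>f (X \<omega>) - exp (- d * X \<omega>) * f (X \<omega>)\<bar> \<partial>Q)"
      by (rule integral_abs_bound)
    also have "\<dots> \<le> (\<integral>\<omega>. B * (1 - exp (- d * X \<omega>)) \<partial>Q)"
    proof (rule integral_mono)
      fix \<omega>
      have "\<bar>f (X \<omega>) - exp (- d * X \<omega>) * f (X \<omega>)\<bar> = \<bar>f (X \<omega>)\<bar> * (1 - exp (- d * X \<omega>))"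
        using *[OF X(2), of \<omega>] abs_mult[of "f (X \<omega>)" "1 - exp (- d * X \<omega>)"] by (simp add: algebra_simps)
      then show "\<bar>f (X \<omega>) - exp (- d * X \<omega>) * f (X \<omega>)\<bar> \<le> B * (1 - exp (- d * X \<omega>))"
        using *[OF X(2), of \<omega>] f(2) by (simp add: mult_right_mono)
    qed simp_all
    also have "\<dots> = B * (1 - (\<integral>\<omega>. exp (- d * X \<omega>) \<partial>Q))"
      by (simp add: prob_space)
    finally show ?thesis .
  qed
  show ?thesis
  proof (rule LIMSEQ_I)
    fix r :: real assume r: "r > 0"
    \<comment> \<open>Dividing by \<open>B + 1\<close> rather than \<open>B\<close> covers
      \<open>B = 0\<close>. Half of \<open>e\<close> bounds the distance from 1 of the Laplace
      transform of \<open>Z\<close> at \<open>d\<close>, the other half its distance from that of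
      \<open>Y k\<close>.\<close>
    define e where "e = r / (4 * (B + 1))"
    have e: "e > 0" "B * e < r / 4"
      using r B by (auto simp: e_def field_simps)
    obtain j where j: "\<bar>(\<integral>\<omega>. exp (- (1 / real (Suc j)) * Z \<omega>) \<partial>N) - 1\<bar> < e / 2"
      using LIMSEQ_D[OF lim1, of "e / 2"] e by auto
    define d where "d = 1 / real (Suc j)"
    have d: "d > 0"
      by (simp add: d_def)
    obtain k1 where k1: "\<And>k. k \<ge> k1 \<Longrightarrow> norm ((\<integral>\<omega>. exp (- d * Y k \<omega>) \<partial>M k) - (\<integral>\<omega>. exp (- d * Z \<omega>) \<partial>N)) < e / 2"
      using LIMSEQ_D[OF L[of d], of "e / 2"] d e by auto
    obtain k2 where k2: "\<And>k. k \<ge> k2 \<Longrightarrow>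
        norm ((\<integral>\<omega>. exp (- d * Y k \<omega>) * f (Y k \<omega>) \<partial>M k) - (\<integral>\<omega>. exp (- d * Z \<omega>) * f (Z \<omega>) \<partial>N)) < r / 2"
      using LIMSEQ_D[OF Laplace_conv_imp_exp_weighted_conv[OF M N Y Z L f d], of "r / 2"] r by auto
    have "norm ((\<integral>\<omega>. f (Y k \<omega>) \<partial>M k) - (\<integral>\<omega>. f (Z \<omega>) \<partial>N)) < r" if "k \<ge> max k1 k2" for k
    proof -
      have kk: "k \<ge> k1" "k \<ge> k2"
        using that by auto
      have "1 - (\<integral>\<omega>. exp (- d * Y k \<omega>) \<partial>M k) \<le> e" "1 - (\<integral>\<omega>. exp (- d * Z \<omega>) \<partial>N) \<le> e"
        using j[folded d_def] k1[OF kk(1)] e(1) unfolding real_norm_def by linarith+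
      then have "B * (1 - (\<integral>\<omega>. exp (- d * Y k \<omega>) \<partial>M k)) < r / 4" "B * (1 - (\<integral>\<omega>. exp (- d * Z \<omega>) \<partial>N)) < r / 4"
        using e(2) mult_left_mono[OF _ B] by (meson le_less_trans)+
      then show ?thesis
        using close[OF M Y d, of k] close[OF N Z d] k2[OF kk(2)] unfolding real_norm_def by linarith
    qed
    then show "\<exists>no. \<forall>k\<ge>no. norm ((\<integral>\<omega>. f (Y k \<omega>) \<partial>M k) - (\<integral>\<omega>. f (Z \<omega>) \<partial>N)) < r"
      by blast
  qed
qed

section \<open>Two-sample statistics under random permutations\<close>

lemma permutes_nonempty [simp]: "{p. p permutes A} \<noteq> {}"
  using permutes_id[of A] by blast

lemma set_pmf_of_set_permutes:
  "finite A \<Longrightarrow> set_pmf (pmf_of_set {p. p permutes A}) = {p. p permutes A}"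
  by (rule set_pmf_of_set[OF permutes_nonempty finite_permutations])

lemma prob_space_random_permutation: "prob_space (random_permutation N)"
  by (simp add: random_permutation_def prob_space_measure_pmf)

lemma space_random_permutation [simp]: "space (random_permutation N) = UNIV"
  and sets_random_permutation [simp, measurable_cong]:
    "sets (random_permutation N) = sets (count_space UNIV)"
  by (simp_all add: random_permutation_def)

lemma measure_random_permutation_UNIV [simp]: "measure (random_permutation N) UNIV = 1"
  using prob_space.prob_space[OF prob_space_random_permutation[of N]] by simp

lemma borel_measurable_random_permutation [simp]: "f \<in> borel_measurable (random_permutation N)"
  by (simp add: measurable_cong_sets[OF sets_random_permutation refl])

lemma AE_random_permutation: "AE p in random_permutation N. p permutes {1..N}"
  unfolding random_permutation_def AE_measure_pmf_iff
  by (subst set_pmf_of_set_permutes) simp_all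

lemma integrable_random_permutation [simp]:
  fixes f :: "(nat \<Rightarrow> nat) \<Rightarrow> 'b::{banach, second_countable_topology}"
  shows "integrable (random_permutation N) f"
  unfolding random_permutation_def
  by (rule integrable_measure_pmf_finite) (simp only: set_pmf_of_set_permutes finite_permutations finite_atLeastAtMost)

text \<open>Right composition with a transposition is a bijection of the permutations of
  \<open>{1..N}\<close>, so it preserves their uniform law. This invariance is the exchangeability
  of a permutation and its swapped version.\<close>

lemma integral_random_permutation_swap:
  fixes f :: "(nat \<Rightarrow> nat) \<Rightarrow> 'b::{banach, second_countable_topology}"
  assumes "i \<in> {1..N}" "j \<in> {1..N}"
  shows "(\<integral>p. f (p \<circ> Transposition.transpose i j) \<partial>random_permutation N) = (\<integral>p. f p \<partial>random_permutation N)"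
proof -
  let ?P = "{p. p permutes {1..N}}"
  have tr: "Transposition.transpose i j permutes {1..N}"
    using assms by (rule permutes_swap_id)
  have 1: "inj_on (\<lambda>p. p \<circ> Transposition.transpose i j) ?P"
    by (auto simp: inj_on_def fun_eq_iff) (metis transpose_involutory)
  have 2: "(\<lambda>p. p \<circ> Transposition.transpose i j) ` ?P = ?P"
    using 1 permutes_compose[OF tr] by (intro endo_inj_surj finite_permutations) auto
  have "(\<integral>p. f p \<partial>random_permutation N) =
      (\<integral>p. f p \<partial>measure_pmf (map_pmf (\<lambda>p. p \<circ> Transposition.transpose i j) (pmf_of_set ?P)))"
    unfolding random_permutation_def
    by (subst map_pmf_of_set_inj[OF 1]) (simp_all only: 2 permutes_nonempty finite_permutations finite_atLeastAtMost not_False_eq_True)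
  then show ?thesis
    by (simp add: random_permutation_def)
qed

lemma integral_random_permutation_mono:
  fixes f g :: "(nat \<Rightarrow> nat) \<Rightarrow> real"
  assumes "\<And>p. p permutes {1..N} \<Longrightarrow> f p \<le> g p"
  shows "(\<integral>p. f p \<partial>random_permutation N) \<le> (\<integral>p. g p \<partial>random_permutation N)"
proof (rule integral_mono_AE)
  show "AE p in random_permutation N. f p \<le> g p"
    using AE_random_permutation by (rule eventually_mono) (rule assms)
qed auto

section \<open>Two-sample statistics and their change under a swap\<close>

definition two_sample :: "nat \<Rightarrow> nat \<Rightarrow> (nat \<Rightarrow> real) \<Rightarrow> (nat \<Rightarrow> nat) \<Rightarrow> real" where
  "two_sample m n x p = sqrt (real m * real n / real (m + n)) *
     (1 / real m * (\<Sum>i=1..m. x (p i)) - 1 / real n * (\<Sum>j=m+1..m+n. x (p j)))"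

text \<open>The increment of \<open>two_sample\<close> when \<open>p\<close> is composed with the
  transposition of a first-sample position \<open>i\<close> and a second-sample position
  \<open>j\<close>; see \<open>two_sample_swap\<close>.\<close>

definition swap_diff :: "nat \<Rightarrow> nat \<Rightarrow> (nat \<Rightarrow> real) \<Rightarrow> (nat \<Rightarrow> nat) \<Rightarrow> nat \<Rightarrow> nat \<Rightarrow> real" where
  "swap_diff m n x p i j = sqrt (1 / real m + 1 / real n) * (x (p j) - x (p i))"

text \<open>Linearity in the population: a linear combination of the field at several points is
  again a single two-sample statistic, so one-dimensional estimates suffice.\<close>

lemma two_sample_sum:
  "(\<Sum>k\<in>I. c k * two_sample m n (x k) p) = two_sample m n (\<lambda>i. \<Sum>k\<in>I. c k * x k i) p"
proof -
  have "(\<Sum>i\<in>A. \<Sum>k\<in>I. c k * x k (p i)) = (\<Sum>k\<in>I. c k * (\<Sum>i\<in>A. x k (p i)))" for A :: "nat set"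
    by (subst sum.swap) (simp add: sum_distrib_left)
  then show ?thesis
    by (simp add: two_sample_def algebra_simps sum_distrib_left sum_subtractf)
qed

text \<open>The two scalings are reciprocal, because
  \<open>1 / m + 1 / n = (m + n) / (m * n)\<close>. Multiplying \<open>two_sample\<close> by
  \<open>sqrt (1 / m + 1 / n)\<close> therefore returns the plain difference of sample
  means.\<close>

lemma sqrt_two_sample:
  assumes "m > 0" "n > 0"
  shows "sqrt (real m * real n / real (m + n)) * (1 / real m + 1 / real n) = sqrt (1 / real m + 1 / real n)"
    and "sqrt (1 / real m + 1 / real n) * sqrt (real m * real n / real (m + n)) = 1"
proof -
  let ?c = "1 / real m + 1 / real n" and ?e = "real m * real n / real (m + n)"
  have "?c = real (m + n) / (real m * real n)"
    using assms by (simp add: field_simps)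
  then have "?c * ?e = (real (m + n) / (real m * real n)) * ?e"
    by (rule arg_cong)
  also have "\<dots> = 1"
    using assms by simp
  finally have "?c * ?e = 1" .
  then show *: "sqrt ?c * sqrt ?e = 1"
    by (simp only: real_sqrt_mult[symmetric] real_sqrt_one)
  have "?c = sqrt ?c * sqrt ?c"
    by simp
  then have "sqrt ?e * ?c = sqrt ?c * (sqrt ?c * sqrt ?e)"
    by (metis mult.assoc mult.commute)
  then show "sqrt ?e * ?c = sqrt ?c"
    by (simp only: * mult_1_right)
qed

lemma two_sample_swap:
  assumes "m > 0" "n > 0" "i \<in> {1..m}" "j \<in> {m+1..m+n}"
  shows "two_sample m n x (p \<circ> Transposition.transpose i j) = two_sample m n x p + swap_diff m n x p i j"
proof -
  \<comment> \<open>Serves both blocks; for the second one the roles of \<open>i\<close> and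
    \<open>j\<close> are exchanged, whence \<open>transpose_commute\<close>.\<close>
  have *: "(\<Sum>k\<in>A. x ((p \<circ> Transposition.transpose a b) k)) = (\<Sum>k\<in>A. x (p k)) - x (p a) + x (p b)"
    if "finite A" "a \<in> A" "b \<notin> A" for A a b
  proof -
    have "(\<Sum>k\<in>A - {a}. x ((p \<circ> Transposition.transpose a b) k)) = (\<Sum>k\<in>A - {a}. x (p k))"
      using that by (intro sum.cong) (auto simp: Transposition.transpose_def)
    then show ?thesis
      using that by (simp add: sum.remove[of A a])
  qed
  have 1: "(\<Sum>k=1..m. x ((p \<circ> Transposition.transpose i j) k)) = (\<Sum>k=1..m. x (p k)) - x (p i) + x (p j)"
    using assms by (intro *) auto
  have 2: "(\<Sum>k=m+1..m+n. x ((p \<circ> Transposition.transpose i j) k)) = (\<Sum>k=m+1..m+n. x (p k)) - x (p j) + x (p i)"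
    using assms by (subst transpose_commute, intro *) auto
  have "two_sample m n x (p \<circ> Transposition.transpose i j) = two_sample m n x p +
      (sqrt (real m * real n / real (m + n)) * (1 / real m + 1 / real n)) * (x (p j) - x (p i))"
    unfolding two_sample_def 1 2 by (simp add: algebra_simps add_divide_distrib diff_divide_distrib)
  then show ?thesis
    unfolding sqrt_two_sample(1)[OF assms(1,2)] by (simp add: swap_diff_def)
qed

lemma swap_diff_swap:
  "i \<noteq> j \<Longrightarrow> swap_diff m n x (p \<circ> Transposition.transpose i j) i j = - swap_diff m n x p i j"
  by (simp add: swap_diff_def algebra_simps)

text \<open>Over all pairs the value differences add up to \<open>m\<close> times the second block
  sum minus \<open>n\<close> times the first, which is \<open>- m * n\<close> times the difference
  of sample means. So the mean increment of a random swap is an exact negative multiple of the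
  statistic, with no remainder.\<close>

lemma sum_swap_diff:
  assumes "m > 0" "n > 0"
  shows "(\<Sum>i=1..m. \<Sum>j=m+1..m+n. swap_diff m n x p i j) = - real (m + n) * two_sample m n x p"
proof -
  let ?c = "sqrt (1 / real m + 1 / real n)" and ?e = "sqrt (real m * real n / real (m + n))"
  let ?A = "\<Sum>i=1..m. x (p i)" and ?B = "\<Sum>j=m+1..m+n. x (p j)"
  have "(\<Sum>i=1..m. \<Sum>j=m+1..m+n. swap_diff m n x p i j) = ?c * (real m * ?B - real n * ?A)"
    by (simp add: swap_diff_def sum_distrib_left[symmetric] sum_subtractf)
  also have "\<dots> = - (real m * real n) * ?c * (1 / real m * ?A - 1 / real n * ?B)"
    using assms by (simp add: field_simps)
  also have "real m * real n = real (m + n) * (?e * ?e)"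
    using assms by simp
  also have "- (real (m + n) * (?e * ?e)) * ?c = - real (m + n) * ?e * (?c * ?e)"
    by (simp only: mult.commute mult.left_commute mult_minus_left mult_minus_right)
  finally show ?thesis
    unfolding sqrt_two_sample(2)[OF assms] two_sample_def by simp
qed

text \<open>The exchangeable pair identity; its linear regression property is \<open>sum_swap_diff\<close>.\<close>

lemma two_sample_exchange:
  fixes F :: "real \<Rightarrow> 'b::{banach, second_countable_topology}"
  assumes "m > 0" "n > 0"
  defines "R \<equiv> random_permutation (m + n)"
  shows "(\<integral>p. two_sample m n x p *\<^sub>R F (two_sample m n x p) \<partial>R) =
    (1 / (2 * real (m + n))) *\<^sub>R (\<Sum>i=1..m. \<Sum>j=m+1..m+n.
       \<integral>p. swap_diff m n x p i j *\<^sub>R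
         (F (two_sample m n x p + swap_diff m n x p i j) - F (two_sample m n x p)) \<partial>R)"
proof -
  let ?W = "two_sample m n x" and ?D = "swap_diff m n x"
  have [simp]: "integrable R f" for f :: "_ \<Rightarrow> 'b"
    by (simp add: R_def)
  \<comment> \<open>Replacing \<open>p\<close> by its swapped version sends \<open>?W\<close> to
    \<open>?W + ?D\<close> and \<open>?D\<close> to \<open>- ?D\<close>. Both halves of the
    difference therefore contribute equally, which is the origin of the factor 2.\<close>
  have swap: "(\<integral>p. ?D p i j *\<^sub>R F (?W p + ?D p i j) \<partial>R) = - (\<integral>p. ?D p i j *\<^sub>R F (?W p) \<partial>R)"
    if "i \<in> {1..m}" "j \<in> {m+1..m+n}" for i j
  proof -
    have "(\<integral>p. ?D p i j *\<^sub>R F (?W p) \<partial>R) =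
        (\<integral>p. ?D (p \<circ> Transposition.transpose i j) i j *\<^sub>R F (?W (p \<circ> Transposition.transpose i j)) \<partial>R)"
      unfolding R_def using that by (subst integral_random_permutation_swap) auto
    also have "\<dots> = (\<integral>p. - (?D p i j *\<^sub>R F (?W p + ?D p i j)) \<partial>R)"
      unfolding two_sample_swap[OF assms(1,2) that] using that by (subst swap_diff_swap) auto
    finally show ?thesis
      by simp
  qed
  have "(\<Sum>i=1..m. \<Sum>j=m+1..m+n. \<integral>p. ?D p i j *\<^sub>R (F (?W p + ?D p i j) - F (?W p)) \<partial>R) =
      (\<Sum>i=1..m. \<Sum>j=m+1..m+n. - 2 *\<^sub>R (\<integral>p. ?D p i j *\<^sub>R F (?W p) \<partial>R))"
    by (intro sum.cong refl) (simp add: scaleR_diff_right swap scaleR_2)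
  also have "\<dots> = - 2 *\<^sub>R (\<integral>p. (\<Sum>i=1..m. \<Sum>j=m+1..m+n. ?D p i j) *\<^sub>R F (?W p) \<partial>R)"
    by (simp add: scaleR_sum_left scaleR_sum_right sum_negf)
  also have "\<dots> = (2 * real (m + n)) *\<^sub>R (\<integral>p. ?W p *\<^sub>R F (?W p) \<partial>R)"
    unfolding sum_swap_diff[OF assms(1,2)]
    by (simp only: scaleR_scaleR[symmetric] integral_scaleR_right) simp
  finally show ?thesis
    using assms by simp
qed

section \<open>Moment bounds from the exchangeable pair\<close>

lemma abs_swap_diff_le:
  assumes p: "p permutes {1..m+n}" and ij: "i \<in> {1..m}" "j \<in> {m+1..m+n}"
    and L: "\<And>i j. i \<in> {1..m+n} \<Longrightarrow> j \<in> {1..m+n} \<Longrightarrow> \<bar>x i - x j\<bar> \<le> L"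
  shows "\<bar>swap_diff m n x p i j\<bar> \<le> sqrt (1 / real m + 1 / real n) * L"
proof -
  have "p i \<in> {1..m+n}" "p j \<in> {1..m+n}"
    using ij by (simp_all only: permutes_in_image[OF p]) auto
  then show ?thesis
    using L[of "p j" "p i"] by (simp add: swap_diff_def abs_mult mult_left_mono)
qed

lemma swap_diff_square_le:
  assumes "p permutes {1..m+n}" "i \<in> {1..m}" "j \<in> {m+1..m+n}"
    and "\<And>i j. i \<in> {1..m+n} \<Longrightarrow> j \<in> {1..m+n} \<Longrightarrow> \<bar>x i - x j\<bar> \<le> L"
  shows "(swap_diff m n x p i j)\<^sup>2 \<le> (1 / real m + 1 / real n) * L\<^sup>2"
  using power_mono[OF abs_swap_diff_le[where x = x, OF assms], of 2]
  by (simp add: power_mult_distrib)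

text \<open>There are \<open>m * n\<close> pairs and \<open>m * n * (1 / m + 1 / n) = m + n\<close>,
  so the normalisation of \<open>two_sample_exchange\<close> cancels exactly the factor that bounds
  squared increments. The exchange estimates below are brought to this shape.\<close>

lemma average_pairs_le:
  fixes f :: "nat \<Rightarrow> nat \<Rightarrow> real"
  assumes mn: "m > 0" "n > 0"
    and le: "\<And>i j. i \<in> {1..m} \<Longrightarrow> j \<in> {m+1..m+n} \<Longrightarrow> f i j \<le> (1 / real m + 1 / real n) * B"
  shows "1 / (2 * real (m + n)) * (\<Sum>i=1..m. \<Sum>j=m+1..m+n. f i j) \<le> B / 2"
proof -
  have "(\<Sum>i=1..m. \<Sum>j=m+1..m+n. f i j) \<le> (\<Sum>i=1..m. \<Sum>j=m+1..m+n. (1 / real m + 1 / real n) * B)"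
    by (intro sum_mono le)
  also have "\<dots> = real m * real n * ((1 / real m + 1 / real n) * B)"
    by simp
  also have "\<dots> = real (m + n) * B"
    using mn by (simp add: field_simps)
  finally show ?thesis
    using mn by (simp add: field_simps)
qed

text \<open>With the identity for \<open>F\<close>, \<open>two_sample_exchange\<close> turns the
  second moment into a normalised sum of squared increments. Only differences of population values
  enter, hence a bound through the range \<open>L\<close>.\<close>

lemma two_sample_second_moment:
  assumes mn: "m > 0" "n > 0"
    and L: "\<And>i j. i \<in> {1..m+n} \<Longrightarrow> j \<in> {1..m+n} \<Longrightarrow> \<bar>x i - x j\<bar> \<le> L"
  shows "(\<integral>p. (two_sample m n x p)\<^sup>2 \<partial>random_permutation (m + n)) \<le> L\<^sup>2 / 2"
proof -
  let ?R = "random_permutation (m + n)"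
  have "(\<integral>p. (two_sample m n x p)\<^sup>2 \<partial>?R) =
      1 / (2 * real (m + n)) * (\<Sum>i=1..m. \<Sum>j=m+1..m+n. \<integral>p. (swap_diff m n x p i j)\<^sup>2 \<partial>?R)"
    using two_sample_exchange[OF mn, of x "\<lambda>w. w"] by (simp add: power2_eq_square)
  also have "\<dots> \<le> L\<^sup>2 / 2"
  proof (intro average_pairs_le[OF mn])
    fix i j assume ij: "i \<in> {1..m}" "j \<in> {m+1..m+n}"
    have "(\<integral>p. (swap_diff m n x p i j)\<^sup>2 \<partial>?R) \<le> (\<integral>p. (1 / real m + 1 / real n) * L\<^sup>2 \<partial>?R)"
      by (intro integral_random_permutation_mono swap_diff_square_le ij L)
    then show "(\<integral>p. (swap_diff m n x p i j)\<^sup>2 \<partial>?R) \<le> (1 / real m + 1 / real n) * L\<^sup>2"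
      by simp
  qed
  finally show ?thesis .
qed

text \<open>With the cube for \<open>F\<close>, each term is at most
  \<open>3 / 2 * D^2 * ((W + D)^2 + W^2)\<close>. Here \<open>W + D\<close> is the statistic after
  the swap and has the same second moment as \<open>W\<close>, so everything reduces to
  \<open>two_sample_second_moment\<close>; the outcome is \<open>3 / 4 * L ^ 4\<close>.\<close>

lemma two_sample_fourth_moment:
  assumes mn: "m > 0" "n > 0"
    and L: "\<And>i j. i \<in> {1..m+n} \<Longrightarrow> j \<in> {1..m+n} \<Longrightarrow> \<bar>x i - x j\<bar> \<le> L"
  shows "(\<integral>p. two_sample m n x p ^ 4 \<partial>random_permutation (m + n)) \<le> L ^ 4"
proof -
  let ?R = "random_permutation (m + n)" and ?W = "two_sample m n x" and ?D = "swap_diff m n x"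
  let ?c = "1 / real m + 1 / real n"
  have "(\<integral>p. ?W p ^ 4 \<partial>?R) = 1 / (2 * real (m + n)) *
     (\<Sum>i=1..m. \<Sum>j=m+1..m+n. \<integral>p. ?D p i j * ((?W p + ?D p i j) ^ 3 - ?W p ^ 3) \<partial>?R)"
    using two_sample_exchange[OF mn, of x "\<lambda>w. w ^ 3"] by (simp add: power_numeral_reduce)
  also have "\<dots> \<le> (3 * L\<^sup>2 * (\<integral>p. (?W p)\<^sup>2 \<partial>?R)) / 2"
  proof (intro average_pairs_le[OF mn])
    fix i j assume ij: "i \<in> {1..m}" "j \<in> {m+1..m+n}"
    have "(\<integral>p. ?D p i j * ((?W p + ?D p i j) ^ 3 - ?W p ^ 3) \<partial>?R) \<le>
       (\<integral>p. ?c * L\<^sup>2 * (3 / 2) * ((?W (p \<circ> Transposition.transpose i j))\<^sup>2 + (?W p)\<^sup>2) \<partial>?R)"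
    proof (intro integral_random_permutation_mono)
      fix p assume "p permutes {1..m+n}"
      then have D: "(?D p i j)\<^sup>2 \<le> ?c * L\<^sup>2"
        by (intro swap_diff_square_le ij L)
      have "d * ((w + d) ^ 3 - w ^ 3) \<le> d\<^sup>2 * ((3 / 2) * ((w + d)\<^sup>2 + w\<^sup>2))" for w d :: real
      proof -
        \<comment> \<open>Twice the right side of the claim minus twice its left side is exactly
          \<open>d ^ 4\<close>.\<close>
        have "3 * (d\<^sup>2 * ((w + d)\<^sup>2 + w\<^sup>2)) - 2 * (d * ((w + d) ^ 3 - w ^ 3)) = d ^ 4"
          by algebra
        moreover have "d ^ 4 \<ge> 0"
          by simp
        moreover have "d\<^sup>2 * ((3 / 2) * ((w + d)\<^sup>2 + w\<^sup>2)) = 3 * (d\<^sup>2 * ((w + d)\<^sup>2 + w\<^sup>2)) / 2"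
          by simp
        ultimately show ?thesis
          by linarith
      qed
      from this[of "?D p i j" "?W p"]
      have "?D p i j * ((?W p + ?D p i j) ^ 3 - ?W p ^ 3) \<le>
          (?D p i j)\<^sup>2 * ((3 / 2) * ((?W p + ?D p i j)\<^sup>2 + (?W p)\<^sup>2))" .
      also have "\<dots> \<le> ?c * L\<^sup>2 * ((3 / 2) * ((?W p + ?D p i j)\<^sup>2 + (?W p)\<^sup>2))"
        using D by (rule mult_right_mono) simp
      finally show "?D p i j * ((?W p + ?D p i j) ^ 3 - ?W p ^ 3) \<le>
          ?c * L\<^sup>2 * (3 / 2) * ((?W (p \<circ> Transposition.transpose i j))\<^sup>2 + (?W p)\<^sup>2)"
        unfolding two_sample_swap[OF mn ij] by (simp only: mult.assoc)
    qed
    also have "\<dots> = ?c * L\<^sup>2 * (3 / 2) * ((\<integral>p. (?W (p \<circ> Transposition.transpose i j))\<^sup>2 \<partial>?R) + (\<integral>p. (?W p)\<^sup>2 \<partial>?R))"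
      by simp
    also have "(\<integral>p. (?W (p \<circ> Transposition.transpose i j))\<^sup>2 \<partial>?R) = (\<integral>p. (?W p)\<^sup>2 \<partial>?R)"
      using ij by (intro integral_random_permutation_swap) auto
    finally show "(\<integral>p. ?D p i j * ((?W p + ?D p i j) ^ 3 - ?W p ^ 3) \<partial>?R) \<le>
        ?c * (3 * L\<^sup>2 * (\<integral>p. (?W p)\<^sup>2 \<partial>?R))"
      by (simp add: algebra_simps)
  qed
  also have "\<dots> \<le> (3 * L\<^sup>2 * (L\<^sup>2 / 2)) / 2"
    by (intro divide_right_mono mult_left_mono two_sample_second_moment[OF mn L]) auto
  also have "\<dots> = 3 / 4 * L ^ 4"
    by (simp add: power2_eq_square power4_eq_xxxx)
  also have "\<dots> \<le> L ^ 4"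
    using zero_le_even_power[of 4 L] by simp
  finally show ?thesis .
qed

section \<open>Population variance and averaged squared increments\<close>

definition pop_var :: "nat \<Rightarrow> (nat \<Rightarrow> real) \<Rightarrow> real" where
  "pop_var N x = (\<Sum>i=1..N. (x i)\<^sup>2) / real N - ((\<Sum>i=1..N. x i) / real N)\<^sup>2"

lemma pop_var_nonneg: "pop_var N x \<ge> 0"
proof -
  have "(\<Sum>i=1..N. x i)\<^sup>2 \<le> (\<Sum>i=1..N. (x i)\<^sup>2) * (\<Sum>i=1..N. 1\<^sup>2)"
    using Cauchy_Schwarz_ineq_sum[of x "\<lambda>_. 1" "{1..N}"] by simp
  then show ?thesis
    by (cases "N = 0") (auto simp: pop_var_def field_simps power2_eq_square)
qed

lemma sum_square_diff_pairs:
  fixes f g :: "nat \<Rightarrow> real"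
  shows "(\<Sum>i\<in>A. \<Sum>j\<in>B. (f j - g i)\<^sup>2) =
    real (card A) * (\<Sum>j\<in>B. (f j)\<^sup>2) + real (card B) * (\<Sum>i\<in>A. (g i)\<^sup>2) - 2 * ((\<Sum>i\<in>A. g i) * (\<Sum>j\<in>B. f j))"
proof -
  have "(\<Sum>i\<in>A. \<Sum>j\<in>B. (f j - g i)\<^sup>2) = (\<Sum>i\<in>A. \<Sum>j\<in>B. (f j)\<^sup>2 + (g i)\<^sup>2 - 2 * (g i * f j))"
    by (simp add: power2_diff mult_ac)
  also have "\<dots> = (\<Sum>i\<in>A. (\<Sum>j\<in>B. (f j)\<^sup>2) + real (card B) * (g i)\<^sup>2) - 2 * (\<Sum>i\<in>A. \<Sum>j\<in>B. g i * f j)"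
    by (simp add: sum.distrib sum_subtractf sum_distrib_left)
  also have "(\<Sum>i\<in>A. \<Sum>j\<in>B. g i * f j) = (\<Sum>i\<in>A. g i) * (\<Sum>j\<in>B. f j)"
    by (rule sum_product[symmetric])
  finally show ?thesis
    by (simp add: sum.distrib sum_distrib_left)
qed

text \<open>In terms of the sample means \<open>a\<close> and \<open>b\<close> of the proof, the
  average on the left is \<open>(a y + b y) / 2 - a x * b x\<close>, and the population variance is
  what this becomes when sample means are replaced by pooled ones. The difference is a polynomial
  without constant term in the mean differences, each of which is \<open>c\<close> times a
  two-sample statistic.\<close>

lemma sum_swap_diff_square:
  assumes mn: "m > 0" "n > 0" and p: "p permutes {1..m+n}"
    and B: "\<And>i. i \<in> {1..m+n} \<Longrightarrow> \<bar>x i\<bar> \<le> B"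
  defines "c \<equiv> sqrt (1 / real m + 1 / real n)"
  shows "\<bar>1 / (2 * real (m + n)) * (\<Sum>i=1..m. \<Sum>j=m+1..m+n. (swap_diff m n x p i j)\<^sup>2) - pop_var (m + n) x\<bar>
    \<le> c * \<bar>two_sample m n (\<lambda>i. (x i)\<^sup>2) p\<bar> + c * B * \<bar>two_sample m n x p\<bar> + c\<^sup>2 * (two_sample m n x p)\<^sup>2"
proof -
  define N where "N = real m + real n"
  define a where "a = (\<lambda>y. 1 / real m * (\<Sum>i=1..m. y (p i)) :: real)"
  define b where "b = (\<lambda>y. 1 / real n * (\<Sum>j=m+1..m+n. y (p j)) :: real)"
  define d where "d = (\<lambda>y. a y - b y)"
  have N: "N > 0" "real (m + n) = N"
    using mn by (auto simp: N_def)
  have d: "d y = c * two_sample m n y p" for y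
  proof -
    have "c * two_sample m n y p = (c * sqrt (real m * real n / real (m + n))) * d y"
      by (simp add: two_sample_def d_def a_def b_def)
    then show ?thesis
      unfolding c_def sqrt_two_sample(2)[OF mn] by simp
  qed
  have total: "(\<Sum>i=1..m+n. y i) = real m * a y + real n * b y" for y
  proof -
    have "(\<Sum>i=1..m+n. y i) = (\<Sum>i=1..m+n. y (p i))"
      using sum.permute[OF p, of y] by (simp add: o_def)
    also have "\<dots> = (\<Sum>i=1..m. y (p i)) + (\<Sum>j=m+1..m+n. y (p j))"
      using sum.ub_add_nat[of 1 m "\<lambda>i. y (p i)" n] by simp
    finally show ?thesis
      using mn by (simp add: a_def b_def)
  qed
  define y where "y = (\<lambda>i. (x i)\<^sup>2)"
  define s where "s = (\<Sum>i=1..m. \<Sum>j=m+1..m+n. (x (p j) - x (p i))\<^sup>2)"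
  have c2: "c\<^sup>2 = N / (real m * real n)"
    using mn by (simp add: c_def N_def field_simps)
  have s: "s = real m * real n * (a y + b y - 2 * a x * b x)"
  proof -
    have "s = real m * (\<Sum>j=m+1..m+n. (x (p j))\<^sup>2) + real n * (\<Sum>i=1..m. (x (p i))\<^sup>2) - 2 * ((\<Sum>i=1..m. x (p i)) * (\<Sum>j=m+1..m+n. x (p j)))"
      unfolding s_def by (subst sum_square_diff_pairs) simp
    also have "\<dots> = real m * real n * (a y + b y - 2 * a x * b x)"
      using mn by (simp add: a_def b_def y_def field_simps)
    finally show ?thesis .
  qed
  have "1 / (2 * real (m + n)) * (\<Sum>i=1..m. \<Sum>j=m+1..m+n. (swap_diff m n x p i j)\<^sup>2) = c\<^sup>2 * s / (2 * N)"
    by (simp add: swap_diff_def power_mult_distrib sum_distrib_left[symmetric] s_def c_def N_def)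
  also have "\<dots> = (a y + b y) / 2 - a x * b x"
    using mn N unfolding c2 s by (simp add: field_simps)
  finally have 1: "1 / (2 * real (m + n)) * (\<Sum>i=1..m. \<Sum>j=m+1..m+n. (swap_diff m n x p i j)\<^sup>2) =
    (a y + b y) / 2 - a x * b x" .
  have 2: "pop_var (m + n) x = (real m * a y + real n * b y) / N - ((real m * a x + real n * b x) / N)\<^sup>2"
    by (simp only: pop_var_def total N) (simp only: y_def[symmetric] total)
  define \<mu> where "\<mu> = (real m * a x + real n * b x) / N"
  \<comment> \<open>The share of the first sample: pooled means are convex combinations with weights
    \<open>q\<close> and \<open>1 - q\<close>.\<close>
  define q where "q = real m / N"
  have n: "real n / N = 1 - q" "0 \<le> q" "q \<le> 1"
    using N(1) by (auto simp: q_def N_def field_simps)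
  have 4: "(real m * u + real n * v) / N = q * u + (1 - q) * v" for u v
    by (simp add: n(1)[symmetric] add_divide_distrib) (simp add: q_def)
  \<comment> \<open>Read with \<open>A = a y\<close>, \<open>B = b y\<close>,
    \<open>u = a x\<close>, \<open>v = b x\<close> and \<open>h = 1 / 2\<close>; the
    \<open>B\<close> here shadows the bound on the population.\<close>
  have poly: "B + h * (A - B) - u * v - ((q * A + (1 - q) * B) - (q * u + (1 - q) * v)\<^sup>2) =
      (h - q) * (A - B) - (1 - 2 * q) * (q * u + (1 - q) * v) * (u - v) + q * (1 - q) * (u - v)\<^sup>2"
    for A B h u v :: real
    by (simp add: power2_eq_square algebra_simps)
  have half: "(a y + b y) / 2 = b y + 1 / 2 * (a y - b y)"
    by (simp add: field_simps)
  have 5: "(a y + b y) / 2 - a x * b x - ((q * a y + (1 - q) * b y) - (q * a x + (1 - q) * b x)\<^sup>2)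
      = (1 / 2 - q) * d y - (1 - 2 * q) * \<mu> * d x + q * (1 - q) * (d x)\<^sup>2"
    unfolding \<mu>_def 4 d_def half by (rule poly)
  have "\<bar>\<mu>\<bar> \<le> B"
  proof -
    have "\<bar>\<Sum>i=1..m+n. x i\<bar> \<le> (\<Sum>i=1..m+n. B)"
      using B by (intro order_trans[OF sum_abs] sum_mono)
    also have "\<dots> = N * B"
      by (simp add: N_def)
    finally show ?thesis
      using N(1) unfolding \<mu>_def total[symmetric] by (simp add: field_simps)
  qed
  have i: "\<bar>(1 / 2 - q) * d y\<bar> \<le> 1 * \<bar>d y\<bar>"
    unfolding abs_mult using n by (intro mult_right_mono) auto
  have ii: "\<bar>(1 - 2 * q) * \<mu> * d x\<bar> \<le> 1 * B * \<bar>d x\<bar>"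
    unfolding abs_mult using n \<open>\<bar>\<mu>\<bar> \<le> B\<close> by (intro mult_right_mono mult_mono) auto
  have iii: "\<bar>q * (1 - q) * (d x)\<^sup>2\<bar> \<le> 1 * 1 * (d x)\<^sup>2"
    unfolding abs_mult abs_power2 using n by (intro mult_right_mono mult_mono) auto
  have "c \<ge> 0"
    by (simp add: c_def)
  have "\<bar>(1 / 2 - q) * d y - (1 - 2 * q) * \<mu> * d x + q * (1 - q) * (d x)\<^sup>2\<bar>
     \<le> \<bar>d y\<bar> + B * \<bar>d x\<bar> + (d x)\<^sup>2"
    using i ii iii by linarith
  moreover have "\<bar>d z\<bar> = c * \<bar>two_sample m n z p\<bar>" for z
    unfolding d abs_mult using \<open>c \<ge> 0\<close> by simp
  ultimately show ?thesis
    unfolding 1 2 4 5 by (simp add: d power_mult_distrib y_def mult.left_commute mult.assoc)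
qed

section \<open>Characteristic functions at finite sample sizes\<close>

lemma integral_random_permutation_eq_sum:
  fixes f :: "(nat \<Rightarrow> nat) \<Rightarrow> 'b::{banach, second_countable_topology}"
  shows "(\<integral>p. f p \<partial>random_permutation N) =
    (\<Sum>p | p permutes {1..N}. f p) /\<^sub>R real (card {p. p permutes {1..N}})"
proof -
  let ?P = "{p. p permutes {1..N}}"
  have fin: "finite ?P"
    by (intro finite_permutations finite_atLeastAtMost)
  then have "(\<integral>p. f p \<partial>random_permutation N) = (\<Sum>p\<in>?P. pmf (pmf_of_set ?P) p *\<^sub>R f p)"
    unfolding random_permutation_def
    by (intro integral_measure_pmf) (simp_all only: set_pmf_of_set[OF permutes_nonempty])
  also have "\<dots> = (\<Sum>p\<in>?P. inverse (real (card ?P)) *\<^sub>R f p)"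
    by (intro sum.cong refl) (simp only: pmf_of_set[OF permutes_nonempty fin] indicator_simps inverse_eq_divide)
  finally show ?thesis
    by (simp only: scaleR_sum_right)
qed

lemma abs_two_sample_integral_le:
  assumes "m > 0" "n > 0"
    and "\<And>i j. i \<in> {1..m+n} \<Longrightarrow> j \<in> {1..m+n} \<Longrightarrow> \<bar>x i - x j\<bar> \<le> L"
  shows "(\<integral>p. \<bar>two_sample m n x p\<bar> \<partial>random_permutation (m + n)) \<le> 1 + L\<^sup>2 / 2"
proof -
  have "\<bar>w\<bar> \<le> 1 + w\<^sup>2" for w :: real
    using sum_squares_bound[of "\<bar>w\<bar>" 1] by simp
  then have "(\<integral>p. \<bar>two_sample m n x p\<bar> \<partial>random_permutation (m + n)) \<le>
      (\<integral>p. 1 + (two_sample m n x p)\<^sup>2 \<partial>random_permutation (m + n))"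
    by (intro integral_random_permutation_mono)
  also have "\<dots> = 1 + (\<integral>p. (two_sample m n x p)\<^sup>2 \<partial>random_permutation (m + n))"
    by simp
  finally show ?thesis
    using two_sample_second_moment[where x = x, OF assms] by simp
qed

lemma norm_iexp_minus_linear_le: "cmod (iexp x - 1 - \<i> * x) \<le> x\<^sup>2 / 2"
  using iexp_approx1[of x 1] by (simp add: power2_eq_square algebra_simps)

text \<open>The exchange identity with \<open>F w = iexp (t * w)\<close> has terms
  \<open>D * (iexp (t * D) - 1) * iexp (t * W)\<close>, which equal
  \<open>\<i> * t * D^2 * iexp (t * W)\<close> up to third order in \<open>D\<close>. The averaged
  squares are then replaced by the population variance through \<open>sum_swap_diff_square\<close>.
  The first integral is \<open>- \<i>\<close> times the derivative of the characteristic
  function.\<close>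

lemma two_sample_char_derivative:
  assumes mn: "m > 0" "n > 0" and B: "\<And>i. i \<in> {1..m+n} \<Longrightarrow> \<bar>x i\<bar> \<le> B" and t: "\<bar>t\<bar> \<le> 1"
  defines "R \<equiv> random_permutation (m + n)" and "c \<equiv> sqrt (1 / real m + 1 / real n)"
    and "W \<equiv> two_sample m n x"
  shows "cmod ((\<integral>p. W p *\<^sub>R iexp (t * W p) \<partial>R) - \<i> * t * pop_var (m + n) x * (\<integral>p. iexp (t * W p) \<partial>R))
    \<le> c * (1 + B + 4 * B ^ 3 + B ^ 4) + 2 * c\<^sup>2 * B\<^sup>2"
proof -
  define v where "v = pop_var (m + n) x"
  define D where "D = swap_diff m n x"
  define r where "r = 1 / (2 * real (m + n))"
  have r: "r \<ge> 0"
    by (simp add: r_def)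
  have c: "c \<ge> 0" "c\<^sup>2 = 1 / real m + 1 / real n"
    by (simp_all add: c_def)
  have "B \<ge> 0"
    using B[of 1] mn by auto
  have [simp]: "integrable R f" for f :: "_ \<Rightarrow> 'z::{banach, second_countable_topology}"
    by (simp add: R_def)
  have int1: "(\<integral>p. k \<partial>R) = k" for k :: real
    by (simp add: R_def)
  \<comment> \<open>Values in \<open>{- B..B}\<close> differ by at most \<open>2 * B\<close>; their
    squares lie in \<open>{0..B\<^sup>2}\<close> and differ by at most
    \<open>B\<^sup>2\<close>.\<close>
  have L: "\<bar>x i - x j\<bar> \<le> 2 * B" if "i \<in> {1..m+n}" "j \<in> {1..m+n}" for i j
    using B[OF that(1)] B[OF that(2)] by linarith
  have L2: "\<bar>(x i)\<^sup>2 - (x j)\<^sup>2\<bar> \<le> B\<^sup>2" if "i \<in> {1..m+n}" "j \<in> {1..m+n}" for i j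
  proof -
    have "(x i)\<^sup>2 \<le> B\<^sup>2" "(x j)\<^sup>2 \<le> B\<^sup>2"
      using power_mono[OF B[OF that(1)], of 2] power_mono[OF B[OF that(2)], of 2] by simp_all
    moreover have "(x i)\<^sup>2 \<ge> 0" "(x j)\<^sup>2 \<ge> 0"
      by simp_all
    ultimately show ?thesis
      by linarith
  qed
  \<comment> \<open>The Taylor remainder of one increment. Its bound keeps a factor
    \<open>c\<^sup>2\<close> in front, as \<open>average_pairs_le\<close> requires.\<close>
  define \<rho> where "\<rho> p i j = D p i j *\<^sub>R (iexp (t * (W p + D p i j)) - iexp (t * W p))
      - (\<i> * t * (D p i j)\<^sup>2) * iexp (t * W p)" for p i j
  have \<rho>: "cmod (\<rho> p i j) \<le> c\<^sup>2 * (4 * c * B ^ 3)"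
    if p: "p permutes {1..m+n}" and ij: "i \<in> {1..m}" "j \<in> {m+1..m+n}" for p i j
  proof -
    define d where "d = D p i j"
    have d: "\<bar>d\<bar> \<le> c * (2 * B)"
      unfolding d_def D_def c_def by (rule abs_swap_diff_le[where x = x, OF p ij L])
    have "\<rho> p i j = d *\<^sub>R (iexp (t * W p) * (iexp (t * d) - 1 - \<i> * (t * d)))"
      by (simp add: \<rho>_def d_def scaleR_conv_of_real ring_distribs exp_add power2_eq_square mult_ac)
    then have "cmod (\<rho> p i j) = \<bar>d\<bar> * cmod (iexp (t * d) - 1 - \<i> * (t * d))"
      by (simp add: norm_mult)
    also have "\<dots> \<le> \<bar>d\<bar> * ((t * d)\<^sup>2 / 2)"
      using norm_iexp_minus_linear_le[of "t * d"] by (intro mult_left_mono) simp_all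
    also have "\<dots> = t\<^sup>2 * \<bar>d\<bar> ^ 3 / 2"
      by (simp add: power_mult_distrib power3_eq_cube power2_eq_square)
    also have "\<dots> \<le> 1 * (c * (2 * B)) ^ 3 / 2"
      using t d by (intro divide_right_mono mult_mono power_mono) (auto simp: abs_square_le_1)
    also have "\<dots> = c\<^sup>2 * (4 * c * B ^ 3)"
      by (simp add: power_mult_distrib power3_eq_cube power2_eq_square)
    finally show ?thesis .
  qed
  \<comment> \<open>The averaged squared increments given \<open>p\<close>; their mean distance from
    \<open>v\<close> is the second source of error.\<close>
  define V where "V p = r * (\<Sum>i=1..m. \<Sum>j=m+1..m+n. (D p i j)\<^sup>2)" for p
  have "(\<integral>p. W p *\<^sub>R iexp (t * W p) \<partial>R) =
      r *\<^sub>R (\<Sum>i=1..m. \<Sum>j=m+1..m+n. \<integral>p. D p i j *\<^sub>R (iexp (t * (W p + D p i j)) - iexp (t * W p)) \<partial>R)"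
    using two_sample_exchange[OF mn, of x "\<lambda>w. iexp (t * w)"]
    by (simp only: R_def W_def D_def r_def)
  also have "\<dots> = r *\<^sub>R (\<Sum>i=1..m. \<Sum>j=m+1..m+n. \<integral>p. \<rho> p i j + (\<i> * t * (D p i j)\<^sup>2) * iexp (t * W p) \<partial>R)"
    by (simp only: \<rho>_def diff_add_cancel)
  also have "\<dots> = r *\<^sub>R (\<Sum>i=1..m. \<Sum>j=m+1..m+n. \<integral>p. \<rho> p i j \<partial>R) +
      r *\<^sub>R (\<integral>p. (\<Sum>i=1..m. \<Sum>j=m+1..m+n. (\<i> * t * (D p i j)\<^sup>2) * iexp (t * W p)) \<partial>R)"
    by (simp add: sum.distrib scaleR_add_right)
  also have "r *\<^sub>R (\<integral>p. (\<Sum>i=1..m. \<Sum>j=m+1..m+n. (\<i> * t * (D p i j)\<^sup>2) * iexp (t * W p)) \<partial>R)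
      = (\<integral>p. (\<i> * t) * (V p * iexp (t * W p)) \<partial>R)"
    by (subst integral_scaleR_right[symmetric])
      (simp add: V_def sum_distrib_left sum_distrib_right scaleR_conv_of_real mult_ac)
  also have "\<dots> = (\<i> * t) * (\<integral>p. V p * iexp (t * W p) \<partial>R)"
    by simp
  finally have eq: "(\<integral>p. W p *\<^sub>R iexp (t * W p) \<partial>R) - \<i> * t * v * (\<integral>p. iexp (t * W p) \<partial>R) =
      r *\<^sub>R (\<Sum>i=1..m. \<Sum>j=m+1..m+n. \<integral>p. \<rho> p i j \<partial>R) +
      (\<i> * t) * (\<integral>p. (V p - v) * iexp (t * W p) \<partial>R)"
    by (simp add: ring_distribs)
  have "cmod (r *\<^sub>R (\<Sum>i=1..m. \<Sum>j=m+1..m+n. \<integral>p. \<rho> p i j \<partial>R)) \<le>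
      r * (\<Sum>i=1..m. \<Sum>j=m+1..m+n. \<integral>p. cmod (\<rho> p i j) \<partial>R)"
    using r by (simp only: norm_scaleR abs_of_nonneg)
      (intro mult_left_mono sum_norm_le order_trans[OF norm_sum] integral_norm_bound)
  also have "\<dots> \<le> (4 * c * B ^ 3) / 2"
    unfolding r_def
  proof (rule average_pairs_le[OF mn])
    fix i j assume ij: "i \<in> {1..m}" "j \<in> {m+1..m+n}"
    have "(\<integral>p. cmod (\<rho> p i j) \<partial>R) \<le> (\<integral>p. c\<^sup>2 * (4 * c * B ^ 3) \<partial>R)"
      unfolding R_def by (intro integral_random_permutation_mono \<rho> ij)
    then show "(\<integral>p. cmod (\<rho> p i j) \<partial>R) \<le> (1 / real m + 1 / real n) * (4 * c * B ^ 3)"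
      by (simp only: int1 c)
  qed
  finally have 1: "cmod (r *\<^sub>R (\<Sum>i=1..m. \<Sum>j=m+1..m+n. \<integral>p. \<rho> p i j \<partial>R)) \<le> 2 * c * B ^ 3"
    by simp
  have "cmod ((\<i> * t) * (\<integral>p. (V p - v) * iexp (t * W p) \<partial>R)) \<le> 1 * (\<integral>p. \<bar>V p - v\<bar> \<partial>R)"
  proof -
    have "cmod (\<integral>p. (V p - v) * iexp (t * W p) \<partial>R) \<le> (\<integral>p. cmod ((V p - v) * iexp (t * W p)) \<partial>R)"
      by (rule integral_norm_bound)
    also have "\<dots> = (\<integral>p. \<bar>V p - v\<bar> \<partial>R)"
      by (simp add: norm_mult flip: of_real_diff)
    finally show ?thesis
      unfolding norm_mult using t by (intro mult_mono) auto
  qed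
  also have "\<dots> \<le> (\<integral>p. c * \<bar>two_sample m n (\<lambda>i. (x i)\<^sup>2) p\<bar> + c * B * \<bar>W p\<bar> + c\<^sup>2 * (W p)\<^sup>2 \<partial>R)"
    unfolding V_def v_def R_def W_def D_def r_def mult_1
    by (intro integral_random_permutation_mono) (use sum_swap_diff_square[OF mn _ B] in \<open>simp only: c_def\<close>)
  also have "\<dots> = c * (\<integral>p. \<bar>two_sample m n (\<lambda>i. (x i)\<^sup>2) p\<bar> \<partial>R) + c * B * (\<integral>p. \<bar>W p\<bar> \<partial>R) + c\<^sup>2 * (\<integral>p. (W p)\<^sup>2 \<partial>R)"
    by simp
  \<comment> \<open>The moment bounds are used with range \<open>B\<^sup>2\<close> for the squared
    population and range \<open>2 * B\<close> for \<open>x\<close> itself.\<close>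
  also have "\<dots> \<le> c * (1 + (B\<^sup>2)\<^sup>2 / 2) + c * B * (1 + (2 * B)\<^sup>2 / 2) + c\<^sup>2 * ((2 * B)\<^sup>2 / 2)"
    unfolding R_def W_def using c \<open>B \<ge> 0\<close>
    by (intro add_mono mult_left_mono abs_two_sample_integral_le[OF mn] two_sample_second_moment[OF mn] L L2) auto
  also have "\<dots> = c * (1 + B + 2 * B ^ 3 + B ^ 4 / 2) + 2 * c\<^sup>2 * B\<^sup>2"
    by (simp add: power_mult_distrib power3_eq_cube power2_eq_square power4_eq_xxxx algebra_simps)
  also have "\<dots> \<le> c * (1 + B + 2 * B ^ 3 + B ^ 4) + 2 * c\<^sup>2 * B\<^sup>2"
    using c \<open>B \<ge> 0\<close> by (intro add_right_mono mult_left_mono) auto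
  finally have 2: "cmod ((\<i> * t) * (\<integral>p. (V p - v) * iexp (t * W p) \<partial>R)) \<le>
      c * (1 + B + 2 * B ^ 3 + B ^ 4) + 2 * c\<^sup>2 * B\<^sup>2" .
  have "cmod ((\<integral>p. W p *\<^sub>R iexp (t * W p) \<partial>R) - \<i> * t * v * (\<integral>p. iexp (t * W p) \<partial>R)) \<le>
    2 * c * B ^ 3 + (c * (1 + B + 2 * B ^ 3 + B ^ 4) + 2 * c\<^sup>2 * B\<^sup>2)"
    unfolding eq using 1 2 by (rule norm_triangle_mono)
  then show ?thesis
    unfolding v_def by (simp add: algebra_simps)
qed

text \<open>An integrating factor: as \<open>\<phi>\<close> nearly solves
  \<open>\<phi>' t = - v * t * \<phi> t\<close>, the product
  \<open>exp (v * t^2 / 2) * \<phi> t\<close> has a small derivative and stays near its value 1 at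
  0. At \<open>t = 1\<close> the growth factor cancels against \<open>exp (- v / 2)\<close>, so the
  error is independent of \<open>v\<close>. The frequency 1 is general enough, since a frequency can
  be absorbed into \<open>x\<close>.\<close>

lemma two_sample_char:
  assumes mn: "m > 0" "n > 0" and B: "\<And>i. i \<in> {1..m+n} \<Longrightarrow> \<bar>x i\<bar> \<le> B"
  defines "c \<equiv> sqrt (1 / real m + 1 / real n)"
  shows "cmod ((\<integral>p. iexp (two_sample m n x p) \<partial>random_permutation (m + n)) - exp (- pop_var (m + n) x / 2))
    \<le> c * (1 + B + 4 * B ^ 3 + B ^ 4) + 2 * c\<^sup>2 * B\<^sup>2" (is "_ \<le> ?\<delta>")
proof -
  define R where "R = random_permutation (m + n)"
  define W where "W = two_sample m n x"
  define v where "v = pop_var (m + n) x"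
  define \<phi> where "\<phi> t = (\<integral>p. iexp (t * W p) \<partial>R)" for t
  define \<phi>' where "\<phi>' t = \<i> * (\<integral>p. W p *\<^sub>R iexp (t * W p) \<partial>R)" for t
  define \<psi> where "\<psi> t = exp (v * t\<^sup>2 / 2) *\<^sub>R \<phi> t" for t
  define \<psi>' where "\<psi>' t = exp (v * t\<^sup>2 / 2) *\<^sub>R (\<phi>' t + (v * t) *\<^sub>R \<phi> t)" for t
  have "v \<ge> 0"
    by (simp add: v_def pop_var_nonneg)
  have "(\<phi> has_vector_derivative \<phi>' t) (at t within S)" for t S
  proof -
    \<comment> \<open>The integral is a finite sum over permutations and is differentiated term by
      term.\<close>
    have "\<phi> = (\<lambda>t. (\<Sum>p | p permutes {1..m+n}. iexp (t * W p)) /\<^sub>R real (card {p. p permutes {1..m+n}}))"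
      unfolding \<phi>_def R_def integral_random_permutation_eq_sum by simp
    moreover have "\<phi>' t = (\<Sum>p | p permutes {1..m+n}. \<i> * (W p *\<^sub>R iexp (t * W p))) /\<^sub>R real (card {p. p permutes {1..m+n}})"
      unfolding \<phi>'_def R_def integral_random_permutation_eq_sum by (simp add: sum_distrib_left scaleR_sum_right)
    moreover have "((\<lambda>t. iexp (t * w)) has_vector_derivative \<i> * (w *\<^sub>R iexp (t * w))) (at t within S)" for w
      using exp_scaleR_has_vector_derivative_right[of "\<i> * w" t S]
      by (simp add: scaleR_conv_of_real mult_ac)
    ultimately show ?thesis
      by (simp only:) (intro has_vector_derivative_scaleR[OF DERIV_const, simplified] has_vector_derivative_sum)
  qed
  then have deriv: "(\<psi> has_vector_derivative \<psi>' t) (at t within S)" for t S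
    unfolding \<psi>_def \<psi>'_def
    by (auto intro!: derivative_eq_intros simp: scaleR_add_right)
  have bound: "norm (\<psi>' t) \<le> exp (v / 2) * ?\<delta>" if "t \<in> {0..1}" for t
  proof -
    have "\<bar>t\<bar> \<le> 1"
      using that by auto
    have "\<i> * (a - \<i> * t * v * b) = \<i> * a - (\<i> * \<i>) * (v * t * b)" for a b :: complex
      by (simp only: right_diff_distrib of_real_mult mult_ac)
    then have "\<phi>' t + (v * t) *\<^sub>R \<phi> t = \<i> * ((\<integral>p. W p *\<^sub>R iexp (t * W p) \<partial>R) - \<i> * t * v * \<phi> t)"
      by (simp add: \<phi>'_def scaleR_conv_of_real)
    then have "norm (\<phi>' t + (v * t) *\<^sub>R \<phi> t) \<le> ?\<delta>"
      using two_sample_char_derivative[OF mn B \<open>\<bar>t\<bar> \<le> 1\<close>]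
      by (simp add: norm_mult R_def W_def v_def \<phi>_def c_def)
    moreover have "exp (v * t\<^sup>2 / 2) \<le> exp (v / 2)"
      using that \<open>v \<ge> 0\<close> by (simp add: mult_left_le power_le_one)
    ultimately show ?thesis
      unfolding \<psi>'_def norm_scaleR by (intro mult_mono) auto
  qed
  have "norm (\<psi> 1 - \<psi> 0) \<le> exp (v / 2) * ?\<delta> * norm (1 - 0 :: real)"
  proof (rule differentiable_bound[of "{0..1}" \<psi> "\<lambda>t h. h *\<^sub>R \<psi>' t"])
    show "(\<psi> has_derivative (\<lambda>h. h *\<^sub>R \<psi>' t)) (at t within {0..1})" for t
      using deriv by (simp add: has_vector_derivative_def)
    show "onorm (\<lambda>h. h *\<^sub>R \<psi>' t) \<le> exp (v / 2) * ?\<delta>" if "t \<in> {0..1}" for t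
      using bound[OF that] by (simp add: onorm_scaleR_left[OF bounded_linear_ident] onorm_id)
  qed auto
  moreover have "\<psi> 0 = 1"
    by (simp add: \<psi>_def \<phi>_def R_def)
  moreover have "\<phi> 1 - exp (- v / 2) = exp (- v / 2) *\<^sub>R (\<psi> 1 - 1)"
    by (simp add: \<psi>_def scaleR_diff_right flip: exp_add) (simp add: scaleR_conv_of_real)
  ultimately have "norm (\<phi> 1 - exp (- v / 2)) \<le> exp (- v / 2) * (exp (v / 2) * ?\<delta>)"
    by (simp only: norm_scaleR abs_exp_cancel) (intro mult_left_mono, simp_all)
  also have "\<dots> = ?\<delta>"
    by (simp flip: exp_add mult.assoc)
  finally show ?thesis
    by (simp add: \<phi>_def R_def W_def v_def)
qed

section \<open>Empirical measures of halfspaces\<close>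

lemma integral_empirical_measure:
  fixes f :: "'a::topological_space \<Rightarrow> real"
  assumes N: "N > 0" and f [measurable]: "f \<in> borel_measurable borel"
  shows "(\<integral>u. f u \<partial>empirical_measure U N) = (\<Sum>i=1..N. f (U i)) / real N"
proof -
  let ?p = "pmf_of_set {1..N}"
  have ne: "{1..N} \<noteq> {}" "finite {1..N}"
    using N by auto
  \<comment> \<open>The empirical measure is the law of \<open>U\<close> at a uniformly chosen
    index.\<close>
  have "empirical_measure U N = distr (measure_pmf ?p) borel U"
  proof (rule measure_eqI)
    fix A assume "A \<in> sets (empirical_measure U N)"
    then have A: "A \<in> sets borel"
      by simp
    have "emeasure (distr (measure_pmf ?p) borel U) A = (\<integral>\<^sup>+i. indicator A (U i) \<partial>measure_pmf ?p)"
      using A by (subst emeasure_distr) (auto simp flip: nn_integral_indicator intro!: nn_integral_cong simp: indicator_def)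
    also have "\<dots> = (\<Sum>i=1..N. indicator A (U i)) / of_nat N"
      by (subst nn_integral_pmf_of_set[OF ne]) simp
    also have "\<dots> = ennreal (1 / real N) * (\<Sum>i=1..N. indicator A (U i))"
      using N by (simp add: divide_ennreal_def inverse_ennreal ennreal_of_nat_eq_real_of_nat inverse_eq_divide mult.commute)
    finally show "emeasure (empirical_measure U N) A = emeasure (distr (measure_pmf ?p) borel U) A"
      using A by (simp add: emeasure_empirical_measure)
  qed simp
  then have "(\<integral>u. f u \<partial>empirical_measure U N) = (\<integral>i. f (U i) \<partial>measure_pmf ?p)"
    by (simp add: integral_distr)
  also have "\<dots> = (\<Sum>i=1..N. f (U i)) / real N"
    by (subst integral_pmf_of_set[OF ne]) simp
  finally show ?thesis .
qed

text \<open>A squeeze in two limits: for each \<open>j\<close> the bounds converge in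
  \<open>k\<close>, and their limits close up as \<open>j\<close> grows. In the use below,
  \<open>j\<close> is the steepness of a continuous approximation to an indicator.\<close>

lemma LIMSEQ_squeeze_family:
  fixes b :: "nat \<Rightarrow> real"
  assumes "\<And>j. l j \<longlonglongrightarrow> L j" "\<And>j. u j \<longlonglongrightarrow> V j" "L \<longlonglongrightarrow> x" "V \<longlonglongrightarrow> x"
    and "\<And>j k. l j k \<le> b k" "\<And>j k. b k \<le> u j k"
  shows "b \<longlonglongrightarrow> x"
proof (rule order_tendstoI)
  fix a assume "a < x"
  then obtain j where "a < L j"
    using order_tendstoD(1)[OF assms(3)] by (auto simp: eventually_sequentially)
  then have "\<forall>\<^sub>F k in sequentially. a < l j k"
    by (rule order_tendstoD(1)[OF assms(1)])
  then show "\<forall>\<^sub>F k in sequentially. a < b k"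
    by (rule eventually_mono) (use assms(5) less_le_trans in blast)
next
  fix a assume "x < a"
  then obtain j where "V j < a"
    using order_tendstoD(2)[OF assms(4)] by (auto simp: eventually_sequentially)
  then have "\<forall>\<^sub>F k in sequentially. u j k < a"
    by (rule order_tendstoD(2)[OF assms(2)])
  then show "\<forall>\<^sub>F k in sequentially. b k < a"
    by (rule eventually_mono) (use assms(6) le_less_trans in blast)
qed

section \<open>Null hyperplanes and continuous approximations of halfspaces\<close>

lemma prob_space_uniform_cube: "prob_space (uniform_cube :: (real ^ 'd) measure)"
  unfolding uniform_cube_def
proof (rule prob_space_uniform_measure)
  show "emeasure lborel (cbox 0 1 :: (real ^ 'd) set) \<noteq> \<infinity>"
    by (simp add: emeasure_lborel_cbox_eq)
  have "measure lborel (cbox 0 1 :: (real ^ 'd) set) = 1"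
    by (subst content_cbox_cart) (auto simp: interval_eq_empty_cart)
  then show "emeasure lborel (cbox 0 1 :: (real ^ 'd) set) \<noteq> 0"
    by (auto simp: measure_def)
qed

lemma sets_uniform_cube [simp, measurable_cong]: "sets uniform_cube = sets borel"
  and space_uniform_cube [simp]: "space uniform_cube = UNIV"
  by (simp_all add: uniform_cube_def)

lemma hyperplane_null_uniform_cube:
  fixes a :: "real ^ 'd"
  assumes "a \<noteq> 0"
  shows "AE u in uniform_cube. a \<bullet> u \<noteq> r"
proof -
  have "{u. a \<bullet> u = r} \<in> null_sets lebesgue"
    using negligible_hyperplane[of a r] assms by (simp add: negligible_iff_null_sets)
  moreover have "{u. a \<bullet> u = r} \<in> sets lborel"
    by simp
  ultimately have "emeasure lborel {u. a \<bullet> u = r} = 0"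
    by (simp add: null_sets_def)
  then have "AE u in lborel. a \<bullet> u \<noteq> r"
    by (intro AE_I[of _ _ "{u. a \<bullet> u = r}"]) auto
  then show ?thesis
    unfolding uniform_cube_def
    by (intro AE_uniform_measureI) auto
qed

text \<open>For positive \<open>j\<close> the upper ramp is 1 on \<open>{..0}\<close> and reaches 0
  at \<open>1 / j\<close>; the lower ramp falls from 1 at \<open>- 1 / j\<close> to 0 at 0. At 0
  itself the lower ramp is always 0 while the indicator is 1, hence the exclusion.\<close>

lemma ramp_conv:
  fixes x :: real
  shows "(\<lambda>j. max 0 (min 1 (1 - real j * x))) \<longlonglongrightarrow> indicator {..0} x" (is ?A)
    and "x \<noteq> 0 \<Longrightarrow> (\<lambda>j. max 0 (min 1 (- (real j * x)))) \<longlonglongrightarrow> indicator {..0} x" (is "_ \<Longrightarrow> ?B")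
proof -
  have ev: "\<forall>\<^sub>F j in sequentially. 1 \<le> real j * \<bar>x\<bar>" if "x \<noteq> 0"
  proof -
    obtain n :: nat where "1 / \<bar>x\<bar> \<le> real n"
      using real_arch_simple by blast
    then have "1 \<le> real j * \<bar>x\<bar>" if "j \<ge> n" for j
      using that \<open>x \<noteq> 0\<close> by (simp add: field_simps) (meson abs_ge_zero mult_left_mono of_nat_mono order_trans)
    then show ?thesis
      by (auto simp: eventually_sequentially)
  qed
  show ?A
  proof (cases "x \<le> 0")
    case True
    then have "1 \<le> 1 - real j * x" for j
      by (simp add: mult_nonneg_nonpos)
    then have "max 0 (min 1 (1 - real j * x)) = 1" for j
      by (simp add: min_def)
    with True show ?thesis
      by simp
  next
    case False
    then have "\<forall>\<^sub>F j in sequentially. max 0 (min 1 (1 - real j * x)) = 0"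
      using ev by (auto elim: eventually_mono)
    with False show ?thesis
      by (simp add: tendsto_eventually)
  qed
  show ?B if "x \<noteq> 0"
  proof (cases "x < 0")
    case True
    then have "\<forall>\<^sub>F j in sequentially. max 0 (min 1 (- (real j * x))) = 1"
      using ev by (auto elim!: eventually_mono)
    with True show ?thesis
      by (simp add: tendsto_eventually)
  next
    case False
    then have "min 1 (- (real j * x)) \<le> 0" for j
      by (intro min.coboundedI2) simp
    then have "max 0 (min 1 (- (real j * x))) = 0" for j
      by (rule max_absorb1)
    with False that show ?thesis
      by simp
  qed
qed

text \<open>Indicators of halfspaces are not continuous, so weak convergence is applied to products
  of ramps from below and from above. Their integrals over the cube close up because the two
  boundary hyperplanes, having nonzero normals, are null.\<close>

lemma empirical_halfspaces_conv:
  fixes U :: "nat \<Rightarrow> real ^ 'd" and N :: "nat \<Rightarrow> nat"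
  assumes conv: "\<And>f :: real ^ 'd \<Rightarrow> real. continuous_on UNIV f \<Longrightarrow> bounded (range f) \<Longrightarrow>
      (\<lambda>k. (\<Sum>i=1..N k. f (U i)) / real (N k)) \<longlonglongrightarrow> (\<integral>u. f u \<partial>uniform_cube)"
    and a: "a1 \<noteq> 0" "a2 \<noteq> 0"
  shows "(\<lambda>k. (\<Sum>i=1..N k. indicator {u. a1 \<bullet> u \<le> r1} (U i) * indicator {u. a2 \<bullet> u \<le> r2} (U i)) / real (N k))
    \<longlonglongrightarrow> measure uniform_cube {u. a1 \<bullet> u \<le> r1 \<and> a2 \<bullet> u \<le> r2}"
proof -
  interpret prob_space "uniform_cube :: (real ^ 'd) measure"
    by (rule prob_space_uniform_cube)
  define up where "up j x = max 0 (min 1 (1 - real j * x))" for j x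
  define lo where "lo j x = max 0 (min 1 (- (real j * x)))" for j x
  define H where "H = {u. a1 \<bullet> u \<le> r1 \<and> a2 \<bullet> u \<le> r2}"
  let ?ind = "\<lambda>x::real. indicator {..0} x :: real"
  have lo_0: "lo j x = 0" if "x > 0" for j x
  proof -
    have "min 1 (- (real j * x)) \<le> 0"
      using that by (intro min.coboundedI2) simp
    then show ?thesis
      by (simp add: lo_def)
  qed
  have up: "0 \<le> up j x" "up j x \<le> 1" "?ind x \<le> up j x" and lo: "0 \<le> lo j x" "lo j x \<le> 1" "lo j x \<le> ?ind x" for j x
    using lo_0[of x j] by (auto simp: up_def lo_def indicator_def mult_nonneg_nonpos)
  have [measurable]: "up j \<in> borel_measurable borel" "lo j \<in> borel_measurable borel" for j
    unfolding up_def lo_def by measurable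
  have ind: "indicator {u. a1 \<bullet> u \<le> r1} u * indicator {u. a2 \<bullet> u \<le> r2} u = ?ind (a1 \<bullet> u - r1) * ?ind (a2 \<bullet> u - r2)"
    and indH: "indicator H u = ?ind (a1 \<bullet> u - r1) * ?ind (a2 \<bullet> u - r2)" for u
    by (auto simp: H_def indicator_def)
  have bound: "0 \<le> x * y \<and> x * y \<le> 1" if "0 \<le> x" "x \<le> 1" "0 \<le> y" "y \<le> 1" for x y :: real
    using that by (simp add: mult_le_one)
  have conv_fun: "(\<lambda>k. (\<Sum>i=1..N k. g (a1 \<bullet> U i - r1) * g (a2 \<bullet> U i - r2)) / real (N k)) \<longlonglongrightarrow>
      (\<integral>u. g (a1 \<bullet> u - r1) * g (a2 \<bullet> u - r2) \<partial>uniform_cube)"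
    if "continuous_on UNIV g" "\<And>x. 0 \<le> g x" "\<And>x. g x \<le> 1" for g :: "real \<Rightarrow> real"
  proof (rule conv)
    show "continuous_on UNIV (\<lambda>u. g (a1 \<bullet> u - r1) * g (a2 \<bullet> u - r2))"
      by (intro continuous_intros continuous_on_compose2[OF that(1)]) auto
    show "bounded (range (\<lambda>u. g (a1 \<bullet> u - r1) * g (a2 \<bullet> u - r2)))"
      using bound that(2,3) by (intro boundedI[of _ 1]) fastforce
  qed
  have intH: "(\<integral>u. ?ind (a1 \<bullet> u - r1) * ?ind (a2 \<bullet> u - r2) \<partial>uniform_cube) = measure uniform_cube H"
    unfolding indH[symmetric] by (simp add: H_def)
  show ?thesis
    unfolding ind H_def[symmetric]
  proof (rule LIMSEQ_squeeze_family)
    show "(\<lambda>k. (\<Sum>i=1..N k. lo j (a1 \<bullet> U i - r1) * lo j (a2 \<bullet> U i - r2)) / real (N k)) \<longlonglongrightarrow>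
        (\<integral>u. lo j (a1 \<bullet> u - r1) * lo j (a2 \<bullet> u - r2) \<partial>uniform_cube)" for j
      using lo by (intro conv_fun) (auto simp: lo_def intro!: continuous_intros)
    show "(\<lambda>k. (\<Sum>i=1..N k. up j (a1 \<bullet> U i - r1) * up j (a2 \<bullet> U i - r2)) / real (N k)) \<longlonglongrightarrow>
        (\<integral>u. up j (a1 \<bullet> u - r1) * up j (a2 \<bullet> u - r2) \<partial>uniform_cube)" for j
      using up by (intro conv_fun) (auto simp: up_def intro!: continuous_intros)
    \<comment> \<open>The null hyperplanes enter here: the lower ramps converge to the indicators
      only off the boundary.\<close>
    show "(\<lambda>j. \<integral>u. lo j (a1 \<bullet> u - r1) * lo j (a2 \<bullet> u - r2) \<partial>uniform_cube) \<longlonglongrightarrow> measure uniform_cube H"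
      unfolding intH[symmetric]
    proof (rule integral_dominated_convergence[where w = "\<lambda>_. 1"])
      show "AE u in uniform_cube. (\<lambda>j. lo j (a1 \<bullet> u - r1) * lo j (a2 \<bullet> u - r2)) \<longlonglongrightarrow>
          ?ind (a1 \<bullet> u - r1) * ?ind (a2 \<bullet> u - r2)"
        using hyperplane_null_uniform_cube[OF a(1), of r1] hyperplane_null_uniform_cube[OF a(2), of r2]
        by eventually_elim (auto simp: lo_def intro!: tendsto_mult ramp_conv(2))
      show "AE u in uniform_cube. norm (lo j (a1 \<bullet> u - r1) * lo j (a2 \<bullet> u - r2)) \<le> 1" for j
        using bound lo by (intro AE_I2) fastforce
    qed simp_all
    show "(\<lambda>j. \<integral>u. up j (a1 \<bullet> u - r1) * up j (a2 \<bullet> u - r2) \<partial>uniform_cube) \<longlonglongrightarrow> measure uniform_cube H"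
      unfolding intH[symmetric]
    proof (rule integral_dominated_convergence[where w = "\<lambda>_. 1"])
      show "AE u in uniform_cube. (\<lambda>j. up j (a1 \<bullet> u - r1) * up j (a2 \<bullet> u - r2)) \<longlonglongrightarrow>
          ?ind (a1 \<bullet> u - r1) * ?ind (a2 \<bullet> u - r2)"
        unfolding up_def by (intro AE_I2 tendsto_mult ramp_conv(1))
      show "AE u in uniform_cube. norm (up j (a1 \<bullet> u - r1) * up j (a2 \<bullet> u - r2)) \<le> 1" for j
        using bound up by (intro AE_I2) fastforce
    qed simp_all
  next
    fix j k
    show "(\<Sum>i=1..N k. lo j (a1 \<bullet> U i - r1) * lo j (a2 \<bullet> U i - r2)) / real (N k)
        \<le> (\<Sum>i=1..N k. ?ind (a1 \<bullet> U i - r1) * ?ind (a2 \<bullet> U i - r2)) / real (N k)"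
      using lo by (intro divide_right_mono sum_mono mult_mono) auto
    show "(\<Sum>i=1..N k. ?ind (a1 \<bullet> U i - r1) * ?ind (a2 \<bullet> U i - r2)) / real (N k)
        \<le> (\<Sum>i=1..N k. up j (a1 \<bullet> U i - r1) * up j (a2 \<bullet> U i - r2)) / real (N k)"
      using up by (intro divide_right_mono sum_mono mult_mono) auto
  qed
qed

text \<open>The coefficients of this quadratic form are empirical covariances, the finite
  counterparts of \<open>halfspace_kernel\<close>, so convergence can be checked entry by
  entry.\<close>

lemma pop_var_linear_combination:
  assumes "N > 0"
  shows "pop_var N (\<lambda>i. \<Sum>j\<in>J. z j * h j i) = (\<Sum>j\<in>J. \<Sum>l\<in>J. z j * z l *
    ((\<Sum>i=1..N. h j i * h l i) / real N - (\<Sum>i=1..N. h j i) / real N * ((\<Sum>i=1..N. h l i) / real N)))"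
proof -
  have "(\<Sum>i=1..N. (\<Sum>j\<in>J. z j * h j i)\<^sup>2) = (\<Sum>i=1..N. \<Sum>j\<in>J. \<Sum>l\<in>J. z j * z l * (h j i * h l i))"
    by (simp add: power2_eq_square sum_product mult_ac)
  also have "\<dots> = (\<Sum>j\<in>J. \<Sum>i=1..N. \<Sum>l\<in>J. z j * z l * (h j i * h l i))"
    by (rule sum.swap)
  also have "\<dots> = (\<Sum>j\<in>J. \<Sum>l\<in>J. \<Sum>i=1..N. z j * z l * (h j i * h l i))"
    by (intro sum.cong refl sum.swap)
  finally have 1: "(\<Sum>i=1..N. (\<Sum>j\<in>J. z j * h j i)\<^sup>2) / real N =
      (\<Sum>j\<in>J. \<Sum>l\<in>J. z j * z l * ((\<Sum>i=1..N. h j i * h l i) / real N))"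
    by (simp add: sum_divide_distrib sum_distrib_left)
  have "(\<Sum>i=1..N. \<Sum>j\<in>J. z j * h j i) / real N = (\<Sum>j\<in>J. z j * ((\<Sum>i=1..N. h j i) / real N))"
    by (subst sum.swap) (simp add: sum_divide_distrib sum_distrib_left)
  then have 2: "((\<Sum>i=1..N. \<Sum>j\<in>J. z j * h j i) / real N)\<^sup>2 =
      (\<Sum>j\<in>J. \<Sum>l\<in>J. z j * z l * ((\<Sum>i=1..N. h j i) / real N * ((\<Sum>i=1..N. h l i) / real N)))"
    by (simp add: power2_eq_square sum_product mult_ac)
  show ?thesis
    unfolding pop_var_def 1 2 by (simp only: right_diff_distrib sum_subtractf)
qed

lemma pop_var_halfspaces_conv:
  fixes U :: "nat \<Rightarrow> real ^ 'd" and N :: "nat \<Rightarrow> nat" and t :: "'j \<Rightarrow> (real ^ 'd) \<times> real"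
  assumes N: "\<And>k. N k > 0"
    and conv: "\<And>f :: real ^ 'd \<Rightarrow> real. continuous_on UNIV f \<Longrightarrow> bounded (range f) \<Longrightarrow>
      (\<lambda>k. (\<Sum>i=1..N k. f (U i)) / real (N k)) \<longlonglongrightarrow> (\<integral>u. f u \<partial>uniform_cube)"
    and t: "\<And>j. j \<in> J \<Longrightarrow> fst (t j) \<noteq> 0"
  shows "(\<lambda>k. pop_var (N k) (\<lambda>i. \<Sum>j\<in>J. z j * indicator {u. fst (t j) \<bullet> u \<le> snd (t j)} (U i)))
    \<longlonglongrightarrow> (\<Sum>j\<in>J. \<Sum>l\<in>J. z j * z l * halfspace_kernel (t j) (t l))"
proof -
  \<comment> \<open>A single halfspace is its intersection with itself.\<close>
  have single: "(\<lambda>k. (\<Sum>i=1..N k. indicator {u. fst (t j) \<bullet> u \<le> snd (t j)} (U i)) / real (N k)) \<longlonglongrightarrow>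
      measure uniform_cube {u. fst (t j) \<bullet> u \<le> snd (t j)}" if "j \<in> J" for j
    using empirical_halfspaces_conv[OF conv t[OF that] t[OF that], of "snd (t j)" "snd (t j)"]
    by (simp flip: indicator_inter_arith)
  show ?thesis
    unfolding pop_var_linear_combination[OF N] halfspace_kernel_def split_beta
    by (intro tendsto_sum tendsto_mult_left tendsto_diff tendsto_mult empirical_halfspaces_conv single conv t)
qed

section \<open>Finite-dimensional limits of the permutation field\<close>

lemma Theta_perm_eq_two_sample:
  "Theta_perm U m n p t = two_sample m n (\<lambda>i. indicator {u. fst t \<bullet> u \<le> snd t} (U i)) p"
  by (simp add: Theta_perm_def two_sample_def split_beta)

text \<open>By linearity the exponent is one two-sample statistic, whose population is bounded by
  the sum of the \<open>\<bar>z j\<bar>\<close> for every \<open>k\<close>. The error of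
  \<open>two_sample_char\<close> vanishes because both sample sizes diverge, and the population
  variance converges to the quadratic form of the kernel.\<close>

lemma Theta_perm_char_conv:
  fixes U :: "nat \<Rightarrow> real ^ 'd" and m n :: "nat \<Rightarrow> nat" and t :: "'j \<Rightarrow> (real ^ 'd) \<times> real"
  assumes pos: "\<And>k. m k > 0" "\<And>k. n k > 0" and lim: "filterlim m at_top sequentially" "filterlim n at_top sequentially"
    and conv: "\<And>f :: real ^ 'd \<Rightarrow> real. continuous_on UNIV f \<Longrightarrow> bounded (range f) \<Longrightarrow>
      (\<lambda>k. (\<Sum>i=1..m k + n k. f (U i)) / real (m k + n k)) \<longlonglongrightarrow> (\<integral>u. f u \<partial>uniform_cube)"
    and t: "\<And>j. j \<in> J \<Longrightarrow> fst (t j) \<noteq> 0"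
  shows "(\<lambda>k. \<integral>p. iexp (\<Sum>j\<in>J. z j * Theta_perm U (m k) (n k) p (t j)) \<partial>random_permutation (m k + n k))
    \<longlonglongrightarrow> exp (- (\<Sum>j\<in>J. \<Sum>l\<in>J. z j * z l * halfspace_kernel (t j) (t l)) / 2)"
proof -
  define x where "x i = (\<Sum>j\<in>J. z j * indicator {u. fst (t j) \<bullet> u \<le> snd (t j)} (U i))" for i
  define B where "B = (\<Sum>j\<in>J. \<bar>z j\<bar>)"
  have B: "\<bar>x i\<bar> \<le> B" for i
    unfolding x_def B_def by (intro sum_abs[THEN order_trans] sum_mono) (auto simp: indicator_def)
  define c where "c k = sqrt (1 / real (m k) + 1 / real (n k))" for k
  define v where "v k = pop_var (m k + n k) x" for k
  have "c \<longlonglongrightarrow> sqrt (0 + 0)"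
    unfolding c_def
    by (intro tendsto_intros lim_1_over_n[THEN filterlim_compose] lim)
  then have "(\<lambda>k. c k * (1 + B + 4 * B ^ 3 + B ^ 4) + 2 * (c k)\<^sup>2 * B\<^sup>2) \<longlonglongrightarrow> 0 * (1 + B + 4 * B ^ 3 + B ^ 4) + 2 * 0\<^sup>2 * B\<^sup>2"
    by (intro tendsto_intros) simp_all
  then have c0: "(\<lambda>k. c k * (1 + B + 4 * B ^ 3 + B ^ 4) + 2 * (c k)\<^sup>2 * B\<^sup>2) \<longlonglongrightarrow> 0"
    by simp
  have "(\<lambda>k. (\<integral>p. iexp (two_sample (m k) (n k) x p) \<partial>random_permutation (m k + n k)) - exp (- v k / 2)) \<longlonglongrightarrow> 0"
  proof (rule Lim_null_comparison[OF _ c0], intro always_eventually allI)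
    fix k
    show "cmod ((\<integral>p. iexp (two_sample (m k) (n k) x p) \<partial>random_permutation (m k + n k)) - exp (- v k / 2)) \<le>
        c k * (1 + B + 4 * B ^ 3 + B ^ 4) + 2 * (c k)\<^sup>2 * B\<^sup>2"
      using two_sample_char[OF pos, of k k x B] B by (simp only: v_def c_def)
  qed
  moreover have "v \<longlonglongrightarrow> (\<Sum>j\<in>J. \<Sum>l\<in>J. z j * z l * halfspace_kernel (t j) (t l))"
    unfolding v_def x_def using pos by (intro pop_var_halfspaces_conv conv t) auto
  then have "(\<lambda>k. complex_of_real (exp (- v k / 2))) \<longlonglongrightarrow>
      complex_of_real (exp (- (\<Sum>j\<in>J. \<Sum>l\<in>J. z j * z l * halfspace_kernel (t j) (t l)) / 2))"
    by (intro tendsto_intros) auto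
  ultimately have "(\<lambda>k. (\<integral>p. iexp (two_sample (m k) (n k) x p) \<partial>random_permutation (m k + n k))) \<longlonglongrightarrow>
      complex_of_real (exp (- (\<Sum>j\<in>J. \<Sum>l\<in>J. z j * z l * halfspace_kernel (t j) (t l)) / 2))"
    by (rule Lim_transform[rotated])
  then show ?thesis
    unfolding Theta_perm_eq_two_sample two_sample_sum x_def .
qed

section \<open>Laplace transforms of square integrals\<close>

lemma integral_iexp_std_normal:
  "(\<integral>z. iexp (z * w) \<partial>std_normal_distribution) = exp (- w\<^sup>2 / 2)"
  using fun_cong[OF char_std_normal_distribution, of w] by (simp add: char_def mult.commute)

lemma exp_neg_approx:
  fixes x :: real
  assumes "x \<ge> 0"
  shows "\<bar>exp (- x) - (1 - x)\<bar> \<le> x\<^sup>2 / 2"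
proof -
  have "1 - x \<le> exp (- x)"
    using exp_ge_add_one_self[of "- x"] by simp
  moreover have "exp (- x) \<le> 1 - x + x\<^sup>2 / 2"
  proof -
    define h where "h y = 1 - y + y\<^sup>2 / 2 - exp (- y)" for y :: real
    have "h 0 \<le> h x"
    proof (rule DERIV_nonneg_imp_nondecreasing[OF assms])
      fix y :: real
      have "(h has_real_derivative (- 1 + y + exp (- y))) (at y)"
        unfolding h_def by (auto intro!: derivative_eq_intros)
      moreover have "- 1 + y + exp (- y) \<ge> 0"
        using exp_ge_add_one_self[of "- y"] by simp
      ultimately show "\<exists>z. (h has_real_derivative z) (at y) \<and> 0 \<le> z"
        by blast
    qed
    then show ?thesis
      by (simp add: h_def)
  qed
  ultimately show ?thesis
    by (simp add: abs_le_iff)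
qed

text \<open>Both \<open>exp (- E y / K)\<close> and \<open>E exp (- y / K)\<close> agree with
  \<open>1 - E y / K\<close> to second order. They lie in the unit interval, where taking
  \<open>K\<close>-th powers enlarges distances at most \<open>K\<close> times, so an error of order
  \<open>1 / K^2\<close> becomes one of order \<open>1 / K\<close>.\<close>

lemma (in prob_space) exp_neg_expectation_approx:
  fixes y :: "'a \<Rightarrow> real"
  assumes y: "y \<in> borel_measurable M" "\<And>t. y t \<ge> 0" and int2: "integrable M (\<lambda>t. (y t)\<^sup>2)" and K: "K > 0"
  shows "\<bar>exp (- expectation y) - expectation (\<lambda>t. exp (- y t / real K)) ^ K\<bar> \<le> expectation (\<lambda>t. (y t)\<^sup>2) / real K"
proof -
  have int1: "integrable M y"
    using y(1) int2 by (rule square_integrable_imp_integrable)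
  have inte: "integrable M (\<lambda>t. exp (- y t / real K))"
    using y by (intro integrable_const_bound[where B = 1]) (auto simp: divide_nonneg_nonneg)
  define a where "a = expectation (\<lambda>t. exp (- y t / real K))"
  define b where "b = exp (- expectation y / real K)"
  define e where "e = expectation y / real K"
  have ey: "expectation y \<ge> 0"
    using y(2) by simp
  have "a \<ge> 0"
    by (simp add: a_def)
  have "a \<le> expectation (\<lambda>_. 1)"
    unfolding a_def using y by (intro integral_mono inte) (auto simp: divide_nonneg_nonneg)
  then have "a \<le> 1"
    by (simp add: prob_space)
  have b: "b \<ge> 0" "b \<le> 1" "b ^ K = exp (- expectation y)"
    using ey K by (auto simp: b_def divide_nonneg_nonneg simp flip: exp_of_nat_mult)
  have "\<bar>a - (1 - e)\<bar> = \<bar>expectation (\<lambda>t. exp (- y t / real K) - (1 - y t / real K))\<bar>"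
    using inte int1 by (simp add: a_def e_def prob_space)
  also have "\<dots> \<le> expectation (\<lambda>t. \<bar>exp (- y t / real K) - (1 - y t / real K)\<bar>)"
    by (rule integral_abs_bound)
  also have "\<dots> \<le> expectation (\<lambda>t. (y t)\<^sup>2 / (2 * (real K)\<^sup>2))"
    using inte int1 int2 exp_neg_approx[of "y t / real K" for t] y
    by (intro integral_mono) (auto simp: divide_nonneg_nonneg power_divide mult.commute[of 2])
  finally have 1: "\<bar>a - (1 - e)\<bar> \<le> expectation (\<lambda>t. (y t)\<^sup>2) / (2 * (real K)\<^sup>2)"
    by simp
  \<comment> \<open>Nonnegativity of the variance lets the second moment bound both errors.\<close>
  have "(expectation y)\<^sup>2 \<le> expectation (\<lambda>t. (y t)\<^sup>2)"
    using variance_eq[OF int1 int2] variance_positive[of y] by simp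
  then have "(expectation y)\<^sup>2 / (2 * (real K)\<^sup>2) \<le> expectation (\<lambda>t. (y t)\<^sup>2) / (2 * (real K)\<^sup>2)"
    by (intro divide_right_mono) auto
  moreover have "\<bar>b - (1 - e)\<bar> \<le> (expectation y)\<^sup>2 / (2 * (real K)\<^sup>2)"
    using exp_neg_approx[of "expectation y / real K"] ey by (simp add: b_def e_def power_divide divide_nonneg_nonneg)
  ultimately have "\<bar>b - a\<bar> \<le> 2 * (expectation (\<lambda>t. (y t)\<^sup>2) / (2 * (real K)\<^sup>2))"
    using 1 by linarith
  then have "real K * \<bar>b - a\<bar> \<le> real K * (expectation (\<lambda>t. (y t)\<^sup>2) / (real K)\<^sup>2)"
    by (intro mult_left_mono) auto
  moreover have "\<bar>b ^ K - a ^ K\<bar> \<le> real K * \<bar>b - a\<bar>"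
    using norm_power_diff[of b a K] b \<open>a \<ge> 0\<close> \<open>a \<le> 1\<close> by simp
  ultimately have "\<bar>b ^ K - a ^ K\<bar> \<le> expectation (\<lambda>t. (y t)\<^sup>2) / real K"
    using K by (simp add: power2_eq_square)
  then show ?thesis
    by (simp only: b(3) a_def)
qed

text \<open>\<open>K\<close> independent copies of a random point with an independent standard
  normal weight. Point and weight share one factor, so that the integral of a product splits into
  the \<open>K\<close>-th power of one double integral.\<close>

definition gauss_points :: "'t measure \<Rightarrow> nat \<Rightarrow> (nat \<Rightarrow> 't \<times> real) measure" where
  "gauss_points \<mu> K = (\<Pi>\<^sub>M j\<in>{..<K}. \<mu> \<Otimes>\<^sub>M std_normal_distribution)"

lemma prob_space_gauss_points:
  assumes "prob_space \<mu>"
  shows "prob_space (gauss_points \<mu> K)"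
proof -
  interpret \<mu>: prob_space \<mu> by fact
  interpret N: prob_space std_normal_distribution
    by (rule prob_space_normal_density) simp
  interpret pair_prob_space \<mu> std_normal_distribution ..
  show ?thesis
    unfolding gauss_points_def by (intro prob_space_PiM prob_space_axioms)
qed

text \<open>The standard normal characteristic function is \<open>exp (- w^2 / 2)\<close>, so
  \<open>w = sqrt (2 * s) * x\<close> produces \<open>exp (- s * x^2)\<close> after integrating out
  the weight. Independence of the pairs gives the power.\<close>

lemma exp_square_eq_gauss_points:
  fixes X :: "'t \<Rightarrow> real"
  assumes \<mu>: "prob_space \<mu>" and X [measurable]: "X \<in> borel_measurable \<mu>" and s: "s \<ge> 0"
  shows "complex_of_real ((\<integral>t. exp (- s * (X t)\<^sup>2) \<partial>\<mu>) ^ K) =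
    (\<integral>w. iexp (\<Sum>j<K. sqrt (2 * s) * snd (w j) * X (fst (w j))) \<partial>gauss_points \<mu> K)"
proof -
  interpret \<mu>: prob_space \<mu> by fact
  interpret N: prob_space std_normal_distribution
    by (rule prob_space_normal_density) simp
  interpret P: pair_prob_space \<mu> std_normal_distribution ..
  interpret PiM: product_sigma_finite "\<lambda>_::nat. \<mu> \<Otimes>\<^sub>M std_normal_distribution" ..
  let ?g = "\<lambda>(t, z). iexp (sqrt (2 * s) * z * X t)"
  have int: "integrable (\<mu> \<Otimes>\<^sub>M std_normal_distribution) ?g"
    by (intro P.integrable_const_bound[where B = 1]) (auto simp: split_beta)
  have "(\<integral>w. ?g w \<partial>(\<mu> \<Otimes>\<^sub>M std_normal_distribution)) = (\<integral>t. (\<integral>z. iexp (z * (sqrt (2 * s) * X t)) \<partial>std_normal_distribution) \<partial>\<mu>)"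
    using P.integral_fst'[OF int] by (simp add: mult_ac)
  also have "\<dots> = (\<integral>t. complex_of_real (exp (- s * (X t)\<^sup>2)) \<partial>\<mu>)"
    unfolding integral_iexp_std_normal using s by (simp add: power_mult_distrib)
  also have "\<dots> = complex_of_real (\<integral>t. exp (- s * (X t)\<^sup>2) \<partial>\<mu>)"
    by (rule integral_complex_of_real)
  finally have *: "(\<integral>w. ?g w \<partial>(\<mu> \<Otimes>\<^sub>M std_normal_distribution)) = complex_of_real (\<integral>t. exp (- s * (X t)\<^sup>2) \<partial>\<mu>)" .
  have "(\<integral>w. (\<Prod>j<K. ?g (w j)) \<partial>gauss_points \<mu> K) = (\<Prod>j<K. \<integral>w. ?g w \<partial>(\<mu> \<Otimes>\<^sub>M std_normal_distribution))"
    unfolding gauss_points_def by (rule PiM.product_integral_prod) (simp, rule int)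
  also have "\<dots> = complex_of_real ((\<integral>t. exp (- s * (X t)\<^sup>2) \<partial>\<mu>) ^ K)"
    unfolding * by simp
  finally show ?thesis
    by (simp add: split_beta exp_sum sum_distrib_left)
qed

lemma measurable_iexp_gauss_points:
  fixes X :: "'w \<Rightarrow> 't \<Rightarrow> real"
  assumes X: "(\<lambda>(\<omega>, t). X \<omega> t) \<in> borel_measurable (\<Omega> \<Otimes>\<^sub>M \<mu>)"
  shows "(\<lambda>(\<omega>, w). iexp (\<Sum>j<K. c * snd (w j) * X \<omega> (fst (w j)))) \<in> borel_measurable (\<Omega> \<Otimes>\<^sub>M gauss_points \<mu> K)"
proof -
  have [measurable]: "(\<lambda>q. X (fst q) (fst (snd q j))) \<in> borel_measurable (\<Omega> \<Otimes>\<^sub>M gauss_points \<mu> K)"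
    "(\<lambda>q. snd (snd q j)) \<in> borel_measurable (\<Omega> \<Otimes>\<^sub>M gauss_points \<mu> K)" if "j < K" for j
  proof -
    have 1: "(\<lambda>q. snd q j) \<in> measurable (\<Omega> \<Otimes>\<^sub>M gauss_points \<mu> K) (\<mu> \<Otimes>\<^sub>M std_normal_distribution)"
      unfolding gauss_points_def
      by (rule measurable_compose[OF measurable_snd measurable_component_singleton]) (use that in simp)
    then show "(\<lambda>q. snd (snd q j)) \<in> borel_measurable (\<Omega> \<Otimes>\<^sub>M gauss_points \<mu> K)"
      using measurable_compose[OF 1 measurable_snd] by simp
    have "(\<lambda>q. (fst q, fst (snd q j))) \<in> measurable (\<Omega> \<Otimes>\<^sub>M gauss_points \<mu> K) (\<Omega> \<Otimes>\<^sub>M \<mu>)"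
      by (intro measurable_Pair measurable_fst measurable_compose[OF 1 measurable_fst])
    from measurable_compose[OF this X]
    show "(\<lambda>q. X (fst q) (fst (snd q j))) \<in> borel_measurable (\<Omega> \<Otimes>\<^sub>M gauss_points \<mu> K)"
      by simp
  qed
  show ?thesis
    unfolding split_beta by measurable
qed

text \<open>Pathwise, \<open>exp_neg_expectation_approx\<close> with \<open>y = s * X^2\<close>
  replaces the exponential by a \<open>K\<close>-th power, and
  \<open>exp_square_eq_gauss_points\<close> with \<open>s / K\<close> linearises it. Fubini then
  moves the integral over \<open>\<Omega>\<close> inside, where points and weights are fixed and
  only a finite-dimensional characteristic function remains.\<close>

lemma Laplace_square_integral_approx:
  fixes X :: "'w \<Rightarrow> 't \<Rightarrow> real"
  assumes \<Omega>: "prob_space \<Omega>" and \<mu>: "prob_space \<mu>"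
    and X [measurable]: "(\<lambda>(\<omega>, t). X \<omega> t) \<in> borel_measurable (\<Omega> \<Otimes>\<^sub>M \<mu>)"
    and int4: "integrable (\<Omega> \<Otimes>\<^sub>M \<mu>) (\<lambda>(\<omega>, t). X \<omega> t ^ 4)"
    and C: "(\<integral>w. (case w of (\<omega>, t) \<Rightarrow> X \<omega> t ^ 4) \<partial>(\<Omega> \<Otimes>\<^sub>M \<mu>)) \<le> C"
    and s: "s \<ge> 0" and K: "K > 0"
  shows "cmod (complex_of_real (\<integral>\<omega>. exp (- s * (\<integral>t. (X \<omega> t)\<^sup>2 \<partial>\<mu>)) \<partial>\<Omega>) -
    (\<integral>w. (\<integral>\<omega>. iexp (\<Sum>j<K. sqrt (2 * (s / real K)) * snd (w j) * X \<omega> (fst (w j))) \<partial>\<Omega>) \<partial>gauss_points \<mu> K))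
    \<le> s\<^sup>2 * C / real K"
proof -
  interpret \<Omega>: prob_space \<Omega> by fact
  interpret \<mu>: prob_space \<mu> by fact
  interpret P: pair_prob_space \<Omega> \<mu> ..
  interpret G: prob_space "gauss_points \<mu> K"
    by (rule prob_space_gauss_points[OF \<mu>])
  interpret PG: pair_prob_space \<Omega> "gauss_points \<mu> K" ..
  let ?F = "\<lambda>\<omega> w. iexp (\<Sum>j<K. sqrt (2 * (s / real K)) * snd (w j) * X \<omega> (fst (w j)))"
  let ?A = "\<lambda>\<omega>. (\<integral>t. exp (- (s / real K) * (X \<omega> t)\<^sup>2) \<partial>\<mu>) ^ K"
  have X\<omega>: "X \<omega> \<in> borel_measurable \<mu>" if "\<omega> \<in> space \<Omega>" for \<omega>
    using measurable_Pair2[OF X that] by simp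
  have Fmeas: "(\<lambda>(\<omega>, w). ?F \<omega> w) \<in> borel_measurable (\<Omega> \<Otimes>\<^sub>M gauss_points \<mu> K)"
    by (rule measurable_iexp_gauss_points[OF X])
  have Fint: "integrable (\<Omega> \<Otimes>\<^sub>M gauss_points \<mu> K) (\<lambda>(\<omega>, w). ?F \<omega> w)"
    by (intro PG.integrable_const_bound[where B = 1] Fmeas) (auto simp: split_beta)
  have "(\<integral>w. (\<integral>\<omega>. ?F \<omega> w \<partial>\<Omega>) \<partial>gauss_points \<mu> K) = (\<integral>\<omega>. (\<integral>w. ?F \<omega> w \<partial>gauss_points \<mu> K) \<partial>\<Omega>)"
    by (rule PG.Fubini_integral[OF Fint])
  also have "\<dots> = (\<integral>\<omega>. complex_of_real (?A \<omega>) \<partial>\<Omega>)"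
    using s by (intro Bochner_Integration.integral_cong refl exp_square_eq_gauss_points[symmetric] \<mu> X\<omega>) auto
  also have "\<dots> = complex_of_real (\<integral>\<omega>. ?A \<omega> \<partial>\<Omega>)"
    by (rule integral_complex_of_real)
  finally have eq: "(\<integral>w. (\<integral>\<omega>. ?F \<omega> w \<partial>\<Omega>) \<partial>gauss_points \<mu> K) = complex_of_real (\<integral>\<omega>. ?A \<omega> \<partial>\<Omega>)" .
  have [measurable]: "(\<lambda>\<omega>. \<integral>t. (X \<omega> t)\<^sup>2 \<partial>\<mu>) \<in> borel_measurable \<Omega>"
    "(\<lambda>\<omega>. \<integral>t. exp (- (s / real K) * (X \<omega> t)\<^sup>2) \<partial>\<mu>) \<in> borel_measurable \<Omega>"
    by measurable
  have int1: "integrable \<Omega> (\<lambda>\<omega>. exp (- s * (\<integral>t. (X \<omega> t)\<^sup>2 \<partial>\<mu>)))"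
    using s by (intro \<Omega>.integrable_const_bound[where B = 1]) auto
  have A01: "0 \<le> ?A \<omega> \<and> ?A \<omega> \<le> 1" if "\<omega> \<in> space \<Omega>" for \<omega>
  proof -
    have "(\<integral>t. exp (- (s / real K) * (X \<omega> t)\<^sup>2) \<partial>\<mu>) \<le> (\<integral>t. 1 \<partial>\<mu>)"
    proof (rule integral_mono)
      show "integrable \<mu> (\<lambda>t. exp (- (s / real K) * (X \<omega> t)\<^sup>2))"
        using s X\<omega>[OF that] by (intro \<mu>.integrable_const_bound[where B = 1]) auto
    qed (use s in auto)
    then show ?thesis
      by (auto intro!: power_le_one simp: \<mu>.prob_space)
  qed
  have int2: "integrable \<Omega> ?A"
    using A01 by (intro \<Omega>.integrable_const_bound[where B = 1]) auto
  have int3: "integrable \<Omega> (\<lambda>\<omega>. \<integral>t. X \<omega> t ^ 4 \<partial>\<mu>)"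
    using P.integrable_fst'[OF int4] by simp
  \<comment> \<open>Integrability over the product gives an integrable fourth power only for almost
    every path.\<close>
  have ae: "AE \<omega> in \<Omega>. \<bar>exp (- s * (\<integral>t. (X \<omega> t)\<^sup>2 \<partial>\<mu>)) - ?A \<omega>\<bar> \<le> s\<^sup>2 / real K * (\<integral>t. X \<omega> t ^ 4 \<partial>\<mu>)"
    using P.AE_integrable_fst'[OF int4] AE_space
  proof eventually_elim
    case (elim \<omega>)
    have [measurable]: "X \<omega> \<in> borel_measurable \<mu>"
      using elim by (intro X\<omega>)
    have sq: "(s * (X \<omega> t)\<^sup>2)\<^sup>2 = s\<^sup>2 * X \<omega> t ^ 4" for t
      by (simp add: power_mult_distrib flip: power_mult)
    have "\<bar>exp (- (\<integral>t. s * (X \<omega> t)\<^sup>2 \<partial>\<mu>)) - (\<integral>t. exp (- (s * (X \<omega> t)\<^sup>2) / real K) \<partial>\<mu>) ^ K\<bar> \<le>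
        (\<integral>t. (s * (X \<omega> t)\<^sup>2)\<^sup>2 \<partial>\<mu>) / real K"
    proof (rule \<mu>.exp_neg_expectation_approx[OF _ _ _ K])
      show "integrable \<mu> (\<lambda>t. (s * (X \<omega> t)\<^sup>2)\<^sup>2)"
        unfolding sq using elim by simp
    qed (use s in auto)
    then show ?case
      unfolding sq by simp
  qed
  have "cmod (complex_of_real (\<integral>\<omega>. exp (- s * (\<integral>t. (X \<omega> t)\<^sup>2 \<partial>\<mu>)) \<partial>\<Omega>) - complex_of_real (\<integral>\<omega>. ?A \<omega> \<partial>\<Omega>)) =
      \<bar>\<integral>\<omega>. exp (- s * (\<integral>t. (X \<omega> t)\<^sup>2 \<partial>\<mu>)) - ?A \<omega> \<partial>\<Omega>\<bar>"
    unfolding Bochner_Integration.integral_diff[OF int1 int2] by (simp only: norm_of_real flip: of_real_diff)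
  also have "\<dots> \<le> (\<integral>\<omega>. \<bar>exp (- s * (\<integral>t. (X \<omega> t)\<^sup>2 \<partial>\<mu>)) - ?A \<omega>\<bar> \<partial>\<Omega>)"
    by (rule integral_abs_bound)
  also have "\<dots> \<le> (\<integral>\<omega>. s\<^sup>2 / real K * (\<integral>t. X \<omega> t ^ 4 \<partial>\<mu>) \<partial>\<Omega>)"
    by (intro integral_mono_AE ae integrable_abs Bochner_Integration.integrable_diff int1 int2 integrable_mult_right int3)
  also have "\<dots> = s\<^sup>2 / real K * (\<integral>w. (case w of (\<omega>, t) \<Rightarrow> X \<omega> t ^ 4) \<partial>(\<Omega> \<Otimes>\<^sub>M \<mu>))"
    using P.integral_fst'[OF int4] by simp
  also have "\<dots> \<le> s\<^sup>2 / real K * C"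
    by (intro mult_left_mono C) simp
  finally show ?thesis
    unfolding eq by simp
qed

text \<open>For fixed \<open>K\<close>, \<open>fd\<close> gives convergence for each choice of
  points and weights, and dominated convergence averages over them. The approximation error is at
  most \<open>s^2 * C / K\<close> for every \<open>k\<close> and for the limit alike, because they
  share \<open>C\<close>.\<close>

lemma Laplace_square_integral_conv:
  fixes X :: "nat \<Rightarrow> 'a \<Rightarrow> 't \<Rightarrow> real" and Y :: "'w \<Rightarrow> 't \<Rightarrow> real"
  assumes \<Omega>: "\<And>k. prob_space (\<Omega> k)" and M: "prob_space M" and \<mu>: "prob_space \<mu>"
    and X: "\<And>k. (\<lambda>(\<omega>, t). X k \<omega> t) \<in> borel_measurable (\<Omega> k \<Otimes>\<^sub>M \<mu>)"
      "\<And>k. integrable (\<Omega> k \<Otimes>\<^sub>M \<mu>) (\<lambda>(\<omega>, t). X k \<omega> t ^ 4)"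
      "\<And>k. (\<integral>w. (case w of (\<omega>, t) \<Rightarrow> X k \<omega> t ^ 4) \<partial>(\<Omega> k \<Otimes>\<^sub>M \<mu>)) \<le> C"
    and Y: "(\<lambda>(\<omega>, t). Y \<omega> t) \<in> borel_measurable (M \<Otimes>\<^sub>M \<mu>)"
      "integrable (M \<Otimes>\<^sub>M \<mu>) (\<lambda>(\<omega>, t). Y \<omega> t ^ 4)"
      "(\<integral>w. (case w of (\<omega>, t) \<Rightarrow> Y \<omega> t ^ 4) \<partial>(M \<Otimes>\<^sub>M \<mu>)) \<le> C"
    and fd: "\<And>(K::nat) t z. (\<And>j. j < K \<Longrightarrow> t j \<in> space \<mu>) \<Longrightarrow>
      (\<lambda>k. \<integral>\<omega>. iexp (\<Sum>j<K. z j * X k \<omega> (t j)) \<partial>\<Omega> k) \<longlonglongrightarrow> (\<integral>\<omega>. iexp (\<Sum>j<K. z j * Y \<omega> (t j)) \<partial>M)"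
    and s: "s \<ge> 0"
  shows "(\<lambda>k. \<integral>\<omega>. exp (- s * (\<integral>t. (X k \<omega> t)\<^sup>2 \<partial>\<mu>)) \<partial>\<Omega> k) \<longlonglongrightarrow> (\<integral>\<omega>. exp (- s * (\<integral>t. (Y \<omega> t)\<^sup>2 \<partial>\<mu>)) \<partial>M)"
proof -
  define A where "A K k = (\<integral>w. (\<integral>\<omega>. iexp (\<Sum>j<K. sqrt (2 * (s / real K)) * snd (w j) * X k \<omega> (fst (w j))) \<partial>\<Omega> k) \<partial>gauss_points \<mu> K)" for K k
  define A' where "A' K = (\<integral>w. (\<integral>\<omega>. iexp (\<Sum>j<K. sqrt (2 * (s / real K)) * snd (w j) * Y \<omega> (fst (w j))) \<partial>M) \<partial>gauss_points \<mu> K)" for K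
  have A_conv: "A K \<longlonglongrightarrow> A' K" for K
  proof -
    interpret G: prob_space "gauss_points \<mu> K"
      by (rule prob_space_gauss_points[OF \<mu>])
    have meas: "(\<lambda>w. \<integral>\<omega>. iexp (\<Sum>j<K. c * snd (w j) * Z \<omega> (fst (w j))) \<partial>Q) \<in> borel_measurable (gauss_points \<mu> K)"
      if Q: "prob_space Q" and Z: "(\<lambda>(\<omega>, t). Z \<omega> t) \<in> borel_measurable (Q \<Otimes>\<^sub>M \<mu>)" for Q c and Z :: "'z \<Rightarrow> 't \<Rightarrow> real"
    proof -
      interpret Q: prob_space Q by fact
      have "(\<lambda>(w, \<omega>). iexp (\<Sum>j<K. c * snd (w j) * Z \<omega> (fst (w j)))) \<in> borel_measurable (gauss_points \<mu> K \<Otimes>\<^sub>M Q)"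
        using measurable_compose[OF measurable_pair_swap' measurable_iexp_gauss_points[OF Z, of c K]]
        by (simp add: split_beta)
      then show ?thesis
        by (rule Q.borel_measurable_lebesgue_integral)
    qed
    show ?thesis
      unfolding A_def A'_def
    proof (rule integral_dominated_convergence[where w = "\<lambda>_. 1"])
      have "cmod (\<integral>\<omega>. iexp (f \<omega>) \<partial>\<Omega> k) \<le> 1" for k f
      proof -
        interpret prob_space "\<Omega> k" by (rule \<Omega>)
        have "cmod (\<integral>\<omega>. iexp (f \<omega>) \<partial>\<Omega> k) \<le> (\<integral>\<omega>. cmod (iexp (f \<omega>)) \<partial>\<Omega> k)"
          by (rule integral_norm_bound)
        then show ?thesis
          by (simp add: prob_space)
      qed
      then show "AE w in gauss_points \<mu> K. norm (\<integral>\<omega>. iexp (\<Sum>j<K. sqrt (2 * (s / real K)) * snd (w j) * X k \<omega> (fst (w j))) \<partial>\<Omega> k) \<le> 1" for k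
        by (intro AE_I2)
      show "AE w in gauss_points \<mu> K. (\<lambda>k. \<integral>\<omega>. iexp (\<Sum>j<K. sqrt (2 * (s / real K)) * snd (w j) * X k \<omega> (fst (w j))) \<partial>\<Omega> k)
          \<longlonglongrightarrow> (\<integral>\<omega>. iexp (\<Sum>j<K. sqrt (2 * (s / real K)) * snd (w j) * Y \<omega> (fst (w j))) \<partial>M)"
      proof (rule AE_I2)
        fix w assume "w \<in> space (gauss_points \<mu> K)"
        then have "fst (w j) \<in> space \<mu>" if "j < K" for j
          using that by (auto simp: gauss_points_def space_PiM space_pair_measure PiE_def Pi_def dest!: bspec)
        then show "(\<lambda>k. \<integral>\<omega>. iexp (\<Sum>j<K. sqrt (2 * (s / real K)) * snd (w j) * X k \<omega> (fst (w j))) \<partial>\<Omega> k)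
            \<longlonglongrightarrow> (\<integral>\<omega>. iexp (\<Sum>j<K. sqrt (2 * (s / real K)) * snd (w j) * Y \<omega> (fst (w j))) \<partial>M)"
          by (rule fd[where t = "\<lambda>j. fst (w j)" and z = "\<lambda>j. sqrt (2 * (s / real K)) * snd (w j)"])
      qed
    qed (use meas[OF \<Omega> X(1)] meas[OF M Y(1)] in simp_all)
  qed
  have "(\<lambda>k. complex_of_real (\<integral>\<omega>. exp (- s * (\<integral>t. (X k \<omega> t)\<^sup>2 \<partial>\<mu>)) \<partial>\<Omega> k)) \<longlonglongrightarrow>
      complex_of_real (\<integral>\<omega>. exp (- s * (\<integral>t. (Y \<omega> t)\<^sup>2 \<partial>\<mu>)) \<partial>M)" (is "?l \<longlonglongrightarrow> ?l'")
  proof (rule LIMSEQ_I)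
    fix r :: real assume r: "r > 0"
    obtain K :: nat where K: "3 * (s\<^sup>2 * C) / r < real K"
      using reals_Archimedean2 by blast
    \<comment> \<open>The successor keeps the number of points positive and only improves the
      bound.\<close>
    define K' where "K' = Suc K"
    have K': "K' > 0" "s\<^sup>2 * C / real K' < r / 3"
      using K r by (auto simp: K'_def field_simps)
    obtain k0 where k0: "\<And>k. k \<ge> k0 \<Longrightarrow> cmod (A K' k - A' K') < r / 3"
      using LIMSEQ_D[OF A_conv, of "r / 3"] r by auto
    have "cmod (?l k - ?l') < r" if "k \<ge> k0" for k
    proof -
      have "cmod (?l k - A K' k) < r / 3"
        unfolding A_def by (rule le_less_trans[OF Laplace_square_integral_approx[OF \<Omega> \<mu> X s K'(1)] K'(2)])
      moreover have "cmod (?l' - A' K') < r / 3"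
        unfolding A'_def by (rule le_less_trans[OF Laplace_square_integral_approx[OF M \<mu> Y s K'(1)] K'(2)])
      moreover have "cmod (?l k - ?l') \<le> cmod (?l k - A K' k) + cmod (A K' k - A' K') + cmod (?l' - A' K')"
        by norm
      ultimately show ?thesis
        using k0[OF that] by linarith
    qed
    then show "\<exists>no. \<forall>k\<ge>no. cmod (?l k - ?l') < r"
      by blast
  qed
  then show ?thesis
    by (simp only: tendsto_of_real_iff)
qed

section \<open>Gaussian processes\<close>

lemma normal_distribution_eq_distr_std:
  assumes "\<sigma> > 0"
  shows "density lborel (\<lambda>x. ennreal (normal_density 0 \<sigma> x)) = distr std_normal_distribution borel (\<lambda>x. \<sigma> * x)"
proof -
  interpret prob_space std_normal_distribution
    by (rule prob_space_normal_density) simp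
  have "distributed std_normal_distribution lborel (\<lambda>x. x) std_normal_density"
    by (auto simp: distributed_def distr_id2)
  from normal_density_affine[OF this, of \<sigma> 0]
  have "distr std_normal_distribution lborel (\<lambda>x. \<sigma> * x) = density lborel (\<lambda>x. ennreal (normal_density 0 \<sigma> x))"
    using assms by (simp add: distributed_def)
  moreover have "distr std_normal_distribution lborel (\<lambda>x. \<sigma> * x) = distr std_normal_distribution borel (\<lambda>x. \<sigma> * x)"
    by (intro distr_cong) auto
  ultimately show ?thesis
    by simp
qed

text \<open>A point mass with mean zero sits at 0, where the identities are trivial. In the case of
  a density, the vanishing mean forces the centre to be 0, the fourth moment is three times the
  squared variance, and rescaling reduces the characteristic function to the standard normal
  one.\<close>

lemma normal_law_moments:
  assumes M: "prob_space M" and X [measurable]: "X \<in> borel_measurable M"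
    and law: "normal_law (distr M borel X)" and mean: "(\<integral>\<omega>. X \<omega> \<partial>M) = 0"
  shows "integrable M X" "integrable M (\<lambda>\<omega>. (X \<omega>)\<^sup>2)" "integrable M (\<lambda>\<omega>. X \<omega> ^ 4)"
    and "(\<integral>\<omega>. X \<omega> ^ 4 \<partial>M) = 3 * (\<integral>\<omega>. (X \<omega>)\<^sup>2 \<partial>M)\<^sup>2"
    and "(\<integral>\<omega>. iexp (X \<omega>) \<partial>M) = exp (- (\<integral>\<omega>. (X \<omega>)\<^sup>2 \<partial>M) / 2)"
proof -
  interpret prob_space M by fact
  have "integrable M X \<and> integrable M (\<lambda>\<omega>. (X \<omega>)\<^sup>2) \<and> integrable M (\<lambda>\<omega>. X \<omega> ^ 4) \<and>
      (\<integral>\<omega>. X \<omega> ^ 4 \<partial>M) = 3 * (\<integral>\<omega>. (X \<omega>)\<^sup>2 \<partial>M)\<^sup>2 \<and>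
      (\<integral>\<omega>. iexp (X \<omega>) \<partial>M) = exp (- (\<integral>\<omega>. (X \<omega>)\<^sup>2 \<partial>M) / 2)"
    using law unfolding normal_law_def
  proof (elim exE disjE conjE)
    fix \<mu> assume eq: "distr M borel X = return borel \<mu>"
    have "AE x in distr M borel X. x = \<mu>"
      unfolding eq by (subst AE_return) auto
    then have X\<mu>: "AE \<omega> in M. X \<omega> = \<mu>"
      by (subst (asm) AE_distr_iff) auto
    have "(\<integral>\<omega>. X \<omega> \<partial>M) = (\<integral>\<omega>. \<mu> \<partial>M)"
      using X\<mu> by (intro integral_cong_AE) auto
    then have "\<mu> = 0"
      using mean by (simp add: prob_space)
    with X\<mu> have X0: "AE \<omega> in M. X \<omega> = 0"
      by simp
    have pow: "integrable M (\<lambda>\<omega>. X \<omega> ^ k) \<and> (\<integral>\<omega>. X \<omega> ^ k \<partial>M) = 0" if "k > 0" for k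
    proof -
      have ae: "AE \<omega> in M. X \<omega> ^ k = 0"
        using X0 by eventually_elim (use that in simp)
      then show ?thesis
        using integrable_cong_AE[of "\<lambda>\<omega>. X \<omega> ^ k" M "\<lambda>_. 0"] integral_cong_AE[of "\<lambda>\<omega>. X \<omega> ^ k" M "\<lambda>_. 0"] by simp
    qed
    have "(\<integral>\<omega>. iexp (X \<omega>) \<partial>M) = (\<integral>\<omega>. 1 \<partial>M)"
      using X0 by (intro integral_cong_AE) auto
    then show ?thesis
      using pow[of 1] pow[of 2] pow[of 4] by (simp add: prob_space)
  next
    fix \<mu> \<sigma> :: real assume \<sigma>: "\<sigma> > 0" and law: "distr M borel X = density lborel (\<lambda>x. ennreal (normal_density \<mu> \<sigma> x))"
    have transfer: "integrable M (\<lambda>\<omega>. f (X \<omega>)) \<longleftrightarrow> integrable lborel (\<lambda>x. normal_density \<mu> \<sigma> x * f x)"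
      "(\<integral>\<omega>. f (X \<omega>) \<partial>M) = (\<integral>x. normal_density \<mu> \<sigma> x * f x \<partial>lborel)"
      if [measurable]: "f \<in> borel_measurable borel" for f :: "real \<Rightarrow> real"
    proof -
      have "integrable M (\<lambda>\<omega>. f (X \<omega>)) \<longleftrightarrow> integrable (distr M borel X) f"
        by (simp add: integrable_distr_eq)
      also have "\<dots> \<longleftrightarrow> integrable lborel (\<lambda>x. normal_density \<mu> \<sigma> x * f x)"
        unfolding law using \<sigma> by (subst integrable_density) auto
      finally show "integrable M (\<lambda>\<omega>. f (X \<omega>)) \<longleftrightarrow> integrable lborel (\<lambda>x. normal_density \<mu> \<sigma> x * f x)" .
      have "(\<integral>\<omega>. f (X \<omega>) \<partial>M) = (\<integral>x. f x \<partial>distr M borel X)"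
        by (simp add: integral_distr)
      also have "\<dots> = (\<integral>x. normal_density \<mu> \<sigma> x * f x \<partial>lborel)"
        unfolding law using \<sigma> by (subst integral_density) auto
      finally show "(\<integral>\<omega>. f (X \<omega>) \<partial>M) = (\<integral>x. normal_density \<mu> \<sigma> x * f x \<partial>lborel)" .
    qed
    have \<mu>: "\<mu> = 0"
      using mean transfer(2)[of "\<lambda>x. x"] integral_normal_moment_nz_1[OF \<sigma>, of \<mu>] by simp
    have pow: "integrable M (\<lambda>\<omega>. X \<omega> ^ k)" for k
      using transfer(1)[of "\<lambda>x. x ^ k"] integrable_normal_moment[OF \<sigma>, of \<mu> k] by (simp add: \<mu>)
    have X2: "(\<integral>\<omega>. (X \<omega>)\<^sup>2 \<partial>M) = \<sigma>\<^sup>2"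
      using transfer(2)[of "\<lambda>x. x\<^sup>2"] integral_normal_moment_even[OF \<sigma>, of \<mu> 1] \<sigma> by (simp add: \<mu> fact_2)
    have X4: "(\<integral>\<omega>. X \<omega> ^ 4 \<partial>M) = 3 * (\<sigma>\<^sup>2)\<^sup>2"
      using transfer(2)[of "\<lambda>x. x ^ 4"] integral_normal_moment_even[OF \<sigma>, of \<mu> 2] \<sigma>
      by (simp add: \<mu> fact_numeral power_divide field_simps)
    have "(\<integral>\<omega>. iexp (X \<omega>) \<partial>M) = (\<integral>x. iexp x \<partial>distr M borel X)"
      by (simp add: integral_distr)
    also have "\<dots> = (\<integral>x. iexp (\<sigma> * x) \<partial>std_normal_distribution)"
      unfolding law \<mu> normal_distribution_eq_distr_std[OF \<sigma>] by (simp add: integral_distr)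
    also have "\<dots> = exp (- \<sigma>\<^sup>2 / 2)"
      using integral_iexp_std_normal[of \<sigma>] by (simp add: mult.commute)
    finally show ?thesis
      using pow[of 1] pow[of 2] pow[of 4] X2 X4 by simp
  qed
  then show "integrable M X" "integrable M (\<lambda>\<omega>. (X \<omega>)\<^sup>2)" "integrable M (\<lambda>\<omega>. X \<omega> ^ 4)"
    "(\<integral>\<omega>. X \<omega> ^ 4 \<partial>M) = 3 * (\<integral>\<omega>. (X \<omega>)\<^sup>2 \<partial>M)\<^sup>2"
    "(\<integral>\<omega>. iexp (X \<omega>) \<partial>M) = exp (- (\<integral>\<omega>. (X \<omega>)\<^sup>2 \<partial>M) / 2)"
    by blast+
qed

context
  fixes M :: "'w measure" and T :: "'t set" and X :: "'t \<Rightarrow> 'w \<Rightarrow> real"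
  assumes gauss: "gaussian_process M T X" and mean: "\<forall>t\<in>T. mean_fun M X t = 0"
begin

text \<open>\<open>gaussian_process\<close> speaks of sums over sets of distinct indices, while the
  points \<open>t j\<close> may coincide. Adding up the weights of coinciding points bridges the
  two.\<close>

lemma gaussian_process_normal_law:
  assumes t: "\<And>j. j \<in> J \<Longrightarrow> t j \<in> T" and J: "finite J"
  shows "normal_law (distr M borel (\<lambda>\<omega>. \<Sum>j\<in>J. z j * X (t j) \<omega>))"
proof -
  define c where "c \<tau> = (\<Sum>j | j \<in> J \<and> t j = \<tau>. z j)" for \<tau>
  have "(\<Sum>j\<in>J. z j * X (t j) \<omega>) = (\<Sum>\<tau>\<in>t ` J. c \<tau> * X \<tau> \<omega>)" for \<omega>
    unfolding c_def sum_distrib_right by (subst sum.image_gen[OF J, of _ t]) (intro sum.cong refl, auto)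
  moreover have "normal_law (distr M borel (\<lambda>\<omega>. \<Sum>\<tau>\<in>t ` J. c \<tau> * X \<tau> \<omega>))"
    using gauss t J unfolding gaussian_process_def by blast
  ultimately show ?thesis
    by simp
qed

lemma gaussian_process_marginal:
  assumes "t \<in> T"
  shows "X t \<in> borel_measurable M" "integrable M (X t)" "integrable M (\<lambda>\<omega>. (X t \<omega>)\<^sup>2)" "integrable M (\<lambda>\<omega>. X t \<omega> ^ 4)"
    "(\<integral>\<omega>. X t \<omega> \<partial>M) = 0" "(\<integral>\<omega>. (X t \<omega>)\<^sup>2 \<partial>M) = cov_kernel M X t t"
    "(\<integral>\<omega>. X t \<omega> ^ 4 \<partial>M) = 3 * (cov_kernel M X t t)\<^sup>2"
proof -
  have M: "prob_space M" and meas: "X t \<in> borel_measurable M"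
    using gauss assms by (auto simp: gaussian_process_def)
  have mean0: "(\<integral>\<omega>. X t \<omega> \<partial>M) = 0"
    using bspec[OF mean assms] by (simp add: mean_fun_def)
  have law: "normal_law (distr M borel (X t))"
    using gaussian_process_normal_law[of "{t}" "\<lambda>t. t" "\<lambda>_. 1"] assms by simp
  note mom = normal_law_moments[OF M meas law mean0]
  have "(\<integral>\<omega>. (X t \<omega>)\<^sup>2 \<partial>M) = cov_kernel M X t t"
    using bspec[OF mean assms] by (simp add: cov_kernel_def power2_eq_square)
  then show "X t \<in> borel_measurable M" "integrable M (X t)" "integrable M (\<lambda>\<omega>. (X t \<omega>)\<^sup>2)" "integrable M (\<lambda>\<omega>. X t \<omega> ^ 4)"
    "(\<integral>\<omega>. X t \<omega> \<partial>M) = 0" "(\<integral>\<omega>. (X t \<omega>)\<^sup>2 \<partial>M) = cov_kernel M X t t"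
    "(\<integral>\<omega>. X t \<omega> ^ 4 \<partial>M) = 3 * (cov_kernel M X t t)\<^sup>2"
    using mom meas mean0 by auto
qed

lemma gaussian_process_char:
  assumes t: "\<And>j. j \<in> J \<Longrightarrow> t j \<in> T" and J: "finite J"
  shows "(\<integral>\<omega>. iexp (\<Sum>j\<in>J. z j * X (t j) \<omega>) \<partial>M) =
    exp (- (\<Sum>j\<in>J. \<Sum>l\<in>J. z j * z l * cov_kernel M X (t j) (t l)) / 2)"
proof -
  let ?Y = "\<lambda>\<omega>. \<Sum>j\<in>J. z j * X (t j) \<omega>"
  have M: "prob_space M"
    using gauss by (simp add: gaussian_process_def)
  note marg = gaussian_process_marginal[OF t]
  have meas: "?Y \<in> borel_measurable M"
    using marg(1) by (intro borel_measurable_sum borel_measurable_times) auto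
  have mean0: "(\<integral>\<omega>. ?Y \<omega> \<partial>M) = 0"
    using marg by (subst Bochner_Integration.integral_sum) auto
  \<comment> \<open>Allows termwise integration of the expanded square.\<close>
  have prod_int: "integrable M (\<lambda>\<omega>. X (t j) \<omega> * X (t l) \<omega>)" if "j \<in> J" "l \<in> J" for j l
  proof (rule Bochner_Integration.integrable_bound)
    show "integrable M (\<lambda>\<omega>. (X (t j) \<omega>)\<^sup>2 + (X (t l) \<omega>)\<^sup>2)"
      using marg(3) that by (intro Bochner_Integration.integrable_add)
    show "(\<lambda>\<omega>. X (t j) \<omega> * X (t l) \<omega>) \<in> borel_measurable M"
      using marg(1) that by (intro borel_measurable_times)
    have "\<bar>a * b\<bar> \<le> a\<^sup>2 + b\<^sup>2" for a b :: real
      using sum_squares_bound[of "\<bar>a\<bar>" "\<bar>b\<bar>"] abs_ge_zero[of "a * b"] unfolding abs_mult power2_abs by linarith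
    then show "AE \<omega> in M. norm (X (t j) \<omega> * X (t l) \<omega>) \<le> norm ((X (t j) \<omega>)\<^sup>2 + (X (t l) \<omega>)\<^sup>2)"
      by simp
  qed
  have "(\<integral>\<omega>. (?Y \<omega>)\<^sup>2 \<partial>M) = (\<integral>\<omega>. (\<Sum>j\<in>J. \<Sum>l\<in>J. z j * z l * (X (t j) \<omega> * X (t l) \<omega>)) \<partial>M)"
    by (simp add: power2_eq_square sum_product mult_ac)
  also have "\<dots> = (\<Sum>j\<in>J. \<Sum>l\<in>J. z j * z l * (\<integral>\<omega>. X (t j) \<omega> * X (t l) \<omega> \<partial>M))"
    using prod_int by (simp add: Bochner_Integration.integral_sum Bochner_Integration.integrable_sum)
  also have "\<dots> = (\<Sum>j\<in>J. \<Sum>l\<in>J. z j * z l * cov_kernel M X (t j) (t l))"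
    using bspec[OF mean t] by (intro sum.cong refl) (simp add: cov_kernel_def)
  finally show ?thesis
    using normal_law_moments(5)[OF M meas gaussian_process_normal_law[where t = t, OF t J] mean0] by simp
qed

end

section \<open>Convergence of the energies\<close>

text \<open>A failure along the filter yields pairs with both entries at least \<open>k + 1\<close>
  on which \<open>f\<close> stays away from \<open>l\<close>. The successor makes the sizes
  positive, as the finite-sample estimates require, and sequences make dominated convergence
  available.\<close>

lemma tendsto_min_at_top_sequentiallyI:
  fixes f :: "nat \<times> nat \<Rightarrow> real"
  assumes "\<And>m n. (\<And>k. m k > 0) \<Longrightarrow> (\<And>k. n k > 0) \<Longrightarrow> filterlim m at_top sequentially \<Longrightarrow>
    filterlim n at_top sequentially \<Longrightarrow> (\<lambda>k. f (m k, n k)) \<longlonglongrightarrow> l"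
  shows "(f \<longlongrightarrow> l) min_at_top"
proof (rule ccontr)
  assume "\<not> (f \<longlongrightarrow> l) min_at_top"
  then obtain e where e: "e > 0" "\<not> eventually (\<lambda>q. dist (f q) l < e) min_at_top"
    by (auto simp: tendsto_iff)
  have "\<exists>q. Suc k \<le> min (fst q) (snd q) \<and> \<not> dist (f q) l < e" for k
  proof (rule ccontr)
    assume "\<nexists>q. Suc k \<le> min (fst q) (snd q) \<and> \<not> dist (f q) l < e"
    then have "eventually (\<lambda>q. dist (f q) l < e) min_at_top"
      unfolding min_at_top_def eventually_filtercomap eventually_at_top_linorder
      by (intro exI[of _ "\<lambda>x. Suc k \<le> x"] conjI exI[of _ "Suc k"]) auto
    with e show False
      by simp
  qed
  then obtain q where q: "\<And>k. Suc k \<le> min (fst (q k)) (snd (q k))" "\<And>k. \<not> dist (f (q k)) l < e"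
    by metis
  have lim: "filterlim g at_top sequentially" if "\<And>k. Suc k \<le> g k" for g :: "nat \<Rightarrow> nat"
    unfolding filterlim_at_top eventually_sequentially using that by (meson Suc_leD order_trans)
  have "(\<lambda>k. f (fst (q k), snd (q k))) \<longlonglongrightarrow> l"
    using q(1) by (intro assms lim) (auto simp: Suc_le_eq intro: le_less_trans[of 0])
  then have "eventually (\<lambda>k. dist (f (q k)) l < e) sequentially"
    using e(1) by (auto simp: tendsto_iff)
  then show False
    using q(2) by (auto simp: eventually_sequentially)
qed

lemma weak_conv_empirical_sequence:
  fixes U :: "nat \<Rightarrow> real ^ 'd" and f :: "real ^ 'd \<Rightarrow> real"
  assumes U: "weak_conv_filter (\<lambda>(m, n). empirical_measure U (m + n)) uniform_cube min_at_top"
    and mn: "\<And>k. m k > 0" "filterlim m at_top sequentially" "filterlim n at_top sequentially"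
    and f: "continuous_on UNIV f" "bounded (range f)"
  shows "(\<lambda>k. (\<Sum>i=1..m k + n k. f (U i)) / real (m k + n k)) \<longlonglongrightarrow> (\<integral>u. f u \<partial>uniform_cube)"
proof -
  have "filterlim (\<lambda>k. min (m k) (n k)) at_top sequentially"
    using mn(2,3) by (auto simp: filterlim_at_top intro: eventually_conj elim!: eventually_elim2)
  then have q: "filterlim (\<lambda>k. (m k, n k)) min_at_top sequentially"
    unfolding min_at_top_def filterlim_filtercomap_iff by (simp add: o_def)
  have meas: "f \<in> borel_measurable borel"
    using f(1) by (rule borel_measurable_continuous_onI)
  have "((\<lambda>q. \<integral>u. f u \<partial>(case q of (m, n) \<Rightarrow> empirical_measure U (m + n))) \<longlongrightarrow> (\<integral>u. f u \<partial>uniform_cube)) min_at_top"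
    using U f unfolding weak_conv_filter_def by blast
  from filterlim_compose[OF this q]
  have "(\<lambda>k. \<integral>u. f u \<partial>empirical_measure U (m k + n k)) \<longlonglongrightarrow> (\<integral>u. f u \<partial>uniform_cube)"
    by simp
  then show ?thesis
    using mn(1) by (subst (asm) integral_empirical_measure[OF _ meas]) auto
qed

text \<open>Levels are restricted to \<open>{- R..R}\<close> so that directions and levels together
  carry a probability measure from which random points can be drawn. The fields vanish at other
  levels once \<open>R\<close> is the dimension, for the limit field almost surely.\<close>

definition direction_level :: "real \<Rightarrow> ((real ^ 'd) \<times> real) measure" where
  "direction_level R = sphere_uniform \<Otimes>\<^sub>M uniform_measure lborel {- R..R}"

lemma sigma_finite_sphere_uniform: "sigma_finite_measure (sphere_uniform :: (real ^ 'd) measure)"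
  using prob_space_sphere_uniform by (rule prob_space_imp_sigma_finite)

lemma prob_space_direction_level:
  assumes "R > 0"
  shows "prob_space (direction_level R :: ((real ^ 'd) \<times> real) measure)"
proof -
  interpret S: prob_space "sphere_uniform :: (real ^ 'd) measure"
    by (rule prob_space_sphere_uniform)
  interpret L: prob_space "uniform_measure lborel {- R..R}"
    using assms by (intro prob_space_uniform_measure) auto
  interpret pair_prob_space "sphere_uniform :: (real ^ 'd) measure" "uniform_measure lborel {- R..R}" ..
  show ?thesis
    unfolding direction_level_def by (rule prob_space_axioms)
qed

lemma sets_direction_level [measurable_cong]:
  "sets (direction_level R) = sets (sphere_uniform \<Otimes>\<^sub>M lborel)"
  unfolding direction_level_def by (intro sets_pair_measure_cong) auto

lemma space_direction_level: "space (direction_level R) = sphere 0 1 \<times> UNIV"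
  by (simp add: direction_level_def space_pair_measure)

lemma direction_level_eq_density:
  assumes "R > 0"
  shows "direction_level R = density (sphere_uniform \<Otimes>\<^sub>M lborel) (\<lambda>t. ennreal (indicator {- R..R} (snd t) / (2 * R)))"
proof -
  have eq: "uniform_measure lborel {- R..R} = density lborel (\<lambda>r. ennreal (indicator {- R..R} r / (2 * R)))"
    unfolding uniform_measure_def using assms
    by (intro density_cong) (auto simp: indicator_def divide_ennreal simp flip: ennreal_1)
  have sf: "sigma_finite_measure (density lborel (\<lambda>r. ennreal (indicator {- R..R} r / (2 * R))))"
    unfolding eq[symmetric] using assms
    by (intro prob_space_imp_sigma_finite prob_space_uniform_measure) auto
  have "density sphere_uniform (\<lambda>_. 1) \<Otimes>\<^sub>M density lborel (\<lambda>r. ennreal (indicator {- R..R} r / (2 * R))) =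
      density (sphere_uniform \<Otimes>\<^sub>M lborel) (\<lambda>(a, r). 1 * ennreal (indicator {- R..R} r / (2 * R)))"
    by (rule pair_measure_density[OF _ _ lborel.sigma_finite_measure_axioms sf]) auto
  then show ?thesis
    by (simp add: direction_level_def eq density_1 case_prod_beta')
qed

text \<open>The factor \<open>2 * R\<close> undoes the normalisation of the level. Vanishing is
  asked for almost everywhere because the paths of the limit field satisfy it only in that sense.
  Integrability identifies the iterated integral in \<open>sphere_energy\<close> with a product
  integral, as Bochner integrals of non-integrable functions default to 0.\<close>

lemma sphere_energy_eq_direction_level:
  fixes h :: "(real ^ 'd) \<times> real \<Rightarrow> real"
  assumes R: "R > 0" and h [measurable]: "h \<in> borel_measurable (sphere_uniform \<Otimes>\<^sub>M lborel)"
    and zero: "AE t in sphere_uniform \<Otimes>\<^sub>M lborel. snd t \<notin> {- R..R} \<longrightarrow> h t = 0"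
    and int: "integrable (direction_level R) (\<lambda>t. (h t)\<^sup>2)"
  shows "sphere_energy h = 2 * R * (\<integral>t. (h t)\<^sup>2 \<partial>direction_level R)"
proof -
  interpret S: sigma_finite_measure "sphere_uniform :: (real ^ 'd) measure"
    by (rule sigma_finite_sphere_uniform)
  interpret P: pair_sigma_finite "sphere_uniform :: (real ^ 'd) measure" "lborel :: real measure" ..
  let ?\<Lambda> = "(sphere_uniform :: (real ^ 'd) measure) \<Otimes>\<^sub>M (lborel :: real measure)"
  let ?w = "\<lambda>t::(real ^ 'd) \<times> real. indicator {- R..R} (snd t) / (2 * R)"
  have w: "?w \<in> borel_measurable ?\<Lambda>" "AE t in ?\<Lambda>. 0 \<le> ?w t"
    using R by (auto intro!: AE_I2)
  have ae: "AE t in ?\<Lambda>. ?w t *\<^sub>R (h t)\<^sup>2 = (h t)\<^sup>2 / (2 * R)"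
    using zero by eventually_elim (auto simp: indicator_def)
  have "integrable ?\<Lambda> (\<lambda>t. ?w t *\<^sub>R (h t)\<^sup>2)"
    using int unfolding direction_level_eq_density[OF R] by (subst (asm) integrable_density[OF _ w]) auto
  then have "integrable ?\<Lambda> (\<lambda>t. (h t)\<^sup>2 / (2 * R))"
    using integrable_cong_AE[OF _ _ ae] by auto
  then have "integrable ?\<Lambda> (\<lambda>t. (2 * R) * ((h t)\<^sup>2 / (2 * R)))"
    by (rule integrable_mult_right)
  then have int\<Lambda>: "integrable ?\<Lambda> (\<lambda>t. (h t)\<^sup>2)"
    using R by simp
  have "(\<integral>t. (h t)\<^sup>2 \<partial>direction_level R) = (\<integral>t. ?w t *\<^sub>R (h t)\<^sup>2 \<partial>?\<Lambda>)"
    unfolding direction_level_eq_density[OF R] by (subst integral_density[OF _ w]) auto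
  also have "\<dots> = (\<integral>t. (h t)\<^sup>2 / (2 * R) \<partial>?\<Lambda>)"
    by (rule integral_cong_AE[OF _ _ ae]) auto
  also have "\<dots> = sphere_energy h / (2 * R)"
    unfolding sphere_energy_def using P.integral_fst'[OF int\<Lambda>] by simp
  finally show ?thesis
    using R by simp
qed

text \<open>The bound is pointwise in \<open>t\<close>, so integrability is shown with
  \<open>\<Omega>\<close> as the inner integral and then carried over to the swapped
  product.\<close>

lemma fourth_moment_pair_measure:
  fixes X :: "'w \<Rightarrow> 't \<Rightarrow> real"
  assumes \<Omega>: "prob_space \<Omega>" and \<mu>: "prob_space \<mu>"
    and X: "(\<lambda>(\<omega>, t). X \<omega> t) \<in> borel_measurable (\<Omega> \<Otimes>\<^sub>M \<mu>)"
    and int: "\<forall>t\<in>space \<mu>. integrable \<Omega> (\<lambda>\<omega>. X \<omega> t ^ 4)"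
    and le: "\<forall>t\<in>space \<mu>. (\<integral>\<omega>. X \<omega> t ^ 4 \<partial>\<Omega>) \<le> C"
  shows "integrable (\<Omega> \<Otimes>\<^sub>M \<mu>) (\<lambda>(\<omega>, t). X \<omega> t ^ 4)"
    and "(\<integral>w. (case w of (\<omega>, t) \<Rightarrow> X \<omega> t ^ 4) \<partial>(\<Omega> \<Otimes>\<^sub>M \<mu>)) \<le> C"
proof -
  interpret \<Omega>: prob_space \<Omega> by fact
  interpret \<mu>: prob_space \<mu> by fact
  interpret P: pair_prob_space \<mu> \<Omega> ..
  interpret Q: pair_prob_space \<Omega> \<mu> ..
  have X' [measurable]: "(\<lambda>(t, \<omega>). X \<omega> t) \<in> borel_measurable (\<mu> \<Otimes>\<^sub>M \<Omega>)"
    using measurable_compose[OF measurable_pair_swap' X] by (simp add: split_beta)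
  have int': "integrable \<mu> (\<lambda>t. \<integral>\<omega>. X \<omega> t ^ 4 \<partial>\<Omega>)"
  proof (rule \<mu>.integrable_const_bound)
    show "AE t in \<mu>. norm (\<integral>\<omega>. X \<omega> t ^ 4 \<partial>\<Omega>) \<le> C"
      using le by (intro AE_I2) simp
  qed measurable
  have "integrable (\<mu> \<Otimes>\<^sub>M \<Omega>) (\<lambda>(t, \<omega>). X \<omega> t ^ 4)"
  proof (rule P.Fubini_integrable)
    show "integrable \<mu> (\<lambda>t. \<integral>\<omega>. norm (case (t, \<omega>) of (t, \<omega>) \<Rightarrow> X \<omega> t ^ 4) \<partial>\<Omega>)"
      using int' by simp
    show "AE t in \<mu>. integrable \<Omega> (\<lambda>\<omega>. case (t, \<omega>) of (t, \<omega>) \<Rightarrow> X \<omega> t ^ 4)"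
      using int by (intro AE_I2) simp
  qed measurable
  from P.integrable_product_swap[OF this]
  show *: "integrable (\<Omega> \<Otimes>\<^sub>M \<mu>) (\<lambda>(\<omega>, t). X \<omega> t ^ 4)"
    by (simp add: case_prod_beta')
  have "(\<integral>w. (case w of (\<omega>, t) \<Rightarrow> X \<omega> t ^ 4) \<partial>(\<Omega> \<Otimes>\<^sub>M \<mu>)) = (\<integral>t. (\<integral>\<omega>. X \<omega> t ^ 4 \<partial>\<Omega>) \<partial>\<mu>)"
    using Q.integral_snd[of "\<lambda>\<omega> t. X \<omega> t ^ 4"] * by simp
  also have "\<dots> \<le> (\<integral>t. C \<partial>\<mu>)"
    using le by (intro integral_mono int') auto
  finally show "(\<integral>w. (case w of (\<omega>, t) \<Rightarrow> X \<omega> t ^ 4) \<partial>(\<Omega> \<Otimes>\<^sub>M \<mu>)) \<le> C"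
    by (simp add: \<mu>.prob_space)
qed

section \<open>Measurability and bounded support of the fields\<close>

lemma measurable_Theta_perm:
  fixes U :: "nat \<Rightarrow> real ^ 'd"
  shows "Theta_perm U m n p \<in> borel_measurable (sphere_uniform \<Otimes>\<^sub>M lborel)"
proof -
  have id: "(\<lambda>a. a) \<in> measurable (sphere_uniform :: (real ^ 'd) measure) borel"
    unfolding measurable_cong_sets[OF sets_sphere_uniform refl]
    by (rule measurable_restrict_space1) simp
  have [measurable]: "(\<lambda>w. fst w) \<in> borel_measurable ((sphere_uniform :: (real ^ 'd) measure) \<Otimes>\<^sub>M (lborel :: real measure))"
    by (rule measurable_compose[OF measurable_fst id])
  have "(\<lambda>t. indicator {u. fst t \<bullet> u \<le> snd t} v :: real) = (\<lambda>t. if fst t \<bullet> v \<le> snd t then 1 else 0)" for v :: "real ^ 'd"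
    by (auto simp: indicator_def)
  moreover have "(\<lambda>t. if fst t \<bullet> v \<le> snd t then 1 else 0 :: real) \<in> borel_measurable (sphere_uniform \<Otimes>\<^sub>M lborel)" for v :: "real ^ 'd"
    by measurable
  ultimately have [measurable]: "(\<lambda>t. indicator {u. fst t \<bullet> u \<le> snd t} v :: real) \<in> borel_measurable (sphere_uniform \<Otimes>\<^sub>M lborel)" for v :: "real ^ 'd"
    by simp
  have "(\<lambda>t. Theta_perm U m n p t) \<in> borel_measurable (sphere_uniform \<Otimes>\<^sub>M lborel)"
    unfolding Theta_perm_eq_two_sample two_sample_def by measurable
  then show ?thesis
    by simp
qed

text \<open>Vanishing off the permutations makes joint measurability a finite sum of products.\<close>

definition perm_field :: "(nat \<Rightarrow> real ^ 'd) \<Rightarrow> nat \<Rightarrow> nat \<Rightarrow> (nat \<Rightarrow> nat) \<Rightarrow> (real ^ 'd) \<times> real \<Rightarrow> real" where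
  "perm_field U m n p t = (\<Sum>q | q permutes {1..m+n}. indicator {q} p * Theta_perm U m n q t)"

lemma perm_field_eq:
  assumes "p permutes {1..m+n}"
  shows "perm_field U m n p = Theta_perm U m n p"
proof
  fix t
  have fin: "finite {q. q permutes {1..m+n}}"
    by (intro finite_permutations finite_atLeastAtMost)
  have "perm_field U m n p t = (\<Sum>q\<in>{q. q permutes {1..m+n}}. if q = p then Theta_perm U m n q t else 0)"
    unfolding perm_field_def by (intro sum.cong refl) (auto simp: indicator_def)
  then show "perm_field U m n p t = Theta_perm U m n p t"
    using assms fin by (simp only: sum.delta mem_Collect_eq if_True)
qed

lemma measurable_perm_field:
  "(\<lambda>(p, t). perm_field U m n p t) \<in> borel_measurable (random_permutation N \<Otimes>\<^sub>M direction_level R)"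
proof -
  have 1: "(\<lambda>w. indicator {q} (fst w) :: real) \<in> borel_measurable (random_permutation N \<Otimes>\<^sub>M direction_level R)" for q
    by (rule measurable_compose[OF measurable_fst]) simp
  have "Theta_perm U m n q \<in> borel_measurable (direction_level R)" for q
    using measurable_Theta_perm measurable_cong_sets[OF sets_direction_level refl] by blast
  then have 2: "(\<lambda>w. Theta_perm U m n q (snd w)) \<in> borel_measurable (random_permutation N \<Otimes>\<^sub>M direction_level R)" for q
    by (rule measurable_compose[OF measurable_snd])
  show ?thesis
    unfolding perm_field_def case_prod_beta' by (intro borel_measurable_sum borel_measurable_times 1 2)
qed

text \<open>Origin of the radius \<open>CARD('d)\<close>: the Euclidean norm is at most the sum of
  the absolute coordinates, each at most 1 on the cube.\<close>

lemma abs_inner_cube_le: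
  fixes a u :: "real ^ 'd"
  assumes "a \<in> sphere 0 1" "u \<in> cbox 0 1"
  shows "\<bar>a \<bullet> u\<bar> \<le> real CARD('d)"
proof -
  have "\<bar>a \<bullet> u\<bar> \<le> norm a * norm u"
    by (rule Cauchy_Schwarz_ineq2)
  also have "\<dots> \<le> (\<Sum>i\<in>UNIV. \<bar>u $ i\<bar>)"
    using assms(1) norm_le_l1_cart[of u] by simp
  also have "\<dots> \<le> (\<Sum>i\<in>(UNIV :: 'd set). 1)"
    using assms(2) by (intro sum_mono) (auto simp: mem_box_cart)
  finally show ?thesis
    by simp
qed

lemma two_sample_const:
  assumes mn: "m > 0" "n > 0" and p: "p permutes {1..m+n}" and x: "\<And>i. i \<in> {1..m+n} \<Longrightarrow> x i = c"
  shows "two_sample m n x p = 0"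
proof -
  have "x (p i) = c" if "i \<in> {1..m+n}" for i
    using that by (intro x) (simp only: permutes_in_image[OF p])
  then have "(\<Sum>i=1..m. x (p i)) = (\<Sum>i=1..m. c)" "(\<Sum>j=m+1..m+n. x (p j)) = (\<Sum>j=m+1..m+n. c)"
    by (auto intro!: sum.cong)
  then show ?thesis
    using mn by (simp add: two_sample_def)
qed

text \<open>Beyond that radius a halfspace contains the whole cube or misses it, so the sampled
  indicators are constant and the two sample means cancel.\<close>

lemma Theta_perm_outside:
  fixes U :: "nat \<Rightarrow> real ^ 'd"
  assumes mn: "m > 0" "n > 0" and p: "p permutes {1..m+n}" and U: "\<And>i. i \<ge> 1 \<Longrightarrow> U i \<in> cbox 0 1"
    and t: "fst t \<in> sphere 0 1" "snd t \<notin> {- real CARD('d)..real CARD('d)}"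
  shows "Theta_perm U m n p t = 0"
proof -
  have "indicator {u. fst t \<bullet> u \<le> snd t} (U i) = (if snd t > 0 then 1 else 0 :: real)" if "i \<in> {1..m+n}" for i
    using abs_inner_cube_le[OF t(1) U[of i]] that t(2) by (auto simp: indicator_def)
  then show ?thesis
    unfolding Theta_perm_eq_two_sample by (rule two_sample_const[OF mn p])
qed

text \<open>The counterpart for the limit field: the halfspace has probability 0 or 1, so its
  indicator has no variance.\<close>

lemma halfspace_kernel_outside:
  fixes t :: "(real ^ 'd) \<times> real"
  assumes t: "fst t \<in> sphere 0 1" "snd t \<notin> {- real CARD('d)..real CARD('d)}"
  shows "halfspace_kernel t t = 0"
proof -
  interpret prob_space "uniform_cube :: (real ^ 'd) measure"
    by (rule prob_space_uniform_cube)
  have cube: "AE u in uniform_cube. u \<in> (cbox 0 1 :: (real ^ 'd) set)"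
    unfolding uniform_cube_def by (rule AE_uniform_measureI) auto
  let ?H = "{u. fst t \<bullet> u \<le> snd t}"
  have "prob ?H = prob (if snd t > 0 then UNIV else {})"
  proof (rule finite_measure_eq_AE)
    show "AE u in uniform_cube. u \<in> ?H \<longleftrightarrow> u \<in> (if snd t > 0 then UNIV else {})"
      using cube by eventually_elim (use abs_inner_cube_le[OF t(1)] t(2) in force)
  qed auto
  then have "prob ?H = 0 \<or> prob ?H = 1"
    using prob_space by (auto split: if_splits)
  then show ?thesis
    by (auto simp: halfspace_kernel_def split_beta)
qed

lemma halfspace_kernel_square_le: "(halfspace_kernel t t)\<^sup>2 \<le> 1"
proof -
  interpret prob_space "uniform_cube :: (real ^ 'd) measure"
    by (rule prob_space_uniform_cube)
  define q where "q = prob {u. fst t \<bullet> u \<le> snd t}"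
  have "0 \<le> q * (1 - q)" "q * (1 - q) \<le> 1"
    by (auto simp: q_def mult_le_one)
  moreover have "halfspace_kernel t t = q * (1 - q)"
    by (simp add: halfspace_kernel_def split_beta q_def algebra_simps)
  ultimately show ?thesis
    by (simp add: power_le_one)
qed

lemma perm_field_energy:
  fixes U :: "nat \<Rightarrow> real ^ 'd"
  assumes mn: "m > 0" "n > 0" and p: "p permutes {1..m+n}" and U: "\<And>i. i \<ge> 1 \<Longrightarrow> U i \<in> cbox 0 1"
    and R: "R = real CARD('d)"
    and int: "integrable (direction_level R) (\<lambda>t. (perm_field U m n p t)\<^sup>2)"
  shows "sphere_energy (Theta_perm U m n p) = 2 * R * (\<integral>t. (perm_field U m n p t)\<^sup>2 \<partial>direction_level R)"
  using int unfolding perm_field_eq[OF p]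
proof (intro sphere_energy_eq_direction_level measurable_Theta_perm AE_I2 impI)
  fix t :: "(real ^ 'd) \<times> real"
  assume "t \<in> space (sphere_uniform \<Otimes>\<^sub>M lborel)" "snd t \<notin> {- R..R}"
  then show "Theta_perm U m n p t = 0"
    by (intro Theta_perm_outside[OF mn p U]) (auto simp: space_pair_measure R)
qed (simp add: R)

theorem lemmaE2:
  fixes U :: "nat \<Rightarrow> real ^ 'd"
    and M :: "'w measure"
    and \<Theta> :: "(real ^ 'd) \<times> real \<Rightarrow> 'w \<Rightarrow> real"
  assumes U_cube: "\<And>i. i \<ge> 1 \<Longrightarrow> U i \<in> cbox 0 1"
    and U_conv: "weak_conv_filter (\<lambda>(m, n). empirical_measure U (m + n)) uniform_cube min_at_top"
    and gauss: "gaussian_process M (sphere 0 1 \<times> UNIV) \<Theta>"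
    and mean: "\<And>t. t \<in> sphere 0 1 \<times> UNIV \<Longrightarrow> mean_fun M \<Theta> t = 0"
    and cov: "\<And>s t. s \<in> sphere 0 1 \<times> UNIV \<Longrightarrow> t \<in> sphere 0 1 \<times> UNIV \<Longrightarrow>
                cov_kernel M \<Theta> s t = halfspace_kernel s t"
    and joint_meas: "(\<lambda>(\<omega>, t). \<Theta> t \<omega>) \<in> borel_measurable (M \<Otimes>\<^sub>M (sphere_uniform \<Otimes>\<^sub>M lborel))"
  shows "weak_conv_filter
           (\<lambda>(m, n). distr (random_permutation (m + n)) borel
                       (\<lambda>p. sphere_energy (Theta_perm U m n p)))
           (distr M borel (\<lambda>\<omega>. sphere_energy (\<lambda>t. \<Theta> t \<omega>)))
           min_at_top"
proof -
  define R where "R = real CARD('d)"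
  define \<mu> where "\<mu> = (direction_level R :: ((real ^ 'd) \<times> real) measure)"
  have R: "R > 0"
    by (simp add: R_def)
  have M: "prob_space M"
    using gauss by (simp add: gaussian_process_def)
  have \<mu>: "prob_space \<mu>"
    unfolding \<mu>_def by (rule prob_space_direction_level[OF R])
  interpret M: prob_space M by (rule M)
  interpret \<mu>: prob_space \<mu> by (rule \<mu>)
  interpret S: sigma_finite_measure "sphere_uniform :: (real ^ 'd) measure"
    by (rule sigma_finite_sphere_uniform)
  interpret \<Lambda>: pair_sigma_finite "sphere_uniform :: (real ^ 'd) measure" "lborel :: real measure" ..
  let ?\<Lambda> = "(sphere_uniform :: (real ^ 'd) measure) \<Otimes>\<^sub>M (lborel :: real measure)"
  interpret L: sigma_finite_measure ?\<Lambda>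
    by (rule \<Lambda>.P.sigma_finite_measure_axioms)
  interpret M\<Lambda>: pair_sigma_finite M ?\<Lambda> ..
  interpret M\<mu>: pair_prob_space M \<mu> ..
  have mean': "\<forall>t\<in>sphere 0 1 \<times> UNIV. mean_fun M \<Theta> t = 0"
    using mean by blast
  note marg = gaussian_process_marginal[OF gauss mean']
  have space\<mu>: "space \<mu> = sphere 0 1 \<times> UNIV"
    by (simp add: \<mu>_def space_direction_level)
  have sets\<mu>: "sets (M \<Otimes>\<^sub>M \<mu>) = sets (M \<Otimes>\<^sub>M ?\<Lambda>)"
    unfolding \<mu>_def by (intro sets_pair_measure_cong sets_direction_level refl)
  have \<Theta>_meas: "(\<lambda>(\<omega>, t). \<Theta> t \<omega>) \<in> borel_measurable (M \<Otimes>\<^sub>M \<mu>)"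
    using joint_meas measurable_cong_sets[OF sets\<mu> refl] by blast
  \<comment> \<open>A centred normal fourth moment is three times the squared variance, and the
    variance is at most 1. The same 3 serves as the bound for the permutation fields.\<close>
  have "integrable M (\<lambda>\<omega>. \<Theta> t \<omega> ^ 4)" "(\<integral>\<omega>. \<Theta> t \<omega> ^ 4 \<partial>M) \<le> 3" if "t \<in> space \<mu>" for t
    using marg(4,7)[of t] cov[of t t] halfspace_kernel_square_le[of t] that by (simp_all add: space\<mu>)
  then have "\<forall>t\<in>space \<mu>. integrable M (\<lambda>\<omega>. \<Theta> t \<omega> ^ 4)" "\<forall>t\<in>space \<mu>. (\<integral>\<omega>. \<Theta> t \<omega> ^ 4 \<partial>M) \<le> 3"
    by blast+
  note \<Theta>4 = fourth_moment_pair_measure[OF M \<mu> \<Theta>_meas this]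
  have sq_int: "integrable \<mu> (\<lambda>t. (h t)\<^sup>2)" if "h \<in> borel_measurable \<mu>" "integrable \<mu> (\<lambda>t. h t ^ 4)" for h :: "_ \<Rightarrow> real"
  proof (rule \<mu>.square_integrable_imp_integrable)
    show "integrable \<mu> (\<lambda>t. ((h t)\<^sup>2)\<^sup>2)"
      using that(2) by (simp only: power_mult[symmetric]) simp
    show "(\<lambda>t. (h t)\<^sup>2) \<in> borel_measurable \<mu>"
      using that(1) by measurable
  qed
  \<comment> \<open>Each fixed \<open>t\<close> with level beyond \<open>R\<close> has its own null
    set of paths, and there are uncountably many such \<open>t\<close>. Joint measurability lets
    Fubini exchange the quantifiers.\<close>
  have \<Theta>_zero: "AE \<omega> in M. AE t in ?\<Lambda>. snd t \<notin> {- R..R} \<longrightarrow> \<Theta> t \<omega> = 0"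
  proof (subst M\<Lambda>.AE_commute)
    have "AE \<omega> in M. snd t \<notin> {- R..R} \<longrightarrow> \<Theta> t \<omega> = 0" if "t \<in> space ?\<Lambda>" for t
    proof (cases "snd t \<in> {- R..R}")
      case False
      have t: "t \<in> sphere 0 1 \<times> UNIV"
        using that by (auto simp: space_pair_measure)
      then have "(\<integral>\<omega>. (\<Theta> t \<omega>)\<^sup>2 \<partial>M) = 0"
        using marg(6)[OF t] cov[OF t t] halfspace_kernel_outside[of t] False by (auto simp: R_def)
      then have "AE \<omega> in M. (\<Theta> t \<omega>)\<^sup>2 = 0"
        using marg(3)[OF t] by (subst (asm) integral_nonneg_eq_0_iff_AE) auto
      then show ?thesis
        by eventually_elim simp
    qed simp
    then show "AE t in ?\<Lambda>. AE \<omega> in M. snd t \<notin> {- R..R} \<longrightarrow> \<Theta> t \<omega> = 0"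
      by (rule AE_I2)
    have [measurable]: "(\<lambda>w. \<Theta> (snd w) (fst w)) \<in> borel_measurable (M \<Otimes>\<^sub>M ?\<Lambda>)"
      using joint_meas by (simp add: case_prod_beta')
    show "{w \<in> space (M \<Otimes>\<^sub>M ?\<Lambda>). snd (snd w) \<notin> {- R..R} \<longrightarrow> \<Theta> (snd w) (fst w) = 0} \<in> sets (M \<Otimes>\<^sub>M ?\<Lambda>)"
      by measurable
  qed
  have limit_energy: "AE \<omega> in M. sphere_energy (\<lambda>t. \<Theta> t \<omega>) = 2 * R * (\<integral>t. (\<Theta> t \<omega>)\<^sup>2 \<partial>\<mu>)"
    using \<Theta>_zero M\<mu>.AE_integrable_fst'[OF \<Theta>4(1)] AE_space
  proof eventually_elim
    case (elim \<omega>)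
    have meas: "(\<lambda>t. \<Theta> t \<omega>) \<in> borel_measurable ?\<Lambda>"
      using measurable_Pair2[OF joint_meas elim(3)] by simp
    then have "(\<lambda>t. \<Theta> t \<omega>) \<in> borel_measurable \<mu>"
      unfolding \<mu>_def using measurable_cong_sets[OF sets_direction_level refl] by blast
    then have "integrable \<mu> (\<lambda>t. (\<Theta> t \<omega>)\<^sup>2)"
      using elim(2) by (intro sq_int) auto
    then show ?case
      unfolding \<mu>_def by (intro sphere_energy_eq_direction_level R meas elim(1))
  qed
  have energy_meas: "(\<lambda>\<omega>. sphere_energy (\<lambda>t. \<Theta> t \<omega>)) \<in> borel_measurable M"
  proof -
    \<comment> \<open>Reassociates the triple so that the level can be integrated out first and the
      direction afterwards.\<close>
    have "(\<lambda>w. (fst (fst w), (snd (fst w), snd w))) \<in> measurable ((M \<Otimes>\<^sub>M (sphere_uniform :: (real ^ 'd) measure)) \<Otimes>\<^sub>M (lborel :: real measure)) (M \<Otimes>\<^sub>M ?\<Lambda>)"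
      by measurable
    from measurable_compose[OF this joint_meas]
    have [measurable]: "(\<lambda>w. \<Theta> (snd (fst w), snd w) (fst (fst w))) \<in>
        borel_measurable ((M \<Otimes>\<^sub>M (sphere_uniform :: (real ^ 'd) measure)) \<Otimes>\<^sub>M (lborel :: real measure))"
      by simp
    have "(\<lambda>w. \<integral>r. (\<Theta> (snd w, r) (fst w))\<^sup>2 \<partial>lborel) \<in> borel_measurable (M \<Otimes>\<^sub>M (sphere_uniform :: (real ^ 'd) measure))"
      by (rule lborel.borel_measurable_lebesgue_integral) (simp add: case_prod_beta')
    then show ?thesis
      unfolding sphere_energy_def by (intro S.borel_measurable_lebesgue_integral) (simp add: case_prod_beta')
  qed
  have \<Theta>I_meas: "(\<lambda>\<omega>. 2 * R * (\<integral>t. (\<Theta> t \<omega>)\<^sup>2 \<partial>\<mu>)) \<in> borel_measurable M"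
    using \<Theta>_meas by (intro borel_measurable_times borel_measurable_const \<mu>.borel_measurable_lebesgue_integral) (simp add: case_prod_beta')
  show ?thesis
    unfolding weak_conv_filter_def
  proof (intro allI impI, elim conjE, rule tendsto_min_at_top_sequentiallyI)
    fix f :: "real \<Rightarrow> real" and m n :: "nat \<Rightarrow> nat"
    assume f: "continuous_on UNIV f" "bounded (range f)"
      and mn: "\<And>k. m k > 0" "\<And>k. n k > 0" "filterlim m at_top sequentially" "filterlim n at_top sequentially"
    obtain B where B: "\<And>x. \<bar>f x\<bar> \<le> B"
      using f(2) by (auto simp: bounded_iff)
    have f_meas [measurable]: "f \<in> borel_measurable borel"
      using f(1) by (rule borel_measurable_continuous_onI)
    define \<Omega> where "\<Omega> k = random_permutation (m k + n k)" for k
    define X where "X k = perm_field U (m k) (n k)" for k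
    have \<Omega>: "prob_space (\<Omega> k)" for k
      unfolding \<Omega>_def by (rule prob_space_random_permutation)
    have AE_perm: "AE p in \<Omega> k. p permutes {1..m k + n k}" for k
      unfolding \<Omega>_def by (rule AE_random_permutation)
    have X_meas: "(\<lambda>(p, t). X k p t) \<in> borel_measurable (\<Omega> k \<Otimes>\<^sub>M \<mu>)" for k
      unfolding X_def \<Omega>_def \<mu>_def by (rule measurable_perm_field)
    have X_int: "\<forall>t\<in>space \<mu>. integrable (\<Omega> k) (\<lambda>p. X k p t ^ 4)" for k
      by (simp add: \<Omega>_def)
    have "(\<integral>p. X k p t ^ 4 \<partial>\<Omega> k) \<le> 3" for k t
    proof -
      have "(\<integral>p. X k p t ^ 4 \<partial>\<Omega> k) = (\<integral>p. Theta_perm U (m k) (n k) p t ^ 4 \<partial>\<Omega> k)"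
        using AE_perm[of k] by (intro integral_cong_AE) (auto simp: \<Omega>_def X_def perm_field_eq elim: eventually_mono)
      \<comment> \<open>Indicator values differ by at most 1, so the range is \<open>L = 1\<close>,
        uniformly in the sample sizes and in \<open>t\<close>.\<close>
      also have "\<dots> \<le> 1 ^ 4"
        unfolding \<Omega>_def Theta_perm_eq_two_sample
        by (rule two_sample_fourth_moment[OF mn(1,2)]) (auto simp: indicator_def)
      finally show ?thesis
        by simp
    qed
    then have "\<forall>t\<in>space \<mu>. (\<integral>p. X k p t ^ 4 \<partial>\<Omega> k) \<le> 3" for k
      by blast
    note X4 = fourth_moment_pair_measure[OF \<Omega> \<mu> X_meas X_int this]
    have X_energy: "AE p in \<Omega> k. sphere_energy (Theta_perm U (m k) (n k) p) = 2 * R * (\<integral>t. (X k p t)\<^sup>2 \<partial>\<mu>)" for k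
    proof -
      interpret \<Omega>: prob_space "\<Omega> k" by (rule \<Omega>)
      interpret P: pair_prob_space "\<Omega> k" \<mu> ..
      show ?thesis
        using AE_perm[of k] P.AE_integrable_fst'[OF X4(1)]
      proof eventually_elim
        case (elim p)
        have "X k p \<in> borel_measurable \<mu>"
          using measurable_Pair2[OF X_meas, of p] by (simp add: \<Omega>_def)
        then have "integrable \<mu> (\<lambda>t. (X k p t)\<^sup>2)"
          using elim(2) by (intro sq_int) auto
        then show ?case
          unfolding X_def \<mu>_def by (intro perm_field_energy mn(1,2) elim(1) U_cube R_def)
      qed
    qed
    have fd: "(\<lambda>k. \<integral>p. iexp (\<Sum>j<K. z j * X k p (t j)) \<partial>\<Omega> k) \<longlonglongrightarrow> (\<integral>\<omega>. iexp (\<Sum>j<K. z j * \<Theta> (t j) \<omega>) \<partial>M)"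
      if t: "\<And>j. j < K \<Longrightarrow> t j \<in> space \<mu>" for K :: nat and t z
    proof -
      have t': "t j \<in> sphere 0 1 \<times> UNIV" if "j \<in> {..<K}" for j
        using t that by (simp add: space\<mu>)
      have "(\<integral>p. iexp (\<Sum>j<K. z j * X k p (t j)) \<partial>\<Omega> k) =
          (\<integral>p. iexp (\<Sum>j<K. z j * Theta_perm U (m k) (n k) p (t j)) \<partial>\<Omega> k)" for k
        using AE_perm[of k] by (intro integral_cong_AE) (auto simp: \<Omega>_def X_def perm_field_eq elim: eventually_mono)
      moreover have "(\<lambda>k. \<integral>p. iexp (\<Sum>j<K. z j * Theta_perm U (m k) (n k) p (t j)) \<partial>\<Omega> k)
          \<longlonglongrightarrow> exp (- (\<Sum>j<K. \<Sum>l<K. z j * z l * halfspace_kernel (t j) (t l)) / 2)"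
        unfolding \<Omega>_def
      proof (rule Theta_perm_char_conv[OF mn])
        show "fst (t j) \<noteq> 0" if "j \<in> {..<K}" for j
          using t'[OF that] by auto
      qed (rule weak_conv_empirical_sequence[OF U_conv mn(1,3,4)])
      moreover have "(\<integral>\<omega>. iexp (\<Sum>j<K. z j * \<Theta> (t j) \<omega>) \<partial>M) =
          exp (- (\<Sum>j<K. \<Sum>l<K. z j * z l * halfspace_kernel (t j) (t l)) / 2)"
      proof -
        have "(\<Sum>j<K. \<Sum>l<K. z j * z l * cov_kernel M \<Theta> (t j) (t l)) = (\<Sum>j<K. \<Sum>l<K. z j * z l * halfspace_kernel (t j) (t l))"
          by (intro sum.cong refl arg_cong2[where f = "(*)"] cov t')
        then show ?thesis
          using gaussian_process_char[OF gauss mean', of "{..<K}" t z] t' by simp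
      qed
      ultimately show ?thesis
        by simp
    qed
    have "(\<lambda>k. \<integral>p. f (2 * R * (\<integral>t. (X k p t)\<^sup>2 \<partial>\<mu>)) \<partial>\<Omega> k) \<longlonglongrightarrow> (\<integral>\<omega>. f (2 * R * (\<integral>t. (\<Theta> t \<omega>)\<^sup>2 \<partial>\<mu>)) \<partial>M)"
    proof (rule Laplace_conv_imp_bounded_continuous_conv[OF \<Omega> M _ _ \<Theta>I_meas _ _ f(1) B])
      show "(\<lambda>p. 2 * R * (\<integral>t. (X k p t)\<^sup>2 \<partial>\<mu>)) \<in> borel_measurable (\<Omega> k)" for k
        by (simp add: \<Omega>_def)
      show "0 \<le> 2 * R * (\<integral>t. (X k p t)\<^sup>2 \<partial>\<mu>)" for k p
        using R by (intro mult_nonneg_nonneg integral_nonneg) auto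
      show "0 \<le> 2 * R * (\<integral>t. (\<Theta> t \<omega>)\<^sup>2 \<partial>\<mu>)" for \<omega>
        using R by (intro mult_nonneg_nonneg integral_nonneg) auto
      show "(\<lambda>k. \<integral>p. exp (- s * (2 * R * (\<integral>t. (X k p t)\<^sup>2 \<partial>\<mu>))) \<partial>\<Omega> k) \<longlonglongrightarrow>
          (\<integral>\<omega>. exp (- s * (2 * R * (\<integral>t. (\<Theta> t \<omega>)\<^sup>2 \<partial>\<mu>))) \<partial>M)" if "s \<ge> 0" for s
      proof -
        \<comment> \<open>The factor \<open>2 * R\<close> is absorbed into the Laplace parameter,
          leaving an average over the probability measure \<open>\<mu>\<close>.\<close>
        have "(\<lambda>k. \<integral>p. exp (- (s * (2 * R)) * (\<integral>t. (X k p t)\<^sup>2 \<partial>\<mu>)) \<partial>\<Omega> k) \<longlonglongrightarrow>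
            (\<integral>\<omega>. exp (- (s * (2 * R)) * (\<integral>t. (\<Theta> t \<omega>)\<^sup>2 \<partial>\<mu>)) \<partial>M)"
          by (rule Laplace_square_integral_conv[OF \<Omega> M \<mu> X_meas X4 \<Theta>_meas \<Theta>4 fd]) (use R that in auto)
        then show ?thesis
          by (simp only: mult_minus_left mult.assoc)
      qed
    qed
    moreover have "(\<integral>x. f x \<partial>distr (\<Omega> k) borel (\<lambda>p. sphere_energy (Theta_perm U (m k) (n k) p))) =
        (\<integral>p. f (2 * R * (\<integral>t. (X k p t)\<^sup>2 \<partial>\<mu>)) \<partial>\<Omega> k)" for k
    proof -
      have "(\<integral>x. f x \<partial>distr (\<Omega> k) borel (\<lambda>p. sphere_energy (Theta_perm U (m k) (n k) p))) =
          (\<integral>p. f (sphere_energy (Theta_perm U (m k) (n k) p)) \<partial>\<Omega> k)"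
        by (rule integral_distr) (auto simp: \<Omega>_def)
      also have "\<dots> = (\<integral>p. f (2 * R * (\<integral>t. (X k p t)\<^sup>2 \<partial>\<mu>)) \<partial>\<Omega> k)"
        using X_energy[of k] by (intro integral_cong_AE) (auto simp: \<Omega>_def elim: eventually_mono)
      finally show ?thesis .
    qed
    moreover have "(\<integral>x. f x \<partial>distr M borel (\<lambda>\<omega>. sphere_energy (\<lambda>t. \<Theta> t \<omega>))) = (\<integral>\<omega>. f (2 * R * (\<integral>t. (\<Theta> t \<omega>)\<^sup>2 \<partial>\<mu>)) \<partial>M)"
    proof -
      have "(\<integral>x. f x \<partial>distr M borel (\<lambda>\<omega>. sphere_energy (\<lambda>t. \<Theta> t \<omega>))) = (\<integral>\<omega>. f (sphere_energy (\<lambda>t. \<Theta> t \<omega>)) \<partial>M)"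
        by (rule integral_distr[OF energy_meas f_meas])
      also have "\<dots> = (\<integral>\<omega>. f (2 * R * (\<integral>t. (\<Theta> t \<omega>)\<^sup>2 \<partial>\<mu>)) \<partial>M)"
        using limit_energy energy_meas \<Theta>I_meas
        by (intro integral_cong_AE measurable_compose[OF _ f_meas]) (auto elim: eventually_mono)
      finally show ?thesis .
    qed
    ultimately show "(\<lambda>k. \<integral>x. f x \<partial>(case (m k, n k) of (m, n) \<Rightarrow> distr (random_permutation (m + n)) borel
        (\<lambda>p. sphere_energy (Theta_perm U m n p)))) \<longlonglongrightarrow> (\<integral>x. f x \<partial>distr M borel (\<lambda>\<omega>. sphere_energy (\<lambda>t. \<Theta> t \<omega>)))"
      by (simp add: \<Omega>_def)
  qed
qed

end
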